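(* In the regression setting described in the context, let $A_+,A_-,\alpha>0$ and let $m$ be a linear subspace of $L_2(P^X)$ of finite dimension $D_m$ admitting a strongly localized basis $(\varphi_k)_{k=1}^{D_m}$ with parameters $r_m$, $b_m$, $(\Pi_i)_{i=1}^{b_m}$, $(A_i)_{i=1}^{b_m}$, $A_c$. Assume that there is a constant $A>0$ such that $|Y_i|\le A<\infty$ and $\|s_m\|_\infty\le A<\infty$, and that $\sigma(X_i)\ge\sigma_{\min}>0$ a.s. If $$A_-(\ln n)^2\le D_m\le\max\{D_m,b_m^2A_{b_m}\}\le A_+\frac{n}{(\ln n)^2},$$ then there exists a constant $L_0>0$, depending only on $\alpha,A_-$ and on the constants $A,\sigma_{\min},r_m$, such that, setting $$\varepsilon_n=L_0\max\left\{\left(\frac{\ln n}{D_m}\right)^{1/4},\left(\frac{D_m\ln n}{n}\right)^{1/4}\right\},$$ we have for all $n\ge n_0$, where $n_0$ depends only on $A_-,A_+,A,r_m,\sigma_{\min},\alpha$, $$\mathbb{P}\left[(1-\varepsilon_n)\frac{\mathcal{C}_m}{n}\le\ell(s_m,\widehat{s}_m)\le(1+\varepsilon_n)\frac{\mathcal{C}_m}{n}\right]\ge1-10n^{-\alpha},$$ $$\mathbb{P}\left[(1-\varepsilon_n^2)\frac{\mathcal{C}_m}{n}\le\ell_{\mathrm{emp}}(\widehat{s}_m,s_m)\le(1+\varepsilon_n^2)\frac{\mathcal{C}_m}{n}\right]\ge1-5n^{-\alpha},$$ where $\mathcal{C}_m=\sum_{k=1}^{D_m}\mathrm{Var}\b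ig((Y-s_m(X))\,\varphi_k(X)\big)$.
   Context: Setting. $(X_i,Y_i)$, $i=1,\dots,n$, are i.i.d. with law $P$ on $\mathcal{X}\times\mathbb{R}$, $\mathcal{X}\subset\mathbb{R}^d$, with the same law as $(X,Y)$, and $Y=s_*(X)+\sigma(X)\varepsilon$, where $s_*\in L_2(P^X)$ ($P^X$ the law of $X$), $\mathbb{E}[\varepsilon|X]=0$, $\mathbb{E}[\varepsilon^2|X]=1$ and $\sigma:\mathcal{X}\to\mathbb{R}_+$. $\|\cdot\|_2$ is the norm of $L_2(P^X)$ and $\|\cdot\|_\infty$ the sup-norm. $\gamma(s)(x,y)=(y-s(x))^2$, $Pf=\mathbb{E}[f(X,Y)]$ (for a data-dependent $f$, integration is over an independent $(X,Y)$ only), $P_n=n^{-1}\sum_{i=1}^n\delta_{(X_i,Y_i)}$. $s_m$ is the orthogonal projection of $s_*$ onto $m$ in $L_2(P^X)$, and $\widehat{s}_m\in\arg\min_{s\in m}P_n(\gamma(s))$ is a least-squares estimator. $\ell(s_m,\widehat{s}_m)=P(\gamma(\widehat{s}_m)-\gamma(s_m))=\|\widehat{s}_m-s_m\|_2^2$ is the excess risk on $m$, and $\ell_{\mathrm{emp}}(\widehat{s}_m,s_m)=P_n(\gamma(s_m)-\gamma(\widehat{s}_m))$ is the empirical excess risk on $m$. Strongly localized basis: an orthonormal basis $(\varphi_k)_{k=1}^{D_m}$ of $(m,\|\cdot\|_2)$ is strongly localized with parameters $r_m$, $b_m$, $(\Pi_i)_{i=1}^{b_m}$, $(A_i)_{i=1}^{b_m}$,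 $A_c$ if $r_m>0$, $b_m\in\mathbb{N}\setminus\{0\}$, $(\Pi_i)_{i=1}^{b_m}$ is a partition of $\{1,\dots,D_m\}$, $1\le A_1\le\dots\le A_{b_m}<+\infty$, $A_c>0$, and: (i) $\sum_{i=1}^{b_m}\sqrt{A_i}\le r_m\sqrt{D_m}$; (ii) $\|\varphi_k\|_\infty\le r_m\sqrt{A_i}$ for all $i$ and all $k\in\Pi_i$; (iii) for all $i,j$, $\max_{k\in\Pi_i}\mathrm{Card}(\Pi_{j|k})\le A_c\max\{A_jA_i^{-1},1\}$, where $\Pi_{j|k}=\{l\in\Pi_j:\mathrm{supp}(\varphi_k)\cap\mathrm{supp}(\varphi_l)\ne\emptyset\}$.
   Formalization: The constants L_0 and n_0 are also allowed to depend on the overlap constant A_c of the strongly localized basis; without dependence on A_c the claim fails, since taking A_c = D_m makes condition (iii) empty. *)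

theory Defs
  imports "HOL-Probability.Probability" "HOL-Library.Disjoint_Sets"
begin

(* Points of R^d are extensional functions on {..<d}, so that the dimension d is an ordinary
   number: the constants of the theorem are then the same for all d. *)
type_synonym point = "nat \<Rightarrow> real"

(* The set \<X> \<subseteq> R^d with the trace of the Borel sigma-algebra of R^d; the measure carried by
   this object is irrelevant. *)
definition design_space :: "nat \<Rightarrow> point set \<Rightarrow> point measure" where
  "design_space d \<X> = restrict_space (PiM {..<d} (\<lambda>_. borel)) \<X>"

(* Q is the joint law of (X, \<epsilon>), with E[\<epsilon> | X] = 0 and E[\<epsilon>^2 | X] = 1;
   conditioning is on the sigma-algebra generated by the first coordinate. *)
definition noise_law :: "point measure \<Rightarrow> (point \<times> real) measure \<Rightarrow> bool" where
  "noise_law S Q \<longleftrightarrow>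
     prob_space Q \<and> sets Q = sets (S \<Otimes>\<^sub>M borel) \<and>
     integrable Q (\<lambda>w. (snd w)\<^sup>2) \<and>
     (AE w in Q. real_cond_exp Q (vimage_algebra (space Q) fst S) snd w = 0) \<and>
     (AE w in Q. real_cond_exp Q (vimage_algebra (space Q) fst S) (\<lambda>w. (snd w)\<^sup>2) w = 1)"

(* The law P of (X, Y), where Y = s_*(X) + \<sigma>(X) \<epsilon>. *)
definition regression_law ::
  "point measure \<Rightarrow> (point \<times> real) measure \<Rightarrow> (point \<Rightarrow> real) \<Rightarrow> (point \<Rightarrow> real)
     \<Rightarrow> (point \<times> real) measure" where
  "regression_law S Q s_star \<sigma> =
     distr Q (S \<Otimes>\<^sub>M borel) (\<lambda>(x, e). (x, s_star x + \<sigma> x * e))"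

definition design_law :: "point measure \<Rightarrow> (point \<times> real) measure \<Rightarrow> point measure" where
  "design_law S P = distr P S fst"

(* L_2 is represented by functions, not by classes of functions, since the empirical risk and
   the sup-norm below evaluate them at points. *)
definition L2_fun :: "'a measure \<Rightarrow> ('a \<Rightarrow> real) set" where
  "L2_fun M = {f \<in> borel_measurable M. integrable M (\<lambda>x. (f x)\<^sup>2)}"

definition L2_inner :: "'a measure \<Rightarrow> ('a \<Rightarrow> real) \<Rightarrow> ('a \<Rightarrow> real) \<Rightarrow> real" where
  "L2_inner M f g = (LINT x|M. f x * g x)"

definition linear_L2_subspace :: "'a measure \<Rightarrow> ('a \<Rightarrow> real) set \<Rightarrow> bool" where
  "linear_L2_subspace M m \<longleftrightarrow>
     m \<subseteq> L2_fun M \<and> (\<lambda>_. 0) \<in> m \<and>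
     (\<forall>f\<in>m. \<forall>g\<in>m. (\<lambda>x. f x + g x) \<in> m) \<and> (\<forall>c. \<forall>f\<in>m. (\<lambda>x. c * f x) \<in> m)"

(* The functions in m are combinations of the basis at every point of the space and not only
   almost everywhere: otherwise m could contain versions interpolating the data, and
   least-squares estimators over m would be meaningless. *)
definition orthonormal_basis ::
  "'a measure \<Rightarrow> ('a \<Rightarrow> real) set \<Rightarrow> nat \<Rightarrow> (nat \<Rightarrow> 'a \<Rightarrow> real) \<Rightarrow> bool" where
  "orthonormal_basis M m D \<phi> \<longleftrightarrow>
     (\<forall>k\<in>{1..D}. \<phi> k \<in> m) \<and>
     (\<forall>k\<in>{1..D}. \<forall>l\<in>{1..D}. L2_inner M (\<phi> k) (\<phi> l) = (if k = l then 1 else 0)) \<and>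
     (\<forall>f\<in>m. \<exists>c. \<forall>x\<in>space M. f x = (\<Sum>k=1..D. c k * \<phi> k x))"

definition sup_norm :: "'a set \<Rightarrow> ('a \<Rightarrow> real) \<Rightarrow> ereal" where
  "sup_norm \<X> f = (SUP x\<in>\<X>. ereal \<bar>f x\<bar>)"

(* The support of a function is the set of points where it does not vanish; no closure is taken. *)
definition strongly_localized_basis ::
  "'a measure \<Rightarrow> ('a \<Rightarrow> real) set \<Rightarrow> nat \<Rightarrow> (nat \<Rightarrow> 'a \<Rightarrow> real) \<Rightarrow>
     real \<Rightarrow> nat \<Rightarrow> (nat \<Rightarrow> nat set) \<Rightarrow> (nat \<Rightarrow> real) \<Rightarrow> real \<Rightarrow> bool" where
  "strongly_localized_basis M m D \<phi> r b parts a A\<^sub>c \<longleftrightarrow>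
     orthonormal_basis M m D \<phi> \<and>
     r > 0 \<and> b \<ge> 1 \<and> A\<^sub>c > 0 \<and>
     partition_on {1..D} (parts ` {1..b}) \<and> inj_on parts {1..b} \<and>
     1 \<le> a 1 \<and> mono_on {1..b} a \<and>
     (\<Sum>i=1..b. sqrt (a i)) \<le> r * sqrt (real D) \<and>
     (\<forall>i\<in>{1..b}. \<forall>k\<in>parts i. sup_norm (space M) (\<phi> k) \<le> ereal (r * sqrt (a i))) \<and>
     (\<forall>i\<in>{1..b}. \<forall>j\<in>{1..b}. \<forall>k\<in>parts i.
        real (card {l \<in> parts j. support_on (space M) (\<phi> k) \<inter> support_on (space M) (\<phi> l) \<noteq> {}})
          \<le> A\<^sub>c * max (a j / a i) 1)"

definition orthogonal_projection_on ::
  "'a measure \<Rightarrow> ('a \<Rightarrow> real) set \<Rightarrow> ('a \<Rightarrow> real) \<Rightarrow> ('a \<Rightarrow> real) \<Rightarrow> bool" where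
  "orthogonal_projection_on M m f p \<longleftrightarrow>
     p \<in> m \<and> (\<forall>t\<in>m. L2_inner M (\<lambda>x. f x - p x) t = 0)"

definition contrast :: "('a \<Rightarrow> real) \<Rightarrow> 'a \<times> real \<Rightarrow> real" where
  "contrast s = (\<lambda>(x, y). (y - s x)\<^sup>2)"

(* Law of an i.i.d. sample z 1, ..., z n from P, where z i = (X_i, Y_i). *)
definition sample_law :: "nat \<Rightarrow> 'b measure \<Rightarrow> (nat \<Rightarrow> 'b) measure" where
  "sample_law n P = PiM {1..n} (\<lambda>_. P)"

definition empirical_mean :: "nat \<Rightarrow> (nat \<Rightarrow> 'b) \<Rightarrow> ('b \<Rightarrow> real) \<Rightarrow> real" where
  "empirical_mean n z f = (\<Sum>i=1..n. f (z i)) / real n"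

(* An estimator maps a sample to a function; measurability makes the events below events. *)
definition least_squares_estimator ::
  "point measure \<Rightarrow> (point \<times> real) measure \<Rightarrow> (point \<Rightarrow> real) set \<Rightarrow> nat
     \<Rightarrow> ((nat \<Rightarrow> point \<times> real) \<Rightarrow> point \<Rightarrow> real) \<Rightarrow> bool" where
  "least_squares_estimator S P m n s_hat \<longleftrightarrow>
     (\<lambda>(z, x). s_hat z x) \<in> borel_measurable (sample_law n P \<Otimes>\<^sub>M S) \<and>
     (\<forall>z\<in>space (sample_law n P).
        is_arg_min (\<lambda>s. empirical_mean n z (contrast s)) (\<lambda>s. s \<in> m) (s_hat z))"

definition excess_risk ::
  "('a \<times> real) measure \<Rightarrow> ('a \<Rightarrow> real) \<Rightarrow> ('a \<Rightarrow> real) \<Rightarrow> real" where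
  "excess_risk P s t = (LINT w|P. contrast t w - contrast s w)"

definition empirical_excess_risk ::
  "nat \<Rightarrow> (nat \<Rightarrow> 'a \<times> real) \<Rightarrow> ('a \<Rightarrow> real) \<Rightarrow> ('a \<Rightarrow> real) \<Rightarrow> real" where
  "empirical_excess_risk n z t s = empirical_mean n z (\<lambda>w. contrast s w - contrast t w)"

definition model_complexity ::
  "('a \<times> real) measure \<Rightarrow> nat \<Rightarrow> (nat \<Rightarrow> 'a \<Rightarrow> real) \<Rightarrow> ('a \<Rightarrow> real) \<Rightarrow> real" where
  "model_complexity P D \<phi> s\<^sub>m =
     (\<Sum>k=1..D. prob_space.variance P (\<lambda>(x, y). (y - s\<^sub>m x) * \<phi> k x))"

end

theory Submission
  imports Defs
begin

text \<open>
  Let \<open>f\<close> be the vector of basis functions, \<open>\<xi> = Y - s\<^sub>m(X)\<close> the residual, \<open>G = P\<^sub>n f f\<^sup>T\<close>,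
  \<open>v = P\<^sub>n \<xi> f\<close>, and \<open>\<beta>\<close> the coefficients of the estimator minus those of \<open>s\<^sub>m\<close>. Then \<open>G \<beta> = v\<close>,
  the excess risk is \<open>\<bar>\<beta>\<bar>\<^sup>2\<close> and the empirical excess risk is \<open>\<beta> \<bullet> v\<close>. With \<open>\<Delta> = G - 1\<close>, the first is
  \<open>\<bar>v\<bar>\<^sup>2 (1 + O(\<bar>\<Delta>\<bar>))\<close>, and the second \<open>\<bar>v\<bar>\<^sup>2 - v \<bullet> \<Delta> v + O(\<bar>\<Delta>\<bar>\<^sup>2 \<bar>v\<bar>\<^sup>2)\<close>. Three estimates remain,
  where \<open>\<epsilon>\<^sup>2\<close> is the larger of \<open>(ln n / D)\<^bsup>1/2\<^esup>\<close> and \<open>(D ln n / n)\<^bsup>1/2\<^esup>\<close>.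

  First, \<open>\<bar>v\<bar>\<^sup>2 = C / n (1 + O(\<epsilon>\<^sup>2))\<close> and \<open>v \<bullet> \<Delta> v = O(\<epsilon>\<^sup>2 \<bar>v\<bar>\<^sup>2)\<close>. Both are followed along the sample: revealing the
  observations one at a time decomposes \<open>\<bar>v\<bar>\<^sup>2\<close> and \<open>v \<bullet> G v\<close> into martingales, which are
  controlled by a Bernstein inequality after truncation. This uses nothing but
  \<open>\<bar>f\<bar>\<^sup>2 = O(D)\<close> and \<open>\<bar>G\<bar> \<le> 2\<close>, and avoids Talagrand's inequality as well as matrix concentration.

  Second, \<open>\<bar>\<Delta>\<bar> = O(\<epsilon>)\<close>. Bernstein's inequality bounds each entry of \<open>\<Delta>\<close>, and the sparsity of a localized
  basis together with a Schur test gives \<open>\<bar>\<Delta>\<bar>\<^sup>2 = O(b (A\<^sub>b D)\<^bsup>1/2\<^esup> ln n / n)\<close>, which the hypothesis on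
  \<open>b\<^sup>2 A\<^sub>b\<close> turns into \<open>o((D ln n / n)\<^bsup>1/2\<^esup>)\<close>.
\<close>

section \<open>Bernstein's inequality for martingale differences on product spaces\<close>

text \<open>The empirical risk is claimed to accuracy \<open>\<epsilon>^2\<close>, while
  \<open>\<Delta>\<close> is only of size \<open>\<epsilon>\<close>: bounding
  \<open>v . \<Delta> v\<close> by the operator norm loses one order. Hence this form is expanded as
  a polynomial in the sample. Its two halves, \<open>v . G v\<close> and \<open>|v|^2\<close>, have
  the same leading diagonal part after normalization, so that only fluctuations and lower order
  terms survive in the difference.

  The obstacle is circular: the coefficients of the martingales are the running scores, whose size
  is among the quantities to be bounded. Cutting each increment off by an indicator of the past
  keeps it centered and makes it bounded; an induction along the sample then shows that the cut-off
  is inactive on the good event.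

  All errors come out in the unit \<open>L^2 N / n\<close>. They become relative because the lower
  bound on the noise forces \<open>C >= \<sigma>_min^2 D\<close>, whereas localization gives
  \<open>N = O(D)\<close>. The constant \<open>A_plus\<close> is absorbed by powers of
  \<open>ln n\<close>, so only the threshold on \<open>n\<close> feels it.\<close>

lemma exp_le_quadratic:
  fixes x :: real
  assumes "\<bar>x\<bar> \<le> 1"
  shows "exp x \<le> 1 + x + x\<^sup>2"
proof (cases "0 \<le> x")
  case True
  then show ?thesis using exp_bound assms by auto
next
  case False
  define y where "y = -x"
  have y: "0 \<le> y" "y \<le> 1" using False assms by (auto simp: y_def)
  \<comment> \<open>For negative arguments the upper bound is the inverse of the lower Taylor bound
    for \<open>exp y\<close>: it suffices that the product of the two polynomials is at least
    1.\<close>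
  have "1 \<le> (1 + y + y\<^sup>2/2) * (1 - y + y\<^sup>2)"
  proof -
    have "(1 + y + y\<^sup>2/2) * (1 - y + y\<^sup>2) - 1 = y\<^sup>2/2 + y^3/2 + y^4/2"
      by (simp add: field_simps power2_eq_square power3_eq_cube power4_eq_xxxx)
    also have "\<dots> \<ge> 0" using y by auto
    finally show ?thesis by linarith
  qed
  also have "\<dots> \<le> exp y * (1 - y + y\<^sup>2)"
  proof (rule mult_right_mono)
    show "1 + y + y\<^sup>2/2 \<le> exp y" by (rule exp_lower_Taylor_quadratic) (use y in auto)
    have "1 - y \<ge> 0" using y by simp
    then show "0 \<le> 1 - y + y\<^sup>2" by auto
  qed
  finally have "exp (-y) \<le> 1 - y + y\<^sup>2"
    by (simp add: exp_minus field_simps)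
  then show ?thesis by (simp add: y_def)
qed

text \<open>The event \<open>E\<close> itself need not be measurable.\<close>

definition whp :: "'z measure \<Rightarrow> real \<Rightarrow> ('z \<Rightarrow> bool) \<Rightarrow> bool" where
  "whp M \<delta> E \<longleftrightarrow> (\<exists>B\<in>sets M. measure M B \<le> \<delta> \<and> (\<forall>z\<in>space M - B. E z))"

lemma whpI:
  assumes "{z \<in> space M. \<not> E z} \<in> sets M" "measure M {z \<in> space M. \<not> E z} \<le> \<delta>"
  shows "whp M \<delta> E"
  unfolding whp_def using assms by (intro bexI[of _ "{z \<in> space M. \<not> E z}"]) auto

lemma whp_mono:
  assumes "whp M \<delta> E" "\<And>z. z \<in> space M \<Longrightarrow> E z \<Longrightarrow> E' z" "\<delta> \<le> \<delta>'"
  shows "whp M \<delta>' E'"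
  using assms unfolding whp_def by (meson DiffD1 order_trans)

lemma whp_conj:
  assumes "whp M \<delta> E" "whp M \<delta>' E'"
  shows "whp M (\<delta> + \<delta>') (\<lambda>z. E z \<and> E' z)"
proof -
  obtain B B' where "B \<in> sets M" "measure M B \<le> \<delta>" "\<And>z. z \<in> space M - B \<Longrightarrow> E z"
    "B' \<in> sets M" "measure M B' \<le> \<delta>'" "\<And>z. z \<in> space M - B' \<Longrightarrow> E' z"
    using assms unfolding whp_def by blast
  then show ?thesis
    unfolding whp_def using measure_Un_le[of B M B'] by (intro bexI[of _ "B \<union> B'"]) auto
qed

lemma whp_ball:
  assumes "finite J" "\<And>j. j \<in> J \<Longrightarrow> whp M \<delta> (E j)"
  shows "whp M (real (card J) * \<delta>) (\<lambda>z. \<forall>j\<in>J. E j z)"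
proof -
  obtain B where B: "\<And>j. j \<in> J \<Longrightarrow> B j \<in> sets M" "\<And>j. j \<in> J \<Longrightarrow> measure M (B j) \<le> \<delta>"
    "\<And>j z. j \<in> J \<Longrightarrow> z \<in> space M - B j \<Longrightarrow> E j z"
    using assms(2) unfolding whp_def by metis
  have "measure M (\<Union>j\<in>J. B j) \<le> (\<Sum>j\<in>J. measure M (B j))"
    using assms B by (intro measure_UNION_le) auto
  also have "\<dots> \<le> (\<Sum>j\<in>J. \<delta>)" using B by (intro sum_mono) auto
  finally have "measure M (\<Union>j\<in>J. B j) \<le> real (card J) * \<delta>" by simp
  moreover have "(\<Union>j\<in>J. B j) \<in> sets M" using B assms by auto
  ultimately show ?thesis unfolding whp_def using B(3) by (intro bexI[of _ "\<Union>j\<in>J. B j"]) auto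
qed

text \<open>The linear term of the quadratic bound on \<open>exp\<close> integrates to zero. Moving
  the variance back into an exponent by \<open>1 + x <= exp x\<close> gives factors that multiply
  along the sample.\<close>

lemma mgf_bounded_centered:
  fixes g :: "'b \<Rightarrow> real"
  assumes "prob_space P" and g[measurable]: "g \<in> borel_measurable P"
    and bnd: "\<And>w. w \<in> space P \<Longrightarrow> \<bar>g w\<bar> \<le> M"
    and mean: "(LINT w|P. g w) = 0" and var: "(LINT w|P. (g w)\<^sup>2) \<le> s"
    and l: "\<bar>l\<bar> * M \<le> 1"
  shows "(\<integral>\<^sup>+ w. ennreal (exp (l * g w)) \<partial>P) \<le> ennreal (exp (l\<^sup>2 * s))"
proof -
  interpret prob_space P by fact
  have ig: "integrable P g"
    by (rule integrable_const_bound[where B=M]) (use bnd in auto)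
  have sq: "(g w)\<^sup>2 \<le> M\<^sup>2" if "w \<in> space P" for w
    using bnd[OF that] by (metis abs_ge_zero power2_abs power_mono)
  have ig2: "integrable P (\<lambda>w. (g w)\<^sup>2)"
    by (rule integrable_const_bound[where B="M\<^sup>2"]) (use sq in auto)
  have pt: "exp (l * g w) \<le> 1 + l * g w + l\<^sup>2 * (g w)\<^sup>2" if "w \<in> space P" for w
  proof -
    have "\<bar>l * g w\<bar> \<le> \<bar>l\<bar> * M" using bnd[OF that] by (simp add: abs_mult mult_left_mono)
    then show ?thesis using exp_le_quadratic[of "l * g w"] l by (simp add: power_mult_distrib)
  qed
  have "(\<integral>\<^sup>+ w. ennreal (exp (l * g w)) \<partial>P) \<le> (\<integral>\<^sup>+ w. ennreal (1 + l * g w + l\<^sup>2 * (g w)\<^sup>2) \<partial>P)"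
    by (rule nn_integral_mono) (use pt in \<open>auto intro: ennreal_leI\<close>)
  also have "\<dots> = ennreal (LINT w|P. 1 + l * g w + l\<^sup>2 * (g w)\<^sup>2)"
  proof (rule nn_integral_eq_integral)
    show "integrable P (\<lambda>w. 1 + l * g w + l\<^sup>2 * (g w)\<^sup>2)" using ig ig2 by auto
    show "AE w in P. 0 \<le> 1 + l * g w + l\<^sup>2 * (g w)\<^sup>2"
      by (rule AE_I2) (meson exp_ge_zero order_trans pt)
  qed
  also have "(LINT w|P. 1 + l * g w + l\<^sup>2 * (g w)\<^sup>2) = 1 + l\<^sup>2 * (LINT w|P. (g w)\<^sup>2)"
    using ig ig2 mean by (simp add: prob_space)
  also have "\<dots> \<le> 1 + l\<^sup>2 * s" using var by (simp add: mult_left_mono)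
  also have "\<dots> \<le> exp (l\<^sup>2 * s)" by (rule exp_ge_add_one_self)
  finally show ?thesis by (simp add: ennreal_leI)
qed

text \<open>The product structure replaces a filtration: by \<open>dep\<close>, the increment
  \<open>d k\<close> sees only the coordinates \<open>e 1, ..., e (k - 1)\<close>, and
  \<open>e k\<close> is fresh. Integrating out the last coordinate first costs a factor
  \<open>exp (l^2 s)\<close> uniformly in the past, which drives the induction. The enumeration
  \<open>e\<close> permits any order of revelation.\<close>

lemma martingale_mgf:
  fixes P :: "'b measure" and e :: "nat \<Rightarrow> 'i" and d :: "nat \<Rightarrow> ('i \<Rightarrow> 'b) \<Rightarrow> 'b \<Rightarrow> real"
  assumes P: "prob_space P"
    and inj: "inj_on e {1..n}"
    and meas: "\<And>k. k \<in> {1..n} \<Longrightarrow>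
        (\<lambda>(z, w). d k z w) \<in> borel_measurable (PiM (e ` {1..<k}) (\<lambda>_. P) \<Otimes>\<^sub>M P)"
    and dep: "\<And>k z z'. (\<And>i. i \<in> {1..<k} \<Longrightarrow> z (e i) = z' (e i)) \<Longrightarrow> d k z = d k z'"
    and bnd: "\<And>k z w. k \<in> {1..n} \<Longrightarrow> z \<in> space (PiM (e ` {1..<k}) (\<lambda>_. P)) \<Longrightarrow> w \<in> space P
        \<Longrightarrow> \<bar>d k z w\<bar> \<le> M"
    and mean: "\<And>k z. k \<in> {1..n} \<Longrightarrow> z \<in> space (PiM (e ` {1..<k}) (\<lambda>_. P))
        \<Longrightarrow> (LINT w|P. d k z w) = 0"
    and var: "\<And>k z. k \<in> {1..n} \<Longrightarrow> z \<in> space (PiM (e ` {1..<k}) (\<lambda>_. P))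
        \<Longrightarrow> (LINT w|P. (d k z w)\<^sup>2) \<le> s"
    and l: "\<bar>l\<bar> * M \<le> 1"
  shows "(\<lambda>z. \<Sum>k=1..n. d k z (z (e k))) \<in> borel_measurable (PiM (e ` {1..n}) (\<lambda>_. P)) \<and>
    (\<integral>\<^sup>+ z. ennreal (exp (l * (\<Sum>k=1..n. d k z (z (e k))))) \<partial>PiM (e ` {1..n}) (\<lambda>_. P))
      \<le> ennreal (exp (real n * (l\<^sup>2 * s)))"
  using inj meas bnd mean var
proof (induction n)
  case 0
  interpret product_prob_space "\<lambda>_::'i. P" "{}" by (rule product_prob_spaceI) (rule P)
  show ?case by (simp add: space_PiM_empty)
next
  case (Suc n)
  interpret prob_space P by fact
  interpret PP: product_prob_space "\<lambda>_::'i. P" "{}" by (rule product_prob_spaceI) (rule P)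
  let ?I = "e ` {1..n}" and ?i = "e (Suc n)"
  let ?Q = "PiM ?I (\<lambda>_. P)" and ?Q' = "PiM (e ` {1..Suc n}) (\<lambda>_. P)"
  have ins: "e ` {1..Suc n} = insert ?i ?I"
    by (auto simp: atLeastAtMostSuc_conv)
  have nin: "?i \<notin> ?I"
    using Suc.prems(1) inj_on_image_mem_iff[of e "{1..Suc n}" "Suc n" "{1..n}"] by auto
  have lt: "{1..<Suc n} = {1..n}" by auto
  let ?T = "\<lambda>z. \<Sum>k=1..n. d k z (z (e k))"
  have IH: "?T \<in> borel_measurable ?Q"
    "(\<integral>\<^sup>+ z. ennreal (exp (l * ?T z)) \<partial>?Q) \<le> ennreal (exp (real n * (l\<^sup>2 * s)))"
    using Suc.IH Suc.prems by (auto simp: inj_on_def)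
  note IH(1)[measurable]
  have dm: "(\<lambda>(z, w). d (Suc n) z w) \<in> borel_measurable (?Q \<Otimes>\<^sub>M P)"
    using Suc.prems(2)[of "Suc n", unfolded lt] by simp
  \<comment> \<open>Restricting to the earlier coordinates turns past terms into functions on the
    smaller product, as needed for integrating over one inserted coordinate.\<close>
  have Teq: "(\<Sum>k=1..Suc n. d k z (z (e k))) = ?T (restrict z ?I) + d (Suc n) (restrict z ?I) (z ?i)" for z
  proof -
    have "d k z = d k (restrict z ?I)" if "k \<in> {1..Suc n}" for k
      by (rule dep) (use that in auto)
    then show ?thesis by (auto intro!: sum.cong)
  qed
  have r: "(\<lambda>z. restrict z ?I) \<in> measurable ?Q' ?Q"
    by (rule measurable_restrict_subset) (auto simp: ins)
  have c: "(\<lambda>z. z ?i) \<in> measurable ?Q' P" by (rule measurable_component_singleton) auto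
  have m: "(\<lambda>z. \<Sum>k=1..Suc n. d k z (z (e k))) \<in> borel_measurable ?Q'"
    unfolding Teq using measurable_compose[OF r IH(1)]
      measurable_compose[OF measurable_Pair[OF r c] dm] by simp
  have "(\<integral>\<^sup>+ z. ennreal (exp (l * (\<Sum>k=1..Suc n. d k z (z (e k))))) \<partial>?Q')
     = (\<integral>\<^sup>+ z. (\<integral>\<^sup>+ w. ennreal (exp (l * (\<Sum>k=1..Suc n. d k (z(?i := w)) ((z(?i := w)) (e k))))) \<partial>P) \<partial>?Q)"
  proof -
    have "(\<lambda>z. ennreal (exp (l * (\<Sum>k=1..Suc n. d k z (z (e k)))))) \<in> borel_measurable ?Q'"
      using m by measurable
    then show ?thesis
      unfolding ins by (intro PP.product_nn_integral_insert) (use nin in auto)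
  qed
  also have "\<dots> = (\<integral>\<^sup>+ z. ennreal (exp (l * ?T z)) * (\<integral>\<^sup>+ w. ennreal (exp (l * d (Suc n) z w)) \<partial>P) \<partial>?Q)"
  proof (rule nn_integral_cong)
    fix z assume z: "z \<in> space ?Q"
    have [measurable]: "d (Suc n) z \<in> borel_measurable P"
      using measurable_compose_Pair1[OF z dm] by simp
    have "(\<Sum>k=1..Suc n. d k (z(?i := w)) ((z(?i := w)) (e k))) = ?T z + d (Suc n) z w" for w
    proof -
      have "restrict (z(?i := w)) ?I = z"
        using z nin by (auto simp: space_PiM fun_eq_iff PiE_def extensional_def)
      then show ?thesis unfolding Teq by simp
    qed
    then show "(\<integral>\<^sup>+ w. ennreal (exp (l * (\<Sum>k=1..Suc n. d k (z(?i := w)) ((z(?i := w)) (e k))))) \<partial>P)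
      = ennreal (exp (l * ?T z)) * (\<integral>\<^sup>+ w. ennreal (exp (l * d (Suc n) z w)) \<partial>P)"
      by (simp add: distrib_left exp_add ennreal_mult nn_integral_cmult)
  qed
  also have "\<dots> \<le> (\<integral>\<^sup>+ z. ennreal (exp (l * ?T z)) * ennreal (exp (l\<^sup>2 * s)) \<partial>?Q)"
  proof (rule nn_integral_mono)
    fix z assume z: "z \<in> space ?Q"
    have [measurable]: "d (Suc n) z \<in> borel_measurable P"
      using measurable_compose_Pair1[OF z dm] by simp
    have "(\<integral>\<^sup>+ w. ennreal (exp (l * d (Suc n) z w)) \<partial>P) \<le> ennreal (exp (l\<^sup>2 * s))"
      by (rule mgf_bounded_centered[where M=M])
        (use P Suc.prems(3-5)[of "Suc n" z] l z lt in \<open>auto\<close>)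
    then show "ennreal (exp (l * ?T z)) * (\<integral>\<^sup>+ w. ennreal (exp (l * d (Suc n) z w)) \<partial>P)
      \<le> ennreal (exp (l * ?T z)) * ennreal (exp (l\<^sup>2 * s))" by (rule mult_left_mono) simp
  qed
  also have "\<dots> = (\<integral>\<^sup>+ z. ennreal (exp (l * ?T z)) \<partial>?Q) * ennreal (exp (l\<^sup>2 * s))"
    by (rule nn_integral_multc) measurable
  also have "\<dots> \<le> ennreal (exp (real n * (l\<^sup>2 * s))) * ennreal (exp (l\<^sup>2 * s))"
    by (rule mult_right_mono[OF IH(2)]) simp
  also have "\<dots> = ennreal (exp (real (Suc n) * (l\<^sup>2 * s)))"
    by (simp add: ennreal_mult[symmetric] exp_add[symmetric] algebra_simps)
  finally show ?case using m by simp
qed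

lemma Chernoff_two_sided:
  assumes "prob_space Q" and X[measurable]: "X \<in> borel_measurable Q"
    and "l > 0"
    and "(\<integral>\<^sup>+ z. ennreal (exp (l * X z)) \<partial>Q) \<le> ennreal (exp c)"
    and "(\<integral>\<^sup>+ z. ennreal (exp (- l * X z)) \<partial>Q) \<le> ennreal (exp c)"
    and "c - l * x \<le> - t"
  shows "whp Q (2 * exp (- t)) (\<lambda>z. \<bar>X z\<bar> \<le> x)"
proof -
  interpret prob_space Q by fact
  have *: "prob {z \<in> space Q. Y z > x} \<le> exp (-t)"
    if Y[measurable]: "Y \<in> borel_measurable Q"
      and b: "(\<integral>\<^sup>+ z. ennreal (exp (l * Y z)) \<partial>Q) \<le> ennreal (exp c)" for Y
  proof -
    have "emeasure Q {z \<in> space Q. Y z > x} \<le> emeasure Q {z \<in> space Q. 1 \<le> ennreal (exp (- (l * x))) * ennreal (exp (l * Y z))}"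
    proof (rule emeasure_mono)
      show "{z \<in> space Q. Y z > x} \<subseteq> {z \<in> space Q. 1 \<le> ennreal (exp (- (l * x))) * ennreal (exp (l * Y z))}"
        using \<open>l > 0\<close> by (auto simp: ennreal_mult[symmetric] exp_add[symmetric])
    qed measurable
    also have "\<dots> \<le> ennreal (exp (- (l * x))) * (\<integral>\<^sup>+ z. ennreal (exp (l * Y z)) * indicator (space Q) z \<partial>Q)"
      using nn_integral_Markov_inequality[of "\<lambda>z. ennreal (exp (l * Y z))" "space Q" Q "ennreal (exp (- (l * x)))"]
      by (auto simp: Collect_conj_eq)
    also have "\<dots> \<le> ennreal (exp (- (l * x))) * ennreal (exp c)"
      using b by (intro mult_left_mono) (auto cong: nn_integral_cong simp: indicator_def)
    also have "\<dots> \<le> ennreal (exp (- t))"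
      using assms(6) by (simp add: ennreal_mult[symmetric] exp_add[symmetric])
    finally show ?thesis by (simp add: emeasure_eq_measure)
  qed
  have eq: "{z \<in> space Q. \<not> \<bar>X z\<bar> \<le> x} = {z \<in> space Q. X z > x} \<union> {z \<in> space Q. - X z > x}" by auto
  have "prob {z \<in> space Q. \<not> \<bar>X z\<bar> \<le> x} \<le> prob {z \<in> space Q. X z > x} + prob {z \<in> space Q. - X z > x}"
    unfolding eq by (rule measure_Un_le) measurable
  also have "\<dots> \<le> exp (-t) + exp (-t)"
    using *[of X] *[of "\<lambda>z. - X z"] assms(4,5) by (intro add_mono) auto
  finally show ?thesis by (intro whpI) auto
qed

theorem martingale_bernstein:
  fixes P :: "'b measure" and e :: "nat \<Rightarrow> 'i" and d :: "nat \<Rightarrow> ('i \<Rightarrow> 'b) \<Rightarrow> 'b \<Rightarrow> real"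
  assumes P: "prob_space P"
    and inj: "inj_on e {1..n}" and I: "e ` {1..n} = I"
    and meas: "\<And>k. k \<in> {1..n} \<Longrightarrow>
        (\<lambda>(z, w). d k z w) \<in> borel_measurable (PiM (e ` {1..<k}) (\<lambda>_. P) \<Otimes>\<^sub>M P)"
    and dep: "\<And>k z z'. (\<And>i. i \<in> {1..<k} \<Longrightarrow> z (e i) = z' (e i)) \<Longrightarrow> d k z = d k z'"
    and bnd: "\<And>k z w. k \<in> {1..n} \<Longrightarrow> z \<in> space (PiM (e ` {1..<k}) (\<lambda>_. P)) \<Longrightarrow> w \<in> space P
        \<Longrightarrow> \<bar>d k z w\<bar> \<le> M"
    and mean: "\<And>k z. k \<in> {1..n} \<Longrightarrow> z \<in> space (PiM (e ` {1..<k}) (\<lambda>_. P))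
        \<Longrightarrow> (LINT w|P. d k z w) = 0"
    and var: "\<And>k z. k \<in> {1..n} \<Longrightarrow> z \<in> space (PiM (e ` {1..<k}) (\<lambda>_. P))
        \<Longrightarrow> (LINT w|P. (d k z w)\<^sup>2) \<le> s"
    and pos: "M > 0" "s > 0" "t > 0" "n > 0"
  shows "whp (PiM I (\<lambda>_. P)) (2 * exp (- t))
    (\<lambda>z. \<bar>\<Sum>k=1..n. d k z (z (e k))\<bar> \<le> 2 * sqrt (real n * s * t) + 2 * M * t)"
proof -
  \<comment> \<open>The second entry makes the variance exponent equal to \<open>t\<close>; the cap
    \<open>1 / M\<close> keeps the moment bound applicable. Whichever entry is the minimum, one of
    the two summands of the threshold alone contributes \<open>2 * t\<close>.\<close>
  define l where "l = min (1 / M) (sqrt (t / (real n * s)))"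
  have ns: "real n * s > 0" using pos by simp
  have l: "l > 0" "l * M \<le> 1" using pos by (auto simp: l_def min_def field_simps)
  have nl: "real n * (l\<^sup>2 * s) \<le> t"
  proof -
    have "l\<^sup>2 \<le> (sqrt (t / (real n * s)))\<^sup>2" using l(1) by (intro power_mono) (auto simp: l_def)
    also have "\<dots> = t / (real n * s)" using pos by simp
    finally show ?thesis using ns pos by (simp add: field_simps)
  qed
  have "2 * t \<le> l * (2 * sqrt (real n * s * t) + 2 * M * t)"
  proof (cases "1 / M \<le> sqrt (t / (real n * s))")
    case True
    then have "l * (2 * M * t) = 2 * t" using pos by (simp add: l_def)
    moreover have "0 \<le> l * (2 * sqrt (real n * s * t))" using l pos by simp
    ultimately show ?thesis unfolding distrib_left by linarith
  next
    case False
    have "sqrt (t / (real n * s)) * sqrt (real n * s * t) = sqrt (t\<^sup>2)"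
      unfolding real_sqrt_mult[symmetric] using ns pos by (simp add: power2_eq_square)
    then have "l * (2 * sqrt (real n * s * t)) = 2 * t" using False pos by (simp add: l_def)
    moreover have "0 \<le> l * (2 * M * t)" using l pos by simp
    ultimately show ?thesis unfolding distrib_left by linarith
  qed
  then have x: "real n * (l\<^sup>2 * s) - l * (2 * sqrt (real n * s * t) + 2 * M * t) \<le> - t" using nl by simp
  have Q: "prob_space (PiM I (\<lambda>_. P))" by (intro prob_space_PiM P)
  have 1: "(\<lambda>z. \<Sum>k=1..n. d k z (z (e k))) \<in> borel_measurable (PiM I (\<lambda>_. P)) \<and>
    (\<integral>\<^sup>+ z. ennreal (exp (l' * (\<Sum>k=1..n. d k z (z (e k))))) \<partial>PiM I (\<lambda>_. P))
      \<le> ennreal (exp (real n * (l'\<^sup>2 * s)))" if "\<bar>l'\<bar> * M \<le> 1" for l'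
    using martingale_mgf[OF P inj meas dep bnd mean var that] unfolding I by blast
  show ?thesis
    by (rule Chernoff_two_sided[OF Q _ l(1) _ _ x]) (use 1[of l] 1[of "-l"] l in auto)
qed

section \<open>Bounded orthonormal designs\<close>

lemma (in prob_space) martingale_bernstein_seq:
  fixes d :: "nat \<Rightarrow> (nat \<Rightarrow> 'a) \<Rightarrow> 'a \<Rightarrow> real"
  assumes "\<And>k. k \<in> {1..n} \<Longrightarrow>
        (\<lambda>x. d k (fst x) (snd x)) \<in> borel_measurable (PiM {1..<k} (\<lambda>_. M) \<Otimes>\<^sub>M M)"
    and "\<And>k z z'. (\<And>i. i \<in> {1..<k} \<Longrightarrow> z i = z' i) \<Longrightarrow> d k z = d k z'"
    and "\<And>k z w. k \<in> {1..n} \<Longrightarrow> z \<in> space (PiM {1..<k} (\<lambda>_. M)) \<Longrightarrow> w \<in> space M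
        \<Longrightarrow> \<bar>d k z w\<bar> \<le> R"
    and "\<And>k z. k \<in> {1..n} \<Longrightarrow> z \<in> space (PiM {1..<k} (\<lambda>_. M)) \<Longrightarrow> (LINT w|M. d k z w) = 0"
    and "\<And>k z. k \<in> {1..n} \<Longrightarrow> z \<in> space (PiM {1..<k} (\<lambda>_. M)) \<Longrightarrow> (LINT w|M. (d k z w)\<^sup>2) \<le> s"
    and "R > 0" "s > 0" "t > 0" "n > 0"
  shows "whp (PiM {1..n} (\<lambda>_. M)) (2 * exp (- t))
    (\<lambda>z. \<bar>\<Sum>k=1..n. d k z (z k)\<bar> \<le> 2 * sqrt (real n * s * t) + 2 * R * t)"
  using martingale_bernstein[OF prob_space_axioms, of "\<lambda>i. i" n "{1..n}" d R s t, unfolded image_ident split_beta',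
    OF inj_on_id2 refl assms] .

text \<open>For values in \<open>[0, R]\<close> one has \<open>g^2 <= R g\<close>, so the variance
  is at most \<open>R m\<close> instead of \<open>R^2\<close>. For squared projections this saves a
  factor \<open>N\<close>.\<close>

lemma (in prob_space) centered_bounds:
  fixes g :: "'a \<Rightarrow> real"
  assumes [measurable]: "g \<in> borel_measurable M"
    and g: "\<And>w. w \<in> space M \<Longrightarrow> 0 \<le> g w" "\<And>w. w \<in> space M \<Longrightarrow> g w \<le> R"
    and m: "(LINT w|M. g w) = m"
  shows "\<And>w. w \<in> space M \<Longrightarrow> \<bar>g w - m\<bar> \<le> R" "(LINT w|M. g w - m) = 0"
    "(LINT w|M. (g w - m)\<^sup>2) \<le> R * m" "0 \<le> m" "m \<le> R" "integrable M g"
proof -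
  have i: "integrable M g" by (rule integrable_const_bound[where B=R]) (use g in auto)
  have g2: "(g w)\<^sup>2 \<le> R * g w" if "w \<in> space M" for w
    using g[OF that] by (simp add: power2_eq_square mult_right_mono)
  have "(g w)\<^sup>2 \<le> R\<^sup>2" if "w \<in> space M" for w
    using g[OF that] by (simp add: power_mono)
  then have i2: "integrable M (\<lambda>w. (g w)\<^sup>2)"
    by (intro integrable_const_bound[where B="R\<^sup>2"]) auto
  show m0: "0 \<le> m" unfolding m[symmetric] by (rule integral_nonneg_AE) (use g in auto)
  have "m \<le> (LINT w|M. R)" unfolding m[symmetric] using i g by (intro integral_mono) auto
  then show mR: "m \<le> R" by (simp add: prob_space)
  show "\<bar>g w - m\<bar> \<le> R" if "w \<in> space M" for w using g[OF that] m0 mR by linarith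
  show "(LINT w|M. g w - m) = 0" using i m by (simp add: prob_space)
  have "(LINT w|M. (g w - m)\<^sup>2) = (LINT w|M. (g w)\<^sup>2) - m\<^sup>2"
    using variance_eq[OF i i2] m by simp
  also have "\<dots> \<le> (LINT w|M. (g w)\<^sup>2)" by simp
  also have "\<dots> \<le> (LINT w|M. R * g w)" using i i2 g2 by (intro integral_mono) auto
  finally show "(LINT w|M. (g w - m)\<^sup>2) \<le> R * m" using m by simp
  show "integrable M g" by (rule i)
qed

text \<open>Vectors are functions on the naturals of which only the coordinates in
  \<open>{1..D}\<close> count: the dimension is a variable of the theorem and cannot be a
  type.\<close>

definition dot :: "nat \<Rightarrow> (nat \<Rightarrow> real) \<Rightarrow> (nat \<Rightarrow> real) \<Rightarrow> real" where
  "dot D a b = (\<Sum>l=1..D. a l * b l)"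

lemma dot_commute: "dot D a b = dot D b a"
  by (simp add: dot_def mult.commute)

lemma dot_add: "dot D (\<lambda>l. a l + b l) c = dot D a c + dot D b c"
  by (simp add: dot_def sum.distrib distrib_right)

lemma dot_diff: "dot D (\<lambda>l. a l - b l) c = dot D a c - dot D b c"
  by (simp add: dot_def sum_subtractf left_diff_distrib)

lemma dot_scale: "dot D (\<lambda>l. x * a l) c = x * dot D a c"
  by (simp add: dot_def sum_distrib_left mult.assoc)

lemma dot_sum: "dot D (\<lambda>l. \<Sum>i\<in>I. a i l) c = (\<Sum>i\<in>I. dot D (a i) c)"
  unfolding dot_def by (simp add: sum_distrib_right) (rule sum.swap)

lemma dot_self_nonneg [simp]: "0 \<le> dot D a a"
  by (auto simp: dot_def intro: sum_nonneg)

lemma dot_cauchy: "(dot D a b)\<^sup>2 \<le> dot D a a * dot D b b"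
  using Cauchy_Schwarz_ineq_sum[of a b "{1..D}"] by (simp add: dot_def power2_eq_square)

lemma abs_dot_le:
  assumes "dot D a a \<le> x" "dot D b b \<le> y"
  shows "\<bar>dot D a b\<bar> \<le> sqrt (x * y)"
proof -
  have "(dot D a b)\<^sup>2 \<le> x * y"
    using dot_cauchy[of D a b] mult_mono[OF assms] assms dot_self_nonneg[of D a] dot_self_nonneg[of D b] by linarith
  then show ?thesis by (metis real_sqrt_abs real_sqrt_le_iff)
qed

lemma borel_measurable_dot [measurable (raw)]:
  assumes "\<And>l. (\<lambda>x. a x l) \<in> borel_measurable M" "\<And>l. (\<lambda>x. b x l) \<in> borel_measurable M"
  shows "(\<lambda>x. dot D (a x) (b x)) \<in> borel_measurable M"
  unfolding dot_def using assms by measurable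

text \<open>The regression model enters the probabilistic estimates only in this form:
  \<open>f\<close> is the feature vector, \<open>\<eta>\<close> the residual. Orthonormality says
  that the mean Gram matrix is the identity, \<open>centered\<close> that the residual is orthogonal
  to the model.\<close>

locale bounded_design = prob_space P for P :: "'b measure" +
  fixes f :: "'b \<Rightarrow> nat \<Rightarrow> real" and \<eta> :: "'b \<Rightarrow> real" and D :: nat and N L :: real
  assumes f_meas [measurable]: "\<And>l. (\<lambda>w. f w l) \<in> borel_measurable P"
    and \<eta>_meas [measurable]: "\<eta> \<in> borel_measurable P"
    and f_bound: "\<And>w. w \<in> space P \<Longrightarrow> dot D (f w) (f w) \<le> N"
    and \<eta>_bound: "\<And>w. w \<in> space P \<Longrightarrow> \<bar>\<eta> w\<bar> \<le> L"
    and orthonormal: "\<And>k l. k \<in> {1..D} \<Longrightarrow> l \<in> {1..D} \<Longrightarrow>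
      (LINT w|P. f w k * f w l) = (if k = l then 1 else 0)"
    and centered: "\<And>k. k \<in> {1..D} \<Longrightarrow> (LINT w|P. \<eta> w * f w k) = 0"
    and N_ge_1: "N \<ge> 1" and L_pos: "L > 0"
begin

text \<open>Crude, with \<open>N\<close> in place of its square root, but it serves only for
  integrability.\<close>

lemma f_abs_bound:
  assumes "w \<in> space P" "l \<in> {1..D}"
  shows "\<bar>f w l\<bar> \<le> N"
proof -
  have "f w l * f w l \<le> dot D (f w) (f w)"
    unfolding dot_def by (rule member_le_sum) (use assms in auto)
  then have "(f w l)\<^sup>2 \<le> N" using f_bound[OF assms(1)] by (simp add: power2_eq_square)
  also have "N \<le> N\<^sup>2" using N_ge_1 by (simp add: power2_eq_square)
  finally show ?thesis using N_ge_1 by (metis abs_le_square_iff abs_of_nonneg order_trans zero_le_one)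
qed

lemma integrable_f_f: "k \<in> {1..D} \<Longrightarrow> l \<in> {1..D} \<Longrightarrow> integrable P (\<lambda>w. f w k * f w l)"
  by (rule integrable_const_bound[where B="N * N"])
    (use f_abs_bound N_ge_1 in \<open>auto simp: abs_mult intro!: mult_mono\<close>)

lemma integrable_\<eta>_f: "k \<in> {1..D} \<Longrightarrow> integrable P (\<lambda>w. \<eta> w * f w k)"
  by (rule integrable_const_bound[where B="L * N"])
    (use f_abs_bound \<eta>_bound L_pos in \<open>auto simp: abs_mult intro!: mult_mono\<close>)

lemma dot_f_bound: "w \<in> space P \<Longrightarrow> (dot D c (f w))\<^sup>2 \<le> dot D c c * N"
  by (rule order_trans[OF dot_cauchy]) (simp add: f_bound mult_left_mono)

lemma \<eta>_sq_bound: "w \<in> space P \<Longrightarrow> (\<eta> w)\<^sup>2 \<le> L\<^sup>2"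
  using power_mono[OF \<eta>_bound abs_ge_zero, of w 2] by simp

lemma diagonal_bound: "w \<in> space P \<Longrightarrow> (\<eta> w)\<^sup>2 * dot D (f w) (f w) \<le> L\<^sup>2 * N"
  using \<eta>_sq_bound f_bound by (intro mult_mono) auto

lemma second_moment: "(LINT w|P. (dot D c (f w))\<^sup>2) = dot D c c"
proof -
  have "(LINT w|P. (dot D c (f w))\<^sup>2) = (LINT w|P. (\<Sum>k=1..D. \<Sum>l=1..D. c k * c l * (f w k * f w l)))"
    by (simp add: dot_def power2_eq_square sum_product algebra_simps)
  also have "\<dots> = (\<Sum>k=1..D. \<Sum>l=1..D. c k * c l * (LINT w|P. f w k * f w l))"
    using integrable_f_f by (subst Bochner_Integration.integral_sum) (auto intro!: sum.cong)
  also have "\<dots> = (\<Sum>k=1..D. \<Sum>l=1..D. if k = l then c k * c l else 0)"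
    by (intro sum.cong refl) (simp add: orthonormal)
  also have "\<dots> = dot D c c" by (simp add: dot_def sum.delta)
  finally show ?thesis .
qed

lemma linear_mean: "(LINT w|P. \<eta> w * dot D c (f w)) = 0"
proof -
  have "(LINT w|P. \<eta> w * dot D c (f w)) = (LINT w|P. (\<Sum>k=1..D. c k * (\<eta> w * f w k)))"
    by (simp add: dot_def sum_distrib_left algebra_simps)
  also have "\<dots> = (\<Sum>k=1..D. c k * (LINT w|P. \<eta> w * f w k))"
    using integrable_\<eta>_f by (subst Bochner_Integration.integral_sum) auto
  also have "\<dots> = 0" by (intro sum.neutral) (simp add: centered)
  finally show ?thesis .
qed

lemma integrable_dot_sq: "integrable P (\<lambda>w. (dot D c (f w))\<^sup>2)"
  by (rule integrable_const_bound[where B="dot D c c * N"]) (use dot_f_bound in auto)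

text \<open>The uniform bound pays a factor \<open>sqrt N\<close> through Cauchy-Schwarz, the
  variance does not: by isotropy the second moment of the projection is \<open>dot D c c\<close>
  exactly. Bernstein's inequality exploits this gap.\<close>

lemma linear_moments:
  assumes "dot D c c \<le> R"
  shows "\<And>w. w \<in> space P \<Longrightarrow> \<bar>2 * \<eta> w * dot D c (f w)\<bar> \<le> 2 * L * sqrt (R * N)"
    "(LINT w|P. 2 * \<eta> w * dot D c (f w)) = 0"
    "(LINT w|P. (2 * \<eta> w * dot D c (f w))\<^sup>2) \<le> 4 * L\<^sup>2 * R"
proof -
  show "\<bar>2 * \<eta> w * dot D c (f w)\<bar> \<le> 2 * L * sqrt (R * N)" if "w \<in> space P" for w
    using \<eta>_bound[OF that] abs_dot_le[OF assms f_bound[OF that]] L_pos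
    by (auto simp: abs_mult intro!: mult_mono)
  show "(LINT w|P. 2 * \<eta> w * dot D c (f w)) = 0"
    using linear_mean[of c] by (simp add: mult.assoc)
  have "(LINT w|P. (2 * \<eta> w * dot D c (f w))\<^sup>2) \<le> (LINT w|P. 4 * L\<^sup>2 * (dot D c (f w))\<^sup>2)"
  proof (rule integral_mono')
    show "integrable P (\<lambda>w. 4 * L\<^sup>2 * (dot D c (f w))\<^sup>2)" using integrable_dot_sq by auto
    fix w assume "w \<in> space P"
    then show "(2 * \<eta> w * dot D c (f w))\<^sup>2 \<le> 4 * L\<^sup>2 * (dot D c (f w))\<^sup>2"
      by (simp add: power_mult_distrib mult_right_mono \<eta>_sq_bound)
  qed simp
  also have "\<dots> = 4 * L\<^sup>2 * dot D c c" using second_moment by simp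
  also have "\<dots> \<le> 4 * L\<^sup>2 * R" using assms by (simp add: mult_left_mono)
  finally show "(LINT w|P. (2 * \<eta> w * dot D c (f w))\<^sup>2) \<le> 4 * L\<^sup>2 * R" .
qed

text \<open>The coefficients \<open>c k\<close> are random without an a priori bound. The indicator
  that they lie in the ball of squared radius \<open>R\<close> depends on the past alone, so the
  increments stay centered. The cut \<open>k <= j\<close> lets a sum over all \<open>n\<close>
  observations speak about the partial sum up to \<open>j\<close>.\<close>

lemma linear_martingale:
  fixes c :: "nat \<Rightarrow> (nat \<Rightarrow> 'b) \<Rightarrow> nat \<Rightarrow> real"
  assumes meas: "\<And>k l. (\<lambda>z. c k z l) \<in> borel_measurable (PiM {1..<k} (\<lambda>_. P))"
    and dep: "\<And>k z z'. (\<And>i. i \<in> {1..<k} \<Longrightarrow> z i = z' i) \<Longrightarrow> c k z = c k z'"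
    and "R > 0" "t > 0" "n > 0"
  shows "whp (PiM {1..n} (\<lambda>_. P)) (2 * exp (- t))
    (\<lambda>z. \<bar>\<Sum>k=1..n. if k \<le> j \<and> dot D (c k z) (c k z) \<le> R then 2 * \<eta> (z k) * dot D (c k z) (f (z k)) else 0\<bar>
       \<le> 2 * sqrt (real n * (4 * L\<^sup>2 * R) * t) + 2 * (2 * L * sqrt (R * N)) * t)"
proof (rule martingale_bernstein_seq[where
      d = "\<lambda>k z w. if k \<le> j \<and> dot D (c k z) (c k z) \<le> R then 2 * \<eta> w * dot D (c k z) (f w) else 0"])
  fix k :: nat
  have [measurable]: "(\<lambda>x. c k (fst x) l) \<in> borel_measurable (PiM {1..<k} (\<lambda>_. P) \<Otimes>\<^sub>M P)" for l
    by (rule measurable_compose[OF measurable_fst meas])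
  show "(\<lambda>x. if k \<le> j \<and> dot D (c k (fst x)) (c k (fst x)) \<le> R then 2 * \<eta> (snd x) * dot D (c k (fst x)) (f (snd x)) else 0)
    \<in> borel_measurable (PiM {1..<k} (\<lambda>_. P) \<Otimes>\<^sub>M P)"
    by measurable
next
  fix k :: nat and z z' :: "nat \<Rightarrow> 'b" assume "\<And>i. i \<in> {1..<k} \<Longrightarrow> z i = z' i"
  then have eq: "c k z = c k z'" by (rule dep)
  show "(\<lambda>w. if k \<le> j \<and> dot D (c k z) (c k z) \<le> R then 2 * \<eta> w * dot D (c k z) (f w) else 0)
     = (\<lambda>w. if k \<le> j \<and> dot D (c k z') (c k z') \<le> R then 2 * \<eta> w * dot D (c k z') (f w) else 0)"
    unfolding eq by (rule refl)
next
  fix k :: nat and z :: "nat \<Rightarrow> 'b"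
  show "(LINT w|P. (if k \<le> j \<and> dot D (c k z) (c k z) \<le> R then 2 * \<eta> w * dot D (c k z) (f w) else 0)) = 0"
    using linear_moments(2)[of "c k z" R] by (cases "k \<le> j"; cases "dot D (c k z) (c k z) \<le> R") simp_all
  show "(LINT w|P. (if k \<le> j \<and> dot D (c k z) (c k z) \<le> R then 2 * \<eta> w * dot D (c k z) (f w) else 0)\<^sup>2) \<le> 4 * L\<^sup>2 * R"
    using linear_moments(3)[of "c k z" R] assms(3) by (cases "k \<le> j"; cases "dot D (c k z) (c k z) \<le> R") simp_all
qed (use assms(3-) L_pos N_ge_1 linear_moments(1)[of "c _ _" R] in auto)

section \<open>Running scores and their concentration events\<close>

definition score :: "(nat \<Rightarrow> 'b) \<Rightarrow> nat \<Rightarrow> nat \<Rightarrow> real" where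
  "score z k l = (\<Sum>i=1..k. \<eta> (z i) * f (z i) l)"

text \<open>At \<open>k = n\<close> this is \<open>n^2 G v\<close>. It is the coefficient of the
  newest residual when the quadratic form of the Gram matrix is updated.\<close>

definition gram_score :: "(nat \<Rightarrow> 'b) \<Rightarrow> nat \<Rightarrow> nat \<Rightarrow> real" where
  "gram_score z k l = (\<Sum>i=1..k. dot D (score z k) (f (z i)) * f (z i) l)"

text \<open>The mean of one diagonal summand of the score energy; in the regression model it turns
  out to be the complexity \<open>C\<close>.\<close>

definition noise_energy :: real where
  "noise_energy = (LINT w|P. (\<eta> w)\<^sup>2 * dot D (f w) (f w))"

lemma f_component_measurable:
  assumes "i \<in> J"
  shows "(\<lambda>z. f (z i) l) \<in> borel_measurable (PiM J (\<lambda>_. P))"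
  by (rule measurable_compose[OF measurable_component_singleton[OF assms] f_meas])

lemma \<eta>_component_measurable:
  assumes "i \<in> J"
  shows "(\<lambda>z. \<eta> (z i)) \<in> borel_measurable (PiM J (\<lambda>_. P))"
  by (rule measurable_compose[OF measurable_component_singleton[OF assms] \<eta>_meas])

lemma score_measurable:
  assumes "{1..k} \<subseteq> J"
  shows "(\<lambda>z. score z k l) \<in> borel_measurable (PiM J (\<lambda>_. P))"
  unfolding score_def
  by (intro borel_measurable_sum borel_measurable_times f_component_measurable \<eta>_component_measurable)
    (use assms in auto)

lemma gram_score_measurable:
  assumes "{1..k} \<subseteq> J"
  shows "(\<lambda>z. gram_score z k l) \<in> borel_measurable (PiM J (\<lambda>_. P))"
  unfolding gram_score_def
  by (intro borel_measurable_sum borel_measurable_times borel_measurable_dot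
      f_component_measurable score_measurable assms)
    (use assms in auto)

lemma score_cong: "(\<And>i. i \<in> {1..<k} \<Longrightarrow> z i = z' i) \<Longrightarrow> score z (k - 1) = score z' (k - 1)"
  by (intro ext) (auto simp: score_def intro!: sum.cong)

lemma gram_score_cong:
  assumes "\<And>i. i \<in> {1..<k} \<Longrightarrow> z i = z' i"
  shows "gram_score z (k - 1) = gram_score z' (k - 1)"
proof -
  have "i \<in> {1..k-1} \<Longrightarrow> z i = z' i" for i using assms by auto
  then show ?thesis
    using score_cong[of k z z', OF assms] unfolding gram_score_def by (intro ext sum.cong) auto
qed

lemma interval_pred_subset: "{1..k - 1} \<subseteq> {1..<k}" for k :: nat by auto

lemma whp_score_martingale:
  assumes "R > 0" "t > 0" "n > 0"
  shows "whp (PiM {1..n} (\<lambda>_. P)) (2 * exp (- t))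
    (\<lambda>z. \<bar>\<Sum>k=1..n. if k \<le> j \<and> dot D (score z (k-1)) (score z (k-1)) \<le> R
          then 2 * \<eta> (z k) * dot D (score z (k-1)) (f (z k)) else 0\<bar>
       \<le> 2 * sqrt (real n * (4 * L\<^sup>2 * R) * t) + 2 * (2 * L * sqrt (R * N)) * t)"
  by (rule linear_martingale[where c="\<lambda>k z. score z (k-1)",
        OF score_measurable[OF interval_pred_subset] score_cong assms])

lemma whp_gram_score_martingale:
  assumes "R > 0" "t > 0" "n > 0"
  shows "whp (PiM {1..n} (\<lambda>_. P)) (2 * exp (- t))
    (\<lambda>z. \<bar>\<Sum>k=1..n. if k \<le> j \<and> dot D (gram_score z (k-1)) (gram_score z (k-1)) \<le> R
          then 2 * \<eta> (z k) * dot D (gram_score z (k-1)) (f (z k)) else 0\<bar>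
       \<le> 2 * sqrt (real n * (4 * L\<^sup>2 * R) * t) + 2 * (2 * L * sqrt (R * N)) * t)"
  by (rule linear_martingale[where c="\<lambda>k z. gram_score z (k-1)",
        OF gram_score_measurable[OF interval_pred_subset] gram_score_cong assms])

lemma square_moments:
  assumes "dot D c c \<le> R"
  shows "\<And>w. w \<in> space P \<Longrightarrow> \<bar>(dot D c (f w))\<^sup>2 - dot D c c\<bar> \<le> R * N"
    "(LINT w|P. (dot D c (f w))\<^sup>2 - dot D c c) = 0"
    "(LINT w|P. ((dot D c (f w))\<^sup>2 - dot D c c)\<^sup>2) \<le> N * R\<^sup>2"
proof -
  have R: "0 \<le> R" using assms dot_self_nonneg[of D c] by linarith
  have b: "(dot D c (f w))\<^sup>2 \<le> R * N" if "w \<in> space P" for w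
    using dot_f_bound[OF that, of c] assms N_ge_1 by (smt (verit) mult_right_mono)
  note * = centered_bounds[of "\<lambda>w. (dot D c (f w))\<^sup>2" "R * N" "dot D c c", OF _ _ b second_moment]
  show "\<bar>(dot D c (f w))\<^sup>2 - dot D c c\<bar> \<le> R * N" if "w \<in> space P" for w
    using *(1) that by simp
  show "(LINT w|P. (dot D c (f w))\<^sup>2 - dot D c c) = 0" using *(2) by simp
  have "(LINT w|P. ((dot D c (f w))\<^sup>2 - dot D c c)\<^sup>2) \<le> R * N * dot D c c" using *(3) by simp
  also have "\<dots> \<le> R * N * R" using assms R N_ge_1 by (intro mult_left_mono) auto
  finally show "(LINT w|P. ((dot D c (f w))\<^sup>2 - dot D c c)\<^sup>2) \<le> N * R\<^sup>2"
    by (simp add: power2_eq_square mult_ac)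
qed

text \<open>By isotropy the subtracted energy is the conditional mean of the squared projection
  given the past, so these are again martingale increments.\<close>

lemma whp_square_martingale:
  assumes "R > 0" "t > 0" "n > 0"
  shows "whp (PiM {1..n} (\<lambda>_. P)) (2 * exp (- t))
    (\<lambda>z. \<bar>\<Sum>k=1..n. if dot D (score z (k-1)) (score z (k-1)) \<le> R
          then (dot D (score z (k-1)) (f (z k)))\<^sup>2 - dot D (score z (k-1)) (score z (k-1)) else 0\<bar>
       \<le> 2 * sqrt (real n * (N * R\<^sup>2) * t) + 2 * (R * N) * t)"
proof (rule martingale_bernstein_seq[where
      d = "\<lambda>k z w. if dot D (score z (k-1)) (score z (k-1)) \<le> R
          then (dot D (score z (k-1)) (f w))\<^sup>2 - dot D (score z (k-1)) (score z (k-1)) else 0"])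
  fix k :: nat
  have [measurable]: "(\<lambda>x. score (fst x) (k-1) l) \<in> borel_measurable (PiM {1..<k} (\<lambda>_. P) \<Otimes>\<^sub>M P)" for l
    by (rule measurable_compose[OF measurable_fst score_measurable[OF interval_pred_subset]])
  show "(\<lambda>x. if dot D (score (fst x) (k-1)) (score (fst x) (k-1)) \<le> R
      then (dot D (score (fst x) (k-1)) (f (snd x)))\<^sup>2 - dot D (score (fst x) (k-1)) (score (fst x) (k-1)) else 0)
    \<in> borel_measurable (PiM {1..<k} (\<lambda>_. P) \<Otimes>\<^sub>M P)"
    by measurable
next
  fix k :: nat and z z' :: "nat \<Rightarrow> 'b" assume "\<And>i. i \<in> {1..<k} \<Longrightarrow> z i = z' i"
  then have eq: "score z (k-1) = score z' (k-1)" by (rule score_cong)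
  show "(\<lambda>w. if dot D (score z (k-1)) (score z (k-1)) \<le> R
          then (dot D (score z (k-1)) (f w))\<^sup>2 - dot D (score z (k-1)) (score z (k-1)) else 0)
     = (\<lambda>w. if dot D (score z' (k-1)) (score z' (k-1)) \<le> R
          then (dot D (score z' (k-1)) (f w))\<^sup>2 - dot D (score z' (k-1)) (score z' (k-1)) else 0)"
    unfolding eq by (rule refl)
next
  fix k :: nat and z :: "nat \<Rightarrow> 'b"
  let ?s = "score z (k-1)"
  show "(LINT w|P. (if dot D ?s ?s \<le> R then (dot D ?s (f w))\<^sup>2 - dot D ?s ?s else 0)) = 0"
    using square_moments(2)[of ?s R] by (cases "dot D ?s ?s \<le> R") simp_all
  show "(LINT w|P. (if dot D ?s ?s \<le> R then (dot D ?s (f w))\<^sup>2 - dot D ?s ?s else 0)\<^sup>2) \<le> N * R\<^sup>2"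
    using square_moments(3)[of ?s R] N_ge_1 by (cases "dot D ?s ?s \<le> R") simp_all
qed (use assms N_ge_1 square_moments(1)[of "score _ _" R] in auto)

lemma whp_diagonal:
  assumes "t > 0" "n > 0"
  shows "whp (PiM {1..n} (\<lambda>_. P)) (2 * exp (- t))
    (\<lambda>z. \<bar>\<Sum>k=1..n. (\<eta> (z k))\<^sup>2 * dot D (f (z k)) (f (z k)) - noise_energy\<bar>
       \<le> 2 * sqrt (real n * (L\<^sup>2 * N)\<^sup>2 * t) + 2 * (L\<^sup>2 * N) * t)"
proof -
  note * = centered_bounds[of "\<lambda>w. (\<eta> w)\<^sup>2 * dot D (f w) (f w)" "L\<^sup>2 * N" noise_energy, OF _ _ diagonal_bound noise_energy_def[symmetric]]
  have LN: "L\<^sup>2 * N > 0" using L_pos N_ge_1 by simp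
  have v: "(LINT w|P. ((\<eta> w)\<^sup>2 * dot D (f w) (f w) - noise_energy)\<^sup>2) \<le> (L\<^sup>2 * N)\<^sup>2"
  proof -
    have "(LINT w|P. ((\<eta> w)\<^sup>2 * dot D (f w) (f w) - noise_energy)\<^sup>2) \<le> L\<^sup>2 * N * noise_energy"
      using *(3) by simp
    also have "\<dots> \<le> L\<^sup>2 * N * (L\<^sup>2 * N)" using *(5) LN by (intro mult_left_mono) auto
    finally show ?thesis by (simp add: power2_eq_square)
  qed
  show ?thesis
    by (rule martingale_bernstein_seq[where d = "\<lambda>k z w. (\<eta> w)\<^sup>2 * dot D (f w) (f w) - noise_energy"])
      (use assms LN *(1,2) v in auto)
qed

text \<open>The observation \<open>z k\<close> is revealed first, so that the sum is a martingale in the other ones.\<close>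

lemma whp_kernel:
  assumes "t > 0" "n > 0" "k \<in> {1..n}"
  shows "whp (PiM {1..n} (\<lambda>_. P)) (2 * exp (- t))
    (\<lambda>z. \<bar>\<Sum>i=1..k-1. (dot D (f (z k)) (f (z i)))\<^sup>2 - dot D (f (z k)) (f (z k))\<bar>
       \<le> 2 * sqrt (real n * N^3 * t) + 2 * N\<^sup>2 * t)"
proof -
  \<comment> \<open>The order \<open>k, 1, ..., k - 1, k + 1, ..., n\<close>. For \<open>i\<close>
    in \<open>{2..k}\<close> the fresh observation \<open>e i = i - 1\<close> precedes
    \<open>k\<close> in the original numbering; at all other times the increment is set to
    zero.\<close>
  define e where "e i = (if i = 1 then k else if i \<le> k then i - 1 else i)" for i
  have inj: "inj_on e {1..n}" using assms(3) by (auto simp: inj_on_def e_def split: if_splits)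
  have "e ` {1..n} \<subseteq> {1..n}" using assms(3) by (auto simp: e_def)
  then have img: "e ` {1..n} = {1..n}" using inj by (intro endo_inj_surj) auto
  define d where "d i z w = (if i \<in> {2..k} then (dot D (f (z k)) (f w))\<^sup>2 - dot D (f (z k)) (f (z k)) else 0)"
    for i :: nat and z :: "nat \<Rightarrow> 'b" and w
  have ke: "k \<in> e ` {1..<i}" if "i \<in> {2..k}" for i
    using that by (intro image_eqI[of _ _ 1]) (auto simp: e_def)
  have bnd: "dot D (f (z k)) (f (z k)) \<le> N" if "i \<in> {2..k}" "z \<in> space (PiM (e ` {1..<i}) (\<lambda>_. P))" for i z
    using ke[OF that(1)] that(2) by (intro f_bound) (auto simp: space_PiM PiE_iff)
  have w: "whp (PiM {1..n} (\<lambda>_. P)) (2 * exp (- t))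
    (\<lambda>z. \<bar>\<Sum>i=1..n. d i z (z (e i))\<bar> \<le> 2 * sqrt (real n * (N * N\<^sup>2) * t) + 2 * (N * N) * t)"
  proof (rule martingale_bernstein[OF prob_space_axioms inj img])
    fix i assume i: "i \<in> {1..n}"
    show "(\<lambda>(z, w). d i z w) \<in> borel_measurable (PiM (e ` {1..<i}) (\<lambda>_. P) \<Otimes>\<^sub>M P)"
    proof (cases "i \<in> {2..k}")
      case True
      have [measurable]: "(\<lambda>x. f (fst x k) l) \<in> borel_measurable (PiM (e ` {1..<i}) (\<lambda>_. P) \<Otimes>\<^sub>M P)" for l
        by (rule measurable_compose[OF measurable_fst f_component_measurable[OF ke[OF True]]])
      have "(\<lambda>x. (dot D (f (fst x k)) (f (snd x)))\<^sup>2 - dot D (f (fst x k)) (f (fst x k)))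
        \<in> borel_measurable (PiM (e ` {1..<i}) (\<lambda>_. P) \<Otimes>\<^sub>M P)" by measurable
      then show ?thesis unfolding d_def split_beta' if_P[OF True] .
    next
      case False
      show ?thesis unfolding d_def split_beta' if_not_P[OF False] by simp
    qed
  next
    fix i and z z' :: "nat \<Rightarrow> 'b" assume "\<And>j. j \<in> {1..<i} \<Longrightarrow> z (e j) = z' (e j)"
    then have "i \<in> {2..k} \<Longrightarrow> z k = z' k" using ke by blast
    then show "d i z = d i z'" by (auto simp: d_def fun_eq_iff)
  next
    fix i z assume z: "z \<in> space (PiM (e ` {1..<i}) (\<lambda>_. P))"
    show "\<bar>d i z w\<bar> \<le> N * N" if "w \<in> space P" for w
      using square_moments(1)[of "f (z k)" N w] that bnd[of i z] z N_ge_1 by (auto simp: d_def)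
    show "(LINT w|P. d i z w) = 0"
      using square_moments(2)[of "f (z k)" N] bnd[of i z] z by (cases "i \<in> {2..k}") (auto simp: d_def)
    show "(LINT w|P. (d i z w)\<^sup>2) \<le> N * N\<^sup>2"
      using square_moments(3)[of "f (z k)" N] bnd[of i z] z N_ge_1 by (cases "i \<in> {2..k}") (auto simp: d_def)
  qed (use assms N_ge_1 in auto)
  have "(\<Sum>i=1..n. d i z (z (e i))) = (\<Sum>i=1..k-1. (dot D (f (z k)) (f (z i)))\<^sup>2 - dot D (f (z k)) (f (z k)))" for z
  proof -
    have "(\<Sum>i=1..n. d i z (z (e i))) = (\<Sum>i\<in>{2..k}. d i z (z (e i)))"
      using assms(3) by (intro sum.mono_neutral_right) (auto simp: d_def)
    also have "\<dots> = (\<Sum>i=1..k-1. d (Suc i) z (z (e (Suc i))))"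
      by (rule sum.reindex_bij_witness[of _ Suc "\<lambda>i. i - 1"]) auto
    also have "\<dots> = (\<Sum>i=1..k-1. (dot D (f (z k)) (f (z i)))\<^sup>2 - dot D (f (z k)) (f (z k)))"
      by (intro sum.cong refl) (auto simp: d_def e_def)
    finally show ?thesis .
  qed
  with w show ?thesis by (simp add: power2_eq_square power3_eq_cube mult.assoc)
qed

end

section \<open>The score and its energies along the sample\<close>

lemma sum_up_to_pred: "n \<ge> (1::nat) \<Longrightarrow> (\<Sum>i=1..n. g i) = (\<Sum>i=1..n-1. g i) + (g n :: real)"
  by (cases n) auto

text \<open>Summation by parts: \<open>p i\<close> occurs in \<open>n - i\<close> of the inner
  sums.\<close>

lemma weighted_increment_sum:
  fixes p :: "nat \<Rightarrow> real"
  shows "(\<Sum>k=1..n. real k * p k) = real n * (\<Sum>k=1..n. p k) - (\<Sum>k=1..n. \<Sum>i=1..k-1. p i)"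
  by (induction n) (auto simp: algebra_simps)

text \<open>Breaks the circle between the size of \<open>q\<close> and a martingale bound that is
  known only for truncated increments. If all values of \<open>q\<close> before \<open>j\<close> are
  at most \<open>B\<close>, the truncation is inactive up to \<open>j\<close>, so the true partial
  sum of \<open>p\<close> is at most \<open>x\<close> in absolute value; then
  \<open>n H + x <= B\<close> returns \<open>q j <= B\<close>.\<close>

lemma truncated_sums:
  fixes h p q :: "nat \<Rightarrow> real"
  assumes q: "\<And>k. q k = (\<Sum>i=1..k. h i) + (\<Sum>i=1..k. p i)"
    and h: "\<And>k. k \<in> {1..n} \<Longrightarrow> h k \<le> H"
    and E: "\<And>j. j \<in> {1..n} \<Longrightarrow> \<bar>\<Sum>k=1..n. if k \<le> j \<and> q (k-1) \<le> B then p k else 0\<bar> \<le> x"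
    and B: "real n * H + x \<le> B" and "0 \<le> x" "0 \<le> H" and "j \<le> n"
  shows "q j \<le> B \<and> \<bar>\<Sum>i=1..j. p i\<bar> \<le> x"
  using \<open>j \<le> n\<close>
proof (induction j rule: less_induct)
  case (less j)
  have hs: "(\<Sum>i=1..j. h i) \<le> real n * H"
  proof -
    have "(\<Sum>i=1..j. h i) \<le> (\<Sum>i=1..j. H)" using h less.prems by (intro sum_mono) auto
    also have "\<dots> \<le> real n * H" using less.prems \<open>0 \<le> H\<close> by (simp add: mult_right_mono)
    finally show ?thesis .
  qed
  have "\<bar>\<Sum>i=1..j. p i\<bar> \<le> x"
  proof (cases "j = 0")
    case True
    then show ?thesis using \<open>0 \<le> x\<close> by simp
  next
    case False
    have "(\<Sum>k=1..n. if k \<le> j \<and> q (k-1) \<le> B then p k else 0) = (\<Sum>k=1..j. p k)"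
    proof (rule sum.mono_neutral_cong_right)
      fix k assume "k \<in> {1..j}"
      then have "k - 1 < j" "k - 1 \<le> n" using less.prems by auto
      then show "(if k \<le> j \<and> q (k-1) \<le> B then p k else 0) = p k"
        using less.IH \<open>k \<in> {1..j}\<close> by auto
    qed (use less.prems in auto)
    then show ?thesis using E[of j] False less.prems by auto
  qed
  then show ?case using q[of j] hs B by auto
qed

context bounded_design
begin

definition score_energy :: "(nat \<Rightarrow> 'b) \<Rightarrow> nat \<Rightarrow> real" where
  "score_energy z k = dot D (score z k) (score z k)"

text \<open>At \<open>k = n\<close> this is \<open>n^3\<close> times \<open>v . G v\<close>, while
  \<open>score_energy\<close> is \<open>n^2 |v|^2\<close>; hence
  \<open>gram_energy - n * score_energy\<close> is \<open>n^3\<close> times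
  \<open>v . \<Delta> v\<close>.\<close>

definition gram_energy :: "(nat \<Rightarrow> 'b) \<Rightarrow> nat \<Rightarrow> real" where
  "gram_energy z k = (\<Sum>i=1..k. (dot D (score z k) (f (z i)))\<^sup>2)"

abbreviation "innov z k \<equiv> dot D (score z (k-1)) (f (z k))"
abbreviation "lev z k \<equiv> dot D (f (z k)) (f (z k))"

lemma score_step:
  assumes "k \<ge> 1"
  shows "score z k = (\<lambda>l. score z (k-1) l + \<eta> (z k) * f (z k) l)"
  unfolding score_def using sum_up_to_pred[OF assms] by (intro ext) simp

lemma dot_score_step:
  "k \<ge> 1 \<Longrightarrow> dot D (score z k) c = dot D (score z (k-1)) c + \<eta> (z k) * dot D (f (z k)) c"
  by (subst score_step) (simp_all add: dot_add dot_scale)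

lemma score_energy_step:
  assumes "k \<ge> 1"
  shows "score_energy z k = score_energy z (k-1) + (\<eta> (z k))\<^sup>2 * lev z k + 2 * \<eta> (z k) * innov z k"
proof -
  have "score_energy z k = dot D (score z (k-1)) (score z k) + \<eta> (z k) * dot D (f (z k)) (score z k)"
    unfolding score_energy_def using assms by (subst dot_score_step) auto
  also have "dot D (score z (k-1)) (score z k) = score_energy z (k-1) + \<eta> (z k) * innov z k"
    using assms by (subst dot_commute) (simp add: dot_score_step score_energy_def dot_commute)
  also have "dot D (f (z k)) (score z k) = innov z k + \<eta> (z k) * lev z k"
    using assms by (subst dot_commute) (simp add: dot_score_step)
  finally show ?thesis by (simp add: algebra_simps power2_eq_square)
qed

lemma score_energy_expansion:
  "score_energy z k = (\<Sum>i=1..k. (\<eta> (z i))\<^sup>2 * lev z i) + (\<Sum>i=1..k. 2 * \<eta> (z i) * innov z i)"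
proof (induction k)
  case 0
  show ?case by (simp add: score_energy_def score_def dot_def)
next
  case (Suc k)
  then show ?case using score_energy_step[of "Suc k" z] by simp
qed

lemma dot_gram_score:
  "dot D (gram_score z k) c = (\<Sum>i=1..k. dot D (score z k) (f (z i)) * dot D (f (z i)) c)"
  unfolding gram_score_def by (subst dot_sum) (simp add: dot_scale)

lemma gram_energy_step:
  assumes "k \<ge> 1"
  shows "gram_energy z k = gram_energy z (k-1) + 2 * \<eta> (z k) * dot D (gram_score z (k-1)) (f (z k))
    + (\<eta> (z k))\<^sup>2 * (\<Sum>i=1..k-1. (dot D (f (z k)) (f (z i)))\<^sup>2)
    + (innov z k)\<^sup>2 + 2 * innov z k * \<eta> (z k) * lev z k + (\<eta> (z k))\<^sup>2 * (lev z k)\<^sup>2"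
proof -
  let ?s = "\<lambda>i. dot D (score z (k-1)) (f (z i))" and ?g = "\<lambda>i. dot D (f (z k)) (f (z i))"
  have "gram_energy z k = (\<Sum>i=1..k-1. (?s i + \<eta> (z k) * ?g i)\<^sup>2) + (innov z k + \<eta> (z k) * lev z k)\<^sup>2"
    unfolding gram_energy_def dot_score_step[OF assms] using sum_up_to_pred[OF assms] .
  also have "(\<Sum>i=1..k-1. (?s i + \<eta> (z k) * ?g i)\<^sup>2) = gram_energy z (k-1)
      + 2 * \<eta> (z k) * (\<Sum>i=1..k-1. ?s i * ?g i) + (\<eta> (z k))\<^sup>2 * (\<Sum>i=1..k-1. (?g i)\<^sup>2)"
    unfolding gram_energy_def
    by (simp add: power2_sum power_mult_distrib sum.distrib sum_distrib_left mult_ac)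
  also have "(\<Sum>i=1..k-1. ?s i * ?g i) = dot D (gram_score z (k-1)) (f (z k))"
    unfolding dot_gram_score by (intro sum.cong refl) (simp add: dot_commute)
  finally show ?thesis by (simp add: power2_sum power_mult_distrib algebra_simps)
qed

text \<open>The five sums are treated differently: the first is a martingale; the second
  concentrates, given \<open>z k\<close>, around \<open>(k - 1)\<close> times a diagonal summand;
  the third is compensated by the running score energies; the fourth is handled by Cauchy-Schwarz;
  the last is of lower order outright.\<close>

lemma gram_energy_expansion:
  "gram_energy z n = (\<Sum>k=1..n. 2 * \<eta> (z k) * dot D (gram_score z (k-1)) (f (z k)))
    + (\<Sum>k=1..n. (\<eta> (z k))\<^sup>2 * (\<Sum>i=1..k-1. (dot D (f (z k)) (f (z i)))\<^sup>2))
    + (\<Sum>k=1..n. (innov z k)\<^sup>2) + (\<Sum>k=1..n. 2 * innov z k * \<eta> (z k) * lev z k)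
    + (\<Sum>k=1..n. (\<eta> (z k))\<^sup>2 * (lev z k)\<^sup>2)"
proof (induction n)
  case 0
  show ?case by (simp add: gram_energy_def)
next
  case (Suc n)
  then show ?case using gram_energy_step[of "Suc n" z] by simp
qed

text \<open>Norm of a positive semidefinite operator from its quadratic form: pairing the vector
  with itself and applying Cauchy-Schwarz over the observations bounds \<open>|g|^4\<close> by
  \<open>(2 n)^2 |s|^2 |g|^2\<close>. Prefixes of the sample inherit the form bound because squares
  are summed.\<close>

lemma gram_score_bound:
  assumes op: "\<And>c. (\<Sum>i=1..n. (dot D c (f (z i)))\<^sup>2) \<le> 2 * real n * dot D c c" and "k \<le> n"
    and S: "score_energy z k \<le> B"
  shows "dot D (gram_score z k) (gram_score z k) \<le> 4 * (real n)\<^sup>2 * B"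
proof -
  let ?G = "gram_score z k"
  have sub: "(\<Sum>i=1..k. (dot D c (f (z i)))\<^sup>2) \<le> 2 * real n * dot D c c" for c
  proof -
    have "(\<Sum>i=1..k. (dot D c (f (z i)))\<^sup>2) \<le> (\<Sum>i=1..n. (dot D c (f (z i)))\<^sup>2)"
      using \<open>k \<le> n\<close> by (intro sum_mono2) auto
    then show ?thesis using op order_trans by blast
  qed
  have "(dot D ?G ?G)\<^sup>2 \<le> (\<Sum>i=1..k. (dot D (score z k) (f (z i)))\<^sup>2) * (\<Sum>i=1..k. (dot D ?G (f (z i)))\<^sup>2)"
    unfolding dot_gram_score[of z k ?G]
    using Cauchy_Schwarz_ineq_sum[of "\<lambda>i. dot D (score z k) (f (z i))" "\<lambda>i. dot D ?G (f (z i))" "{1..k}"]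
    by (simp add: dot_commute)
  also have "\<dots> \<le> (2 * real n * score_energy z k) * (2 * real n * dot D ?G ?G)"
    using sub[of "score z k"] sub[of ?G] unfolding score_energy_def
    by (intro mult_mono) (auto intro: sum_nonneg)
  also have "\<dots> = 4 * (real n)\<^sup>2 * score_energy z k * dot D ?G ?G" by (simp add: power2_eq_square)
  finally have "dot D ?G ?G * dot D ?G ?G \<le> 4 * (real n)\<^sup>2 * score_energy z k * dot D ?G ?G"
    by (simp add: power2_eq_square)
  moreover have "0 \<le> 4 * (real n)\<^sup>2 * score_energy z k" by (simp add: score_energy_def)
  ultimately have "dot D ?G ?G \<le> 4 * (real n)\<^sup>2 * score_energy z k"
    using dot_self_nonneg[of D ?G] by (smt (verit) mult_le_cancel_right)
  also have "\<dots> \<le> 4 * (real n)\<^sup>2 * B" using S by (intro mult_left_mono) auto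
  finally show ?thesis .
qed

text \<open>Both energies have the same diagonal part \<open>n * (\<Sum>k. (\<eta> (z k))\<^sup>2 * lev z k)\<close>, up to lower
  order terms; everything else consists of the five sums that the concentration events control.\<close>

lemma gram_energy_deviation:
  assumes n: "n > 0"
    and z: "\<And>i. i \<in> {1..n} \<Longrightarrow> z i \<in> space P"
    and op: "\<And>c. (\<Sum>i=1..n. (dot D c (f (z i)))\<^sup>2) \<le> 2 * real n * dot D c c"
    and E1: "\<And>j. j \<in> {1..n} \<Longrightarrow> \<bar>\<Sum>k=1..n. if k \<le> j \<and> score_energy z (k-1) \<le> B
        then 2 * \<eta> (z k) * innov z k else 0\<bar> \<le> x1"
    and E2: "\<bar>\<Sum>k=1..n. if k \<le> n \<and> dot D (gram_score z (k-1)) (gram_score z (k-1)) \<le> 4 * (real n)\<^sup>2 * B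
          then 2 * \<eta> (z k) * dot D (gram_score z (k-1)) (f (z k)) else 0\<bar> \<le> x2"
    and E3: "\<bar>\<Sum>k=1..n. if score_energy z (k-1) \<le> B
          then (innov z k)\<^sup>2 - score_energy z (k-1) else 0\<bar> \<le> x3"
    and E4: "\<And>k. k \<in> {1..n} \<Longrightarrow> \<bar>\<Sum>i=1..k-1. (dot D (f (z k)) (f (z i)))\<^sup>2 - lev z k\<bar> \<le> x4"
    and B: "real n * (L\<^sup>2 * N) + x1 \<le> B" and x: "0 \<le> x1" "0 \<le> x4"
  shows "\<bar>gram_energy z n - real n * score_energy z n\<bar> \<le> x2 + x3 + real n * L\<^sup>2 * x4
    + 2 * L * N * sqrt (real n * (real n * B + x3)) + real n * L\<^sup>2 * N\<^sup>2 + 2 * real n * x1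
    + real n * (L\<^sup>2 * N)"
proof -
  define h where "h k = (\<eta> (z k))\<^sup>2 * lev z k" for k
  define p where "p k = 2 * \<eta> (z k) * innov z k" for k
  define q where "q k = score_energy z k" for k
  have \<eta>2: "(\<eta> (z k))\<^sup>2 \<le> L\<^sup>2" if "k \<in> {1..n}" for k
    by (rule \<eta>_sq_bound[OF z[OF that]])
  have lv: "0 \<le> lev z k" "lev z k \<le> N" if "k \<in> {1..n}" for k
    using f_bound[OF z[OF that]] by auto
  have hb: "0 \<le> h k" "h k \<le> L\<^sup>2 * N" if "k \<in> {1..n}" for k
    unfolding h_def using diagonal_bound[OF z[OF that]] by auto
  have qe: "q k = (\<Sum>i=1..k. h i) + (\<Sum>i=1..k. p i)" for k
    unfolding q_def h_def p_def by (rule score_energy_expansion)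
  have LN: "0 \<le> L\<^sup>2 * N" using N_ge_1 by simp
  have tr: "q j \<le> B \<and> \<bar>\<Sum>i=1..j. p i\<bar> \<le> x1" if "j \<le> n" for j
    by (rule truncated_sums[OF qe hb(2) _ B x(1) LN that]) (use E1 in \<open>unfold p_def q_def\<close>)
  have qB: "score_energy z (k-1) \<le> B" if "k \<in> {1..n}" for k
    using tr[of "k-1"] that by (auto simp: q_def)
  have F2: "\<bar>\<Sum>k=1..n. 2 * \<eta> (z k) * dot D (gram_score z (k-1)) (f (z k))\<bar> \<le> x2"
  proof -
    have "(if k \<le> n \<and> dot D (gram_score z (k-1)) (gram_score z (k-1)) \<le> 4 * (real n)\<^sup>2 * B
          then 2 * \<eta> (z k) * dot D (gram_score z (k-1)) (f (z k)) else 0)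
        = 2 * \<eta> (z k) * dot D (gram_score z (k-1)) (f (z k))" if "k \<in> {1..n}" for k
    proof -
      have "k - 1 \<le> n" using that by auto
      from gram_score_bound[OF op this qB[OF that]] show ?thesis using that by simp
    qed
    then show ?thesis using E2 by (subst (asm) sum.cong[OF refl]) auto
  qed
  have F1: "\<bar>(\<Sum>k=1..n. (innov z k)\<^sup>2) - (\<Sum>k=1..n. q (k-1))\<bar> \<le> x3"
  proof -
    have "(if score_energy z (k-1) \<le> B then (innov z k)\<^sup>2 - score_energy z (k-1) else 0)
        = (innov z k)\<^sup>2 - q (k-1)" if "k \<in> {1..n}" for k
      using qB[OF that] by (simp add: q_def)
    then show ?thesis using E3 unfolding sum_subtractf[symmetric] by (subst (asm) sum.cong[OF refl]) auto
  qed
  define u where "u = (\<Sum>k=1..n. (innov z k)\<^sup>2)"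
  have u: "u \<le> real n * B + x3"
  proof -
    have "(\<Sum>k=1..n. q (k-1)) \<le> (\<Sum>k=1..n. B)" using qB by (intro sum_mono) (auto simp: q_def)
    then show ?thesis using F1 unfolding u_def by simp
  qed
  have F4: "\<bar>\<Sum>k=1..n. 2 * innov z k * \<eta> (z k) * lev z k\<bar> \<le> 2 * L * N * sqrt (real n * (real n * B + x3))"
  proof -
    have "\<bar>\<Sum>k=1..n. 2 * innov z k * \<eta> (z k) * lev z k\<bar> \<le> (\<Sum>k=1..n. 2 * L * N * \<bar>innov z k\<bar>)"
    proof (rule order_trans[OF sum_abs sum_mono])
      fix k assume k: "k \<in> {1..n}"
      have "\<bar>\<eta> (z k)\<bar> * lev z k \<le> L * N"
        using \<eta>_bound[OF z[OF k]] lv[OF k] L_pos by (intro mult_mono) auto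
      then have "2 * \<bar>innov z k\<bar> * (\<bar>\<eta> (z k)\<bar> * lev z k) \<le> 2 * \<bar>innov z k\<bar> * (L * N)"
        by (intro mult_left_mono) auto
      then show "\<bar>2 * innov z k * \<eta> (z k) * lev z k\<bar> \<le> 2 * L * N * \<bar>innov z k\<bar>"
        using lv[OF k] by (simp add: abs_mult mult_ac)
    qed
    also have "\<dots> = 2 * L * N * (\<Sum>k=1..n. 1 * \<bar>innov z k\<bar>)" by (simp add: sum_distrib_left)
    also have "(\<Sum>k=1..n. 1 * \<bar>innov z k\<bar>) \<le> sqrt (real n * u)"
    proof -
      have "(\<Sum>k=1..n. 1 * \<bar>innov z k\<bar>)\<^sup>2 \<le> real n * u"
        using Cauchy_Schwarz_ineq_sum[of "\<lambda>_. 1" "\<lambda>k. \<bar>innov z k\<bar>" "{1..n}"] by (simp add: u_def)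
      then show ?thesis by (rule real_le_rsqrt)
    qed
    also have "sqrt (real n * u) \<le> sqrt (real n * (real n * B + x3))"
      using u by (intro real_sqrt_le_mono mult_left_mono) auto
    finally show ?thesis using L_pos N_ge_1 by (simp add: mult_left_mono)
  qed
  have F5: "0 \<le> (\<Sum>k=1..n. (\<eta> (z k))\<^sup>2 * (lev z k)\<^sup>2)" "(\<Sum>k=1..n. (\<eta> (z k))\<^sup>2 * (lev z k)\<^sup>2) \<le> real n * L\<^sup>2 * N\<^sup>2"
  proof -
    have "(\<Sum>k=1..n. (\<eta> (z k))\<^sup>2 * (lev z k)\<^sup>2) \<le> (\<Sum>k=1..n. L\<^sup>2 * N\<^sup>2)"
      using \<eta>2 lv by (intro sum_mono mult_mono) (auto intro!: power_mono)
    then show "(\<Sum>k=1..n. (\<eta> (z k))\<^sup>2 * (lev z k)\<^sup>2) \<le> real n * L\<^sup>2 * N\<^sup>2" by simp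
  qed (auto intro!: sum_nonneg)
  \<comment> \<open>Each of the \<open>k - 1\<close> kernel terms has mean \<open>lev z k\<close>
    given \<open>z k\<close>, whence the weight \<open>real k - 1\<close> on
    \<open>h k\<close>.\<close>
  have F3: "\<bar>(\<Sum>k=1..n. (\<eta> (z k))\<^sup>2 * (\<Sum>i=1..k-1. (dot D (f (z k)) (f (z i)))\<^sup>2)) - (\<Sum>k=1..n. (real k - 1) * h k)\<bar>
    \<le> real n * L\<^sup>2 * x4"
  proof -
    have eq: "(\<eta> (z k))\<^sup>2 * (\<Sum>i=1..k-1. (dot D (f (z k)) (f (z i)))\<^sup>2) - (real k - 1) * h k
      = (\<eta> (z k))\<^sup>2 * (\<Sum>i=1..k-1. (dot D (f (z k)) (f (z i)))\<^sup>2 - lev z k)" if "k \<in> {1..n}" for k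
      using that by (simp add: h_def sum_subtractf algebra_simps of_nat_diff)
    have "\<bar>(\<Sum>k=1..n. (\<eta> (z k))\<^sup>2 * (\<Sum>i=1..k-1. (dot D (f (z k)) (f (z i)))\<^sup>2)) - (\<Sum>k=1..n. (real k - 1) * h k)\<bar>
      = \<bar>\<Sum>k=1..n. (\<eta> (z k))\<^sup>2 * (\<Sum>i=1..k-1. (dot D (f (z k)) (f (z i)))\<^sup>2 - lev z k)\<bar>"
      unfolding sum_subtractf[of "\<lambda>k. (\<eta> (z k))\<^sup>2 * (\<Sum>i=1..k-1. (dot D (f (z k)) (f (z i)))\<^sup>2)", symmetric]
      by (intro arg_cong[of _ _ abs] sum.cong[OF refl] eq)
    also have "\<dots> \<le> (\<Sum>k=1..n. L\<^sup>2 * x4)"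
      by (rule order_trans[OF sum_abs sum_mono])
        (use \<eta>2 E4 x in \<open>auto simp: abs_mult intro!: mult_mono\<close>)
    finally show ?thesis by simp
  qed
  \<comment> \<open>The cancellation of the diagonal parts. The sum of the \<open>q (k-1)\<close>
    counts \<open>h i\<close> exactly \<open>n - i\<close> times and the kernel part counts it
    \<open>i - 1\<close> times, so only one copy out of \<open>n\<close> is missing. The increments
    \<open>p i\<close> are counted \<open>n - i\<close> times and leave the weight
    \<open>i\<close>.\<close>
  have id: "(\<Sum>k=1..n. q (k-1)) + (\<Sum>k=1..n. (real k - 1) * h k) - real n * q n
     = - (\<Sum>k=1..n. h k) - (\<Sum>k=1..n. real k * p k)"
  proof -
    have "(\<Sum>k=1..n. (real k - 1) * h k) = (\<Sum>k=1..n. real k * h k) - (\<Sum>k=1..n. h k)"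
      by (simp add: left_diff_distrib sum_subtractf)
    moreover have "(\<Sum>k=1..n. q (k-1)) = (\<Sum>k=1..n. \<Sum>i=1..k-1. h i) + (\<Sum>k=1..n. \<Sum>i=1..k-1. p i)"
      by (simp add: qe sum.distrib)
    ultimately show ?thesis
      using weighted_increment_sum[of h n] weighted_increment_sum[of p n] qe[of n]
      by (simp add: algebra_simps)
  qed
  have hs: "0 \<le> (\<Sum>k=1..n. h k)" "(\<Sum>k=1..n. h k) \<le> real n * (L\<^sup>2 * N)"
    using hb by (auto intro!: sum_nonneg sum_bounded_above[where A="{1..n}" and K="L\<^sup>2 * N", simplified])
  \<comment> \<open>Summation by parts reduces the weighted sum to the partial sums at all times,
    which are bounded simultaneously.\<close>
  have ps: "\<bar>\<Sum>k=1..n. real k * p k\<bar> \<le> 2 * real n * x1"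
  proof -
    have "\<bar>\<Sum>k=1..n. \<Sum>i=1..k-1. p i\<bar> \<le> (\<Sum>k=1..n. x1)"
      by (rule order_trans[OF sum_abs sum_mono]) (use tr in auto)
    moreover have "\<bar>real n * (\<Sum>k=1..n. p k)\<bar> \<le> real n * x1"
      using tr[of n] by (simp add: abs_mult mult_left_mono)
    ultimately show ?thesis unfolding weighted_increment_sum by simp
  qed
  show ?thesis
    using F1 F2 F3 F4 F5 hs ps id gram_energy_expansion[of z n] unfolding q_def by linarith
qed

lemma noise_energy_le: "noise_energy \<le> L\<^sup>2 * N"
  by (rule centered_bounds(5)[OF _ _ diagonal_bound noise_energy_def[symmetric]]) auto

text \<open>The radius \<open>B = 2 L\<^sup>2 N n\<close> is twice the deterministic bound on the diagonal part of the
  score energy, so the truncations in the martingales are never active on the good event.\<close>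

theorem score_concentration:
  fixes n :: nat and t :: real
  defines "p \<equiv> sqrt (t / N)" and "q \<equiv> sqrt (N * t / real n)"
  assumes n: "n > 0" and t: "t \<ge> 1" and small: "p + q \<le> 1 / 16"
  shows "whp (PiM {1..n} (\<lambda>_. P)) ((4 * real n + 6) * exp (- t)) (\<lambda>z.
    \<bar>score_energy z n - real n * noise_energy\<bar> \<le> 11 * L\<^sup>2 * real n * N * (p + q) \<and>
    ((\<forall>c. (\<Sum>i=1..n. (dot D c (f (z i)))\<^sup>2) \<le> 2 * real n * dot D c c) \<longrightarrow>
      \<bar>gram_energy z n - real n * score_energy z n\<bar> \<le> 50 * L\<^sup>2 * (real n)\<^sup>2 * N * (p + q)))"
proof -
  define X where "X = L\<^sup>2 * N * real n"
  have N0: "N > 0" using N_ge_1 by simp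
  have n1: "real n \<ge> 1" using n by simp
  have X: "X > 0" using L_pos N0 n by (simp add: X_def)
  have p: "0 \<le> p" and q: "0 \<le> q" using N0 t by (auto simp: p_def q_def)
  have p2: "p\<^sup>2 = t / N" and q2: "q\<^sup>2 = N * t / real n" using N0 t by (auto simp: p_def q_def)
  \<comment> \<open>From here on \<open>t\<close> is eliminated: with \<open>t = p q sqrt n\<close>
    and \<open>N t = q^2 n\<close>, the thresholds are bounded by multiples of the scale
    \<open>X\<close> or of its parts, with factors in \<open>p\<close> and \<open>q\<close>.\<close>
  have tn: "t = p * q * sqrt (real n)"
  proof -
    have *: "(p * q * sqrt (real n))\<^sup>2 = t\<^sup>2"
      unfolding power_mult_distrib p2 q2 using N0 n by (simp add: power2_eq_square)
    show ?thesis
      by (rule power2_eq_imp_eq[symmetric, OF *]) (use p q t in simp_all)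
  qed
  have Nt: "N * t = q\<^sup>2 * real n" unfolding q2 using n by simp
  have Nt': "sqrt (N * t) = q * sqrt (real n)"
    using n by (simp add: q_def real_sqrt_divide)
  have sNt: "sqrt (N * t) = N * p"
  proof -
    have "(N * p)\<^sup>2 = N * t" unfolding power_mult_distrib p2 using N0 by (simp add: power2_eq_square)
    then show ?thesis using p N0 by (intro real_sqrt_unique) auto
  qed
  have q_ge: "1 / real n \<le> q\<^sup>2" "N / real n \<le> q\<^sup>2" "q\<^sup>2 \<le> q / 16"
  proof -
    have "1 \<le> N * t" using N_ge_1 t by (metis mult_mono' mult_1 zero_le_one)
    then show "1 / real n \<le> q\<^sup>2" using n1 by (simp add: q2 divide_right_mono)
    show "N / real n \<le> q\<^sup>2" using n1 t N0 by (simp add: q2 divide_right_mono)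
    show "q\<^sup>2 \<le> q / 16" using q p small by (simp add: power2_eq_square mult_left_mono[of q "1/16" q, simplified])
  qed
  define B where "B = 2 * X"
  have B: "B > 0" using X by (simp add: B_def)
  define x1 where "x1 = 2 * sqrt (real n * (4 * L\<^sup>2 * B) * t) + 2 * (2 * L * sqrt (B * N)) * t"
  define x2 where "x2 = 2 * sqrt (real n * (4 * L\<^sup>2 * (4 * (real n)\<^sup>2 * B)) * t) + 2 * (2 * L * sqrt ((4 * (real n)\<^sup>2 * B) * N)) * t"
  define x3 where "x3 = 2 * sqrt (real n * (N * B\<^sup>2) * t) + 2 * (B * N) * t"
  define x4 where "x4 = 2 * sqrt (real n * N^3 * t) + 2 * N\<^sup>2 * t"
  define x5 where "x5 = 2 * sqrt (real n * (L\<^sup>2 * N)\<^sup>2 * t) + 2 * (L\<^sup>2 * N) * t"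
  have sB: "sqrt B = L * sqrt 2 * sqrt N * sqrt (real n)"
    using L_pos by (simp add: B_def X_def real_sqrt_mult)
  have x1_eq: "x1 = 4 * sqrt 2 * X * (p + p * q)"
  proof -
    have "sqrt (real n * (4 * L\<^sup>2 * B) * t) = 2 * L * sqrt B * sqrt t * sqrt (real n)"
      using L_pos by (simp add: real_sqrt_mult)
    also have "\<dots> = 2 * L\<^sup>2 * sqrt 2 * sqrt (N * t) * real n"
      by (simp add: sB real_sqrt_mult power2_eq_square)
    also have "\<dots> = 2 * sqrt 2 * X * p" by (simp add: sNt X_def)
    finally have 1: "sqrt (real n * (4 * L\<^sup>2 * B) * t) = 2 * sqrt 2 * X * p" .
    have "L * sqrt (B * N) * t = L * (L * sqrt 2 * sqrt N * sqrt (real n)) * sqrt N * (p * q * sqrt (real n))"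
      unfolding real_sqrt_mult sB tn[symmetric] by simp
    also have "\<dots> = L\<^sup>2 * sqrt 2 * (sqrt N * sqrt N) * (sqrt (real n) * sqrt (real n)) * (p * q)"
      by (simp only: power2_eq_square mult_ac)
    also have "\<dots> = sqrt 2 * X * (p * q)"
      unfolding real_sqrt_mult_self using N0 by (simp add: X_def)
    finally show ?thesis unfolding x1_def 1 by (simp add: algebra_simps)
  qed
  have r2: "sqrt 2 \<le> 3 / 2" by (rule real_le_lsqrt) (auto simp: power2_eq_square)
  have pq: "p * q \<le> p / 16" using p q small mult_left_mono[of q "1/16" p] by simp
  have x1_le: "x1 \<le> 7 * X * p"
  proof -
    have "4 * sqrt 2 * (p + p * q) \<le> 6 * (p + p / 16)"
      using r2 p q pq by (intro mult_mono) auto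
    also have "\<dots> \<le> 7 * p" using p by simp
    finally have "X * (4 * sqrt 2 * (p + p * q)) \<le> X * (7 * p)"
      using X by (intro mult_left_mono) auto
    then show ?thesis unfolding x1_eq by (simp only: mult_ac)
  qed
  have x1_0: "0 \<le> x1" using X p q by (simp add: x1_eq)
  have Bx: "real n * (L\<^sup>2 * N) + x1 \<le> B"
  proof -
    have "7 * X * p \<le> X * 1" using small p q X mult_left_mono[of "7 * p" 1 X] by simp
    moreover have "real n * (L\<^sup>2 * N) = X" by (simp add: X_def)
    ultimately show ?thesis using x1_le unfolding B_def by linarith
  qed
  \<comment> \<open>The squared radius of the Gram score is \<open>4 n^2\<close> times that of the
    score, so both terms of the Bernstein threshold scale by \<open>2 n\<close>.\<close>
  have x2_eq: "x2 = 2 * real n * x1"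
    unfolding x1_def x2_def by (simp add: real_sqrt_mult algebra_simps)
  have sq: "sqrt (real n * N * t) = real n * q"
  proof -
    have "sqrt (real n * N * t) = sqrt (real n) * sqrt (N * t)"
      unfolding real_sqrt_mult[symmetric] by (simp add: mult.assoc)
    then show ?thesis unfolding Nt' by simp
  qed
  have x3_le: "x3 \<le> 8 * X * real n * q"
  proof -
    have "sqrt (real n * (N * B\<^sup>2) * t) = B * sqrt (real n * N * t)"
      using B by (simp add: real_sqrt_mult)
    then have "x3 = 2 * B * real n * (q + q\<^sup>2)"
      unfolding x3_def sq using Nt by (simp add: algebra_simps)
    also have "\<dots> \<le> 2 * B * real n * (2 * q)"
      using q_ge(3) q B by (intro mult_left_mono) auto
    finally show ?thesis by (simp add: B_def)
  qed
  have x4_le: "x4 \<le> 4 * N * real n * q"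
  proof -
    have "sqrt (real n * N^3 * t) = N * sqrt (real n * N * t)"
      using N0 by (simp add: real_sqrt_mult power3_eq_cube)
    then have "x4 = 2 * N * real n * (q + q\<^sup>2)"
      unfolding x4_def sq using Nt by (simp add: algebra_simps power2_eq_square)
    also have "\<dots> \<le> 2 * N * real n * (2 * q)"
      using q_ge(3) q N0 by (intro mult_left_mono) auto
    finally show ?thesis by simp
  qed
  have x4_0: "0 \<le> x4" using N0 t by (simp add: x4_def)
  have x5_le: "x5 \<le> 4 * X * q"
  proof -
    have "sqrt (real n * (L\<^sup>2 * N)\<^sup>2 * t) = L\<^sup>2 * N * sqrt (real n * t)"
      using N0 by (simp add: real_sqrt_mult)
    also have "\<dots> \<le> L\<^sup>2 * N * sqrt (real n * N * t)"
      using N_ge_1 N0 t n by (intro mult_left_mono real_sqrt_le_mono) (auto simp: mult_right_mono)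
    finally have 1: "sqrt (real n * (L\<^sup>2 * N)\<^sup>2 * t) \<le> X * q" unfolding sq by (simp add: X_def)
    have "t \<le> N * t" using N_ge_1 t by simp
    also have "\<dots> \<le> q * real n" unfolding Nt using q_ge(3) q n1 by (intro mult_right_mono) auto
    finally have "L\<^sup>2 * N * t \<le> L\<^sup>2 * N * (q * real n)" using N0 by (intro mult_left_mono) auto
    then have "L\<^sup>2 * N * t \<le> X * q" by (simp add: X_def mult_ac)
    then show ?thesis unfolding x5_def using 1 by (simp add: mult.assoc)
  qed
  have x6: "2 * L * N * sqrt (real n * (real n * B + x3)) \<le> 4 * X * real n * q"
  proof -
    have "x3 \<le> real n * B"
    proof -
      have "8 * X * real n * q = (X * real n) * (8 * q)" by simp
      also have "\<dots> \<le> (X * real n) * 2" using small p X by (intro mult_left_mono) auto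
      also have "\<dots> = real n * B" by (simp add: B_def)
      finally show ?thesis using x3_le by linarith
    qed
    then have "real n * (real n * B + x3) \<le> real n * (2 * (real n * B))"
      by (intro mult_left_mono) linarith+
    also have "\<dots> = (2 * real n * L)\<^sup>2 * (N * real n)" by (simp add: B_def X_def power2_eq_square)
    finally have "sqrt (real n * (real n * B + x3)) \<le> 2 * real n * L * sqrt (N * real n)"
      using real_sqrt_le_mono[of "real n * (real n * B + x3)" "(2 * real n * L)\<^sup>2 * (N * real n)"] L_pos
      by (simp add: real_sqrt_mult)
    moreover have "2 * real n * L * sqrt (N * real n) \<le> 2 * real n * L * (real n * q)"
    proof (rule mult_left_mono)
      have "real n * N * 1 \<le> real n * N * t" using t N0 by (intro mult_left_mono) auto
      then have "sqrt (N * real n) \<le> sqrt (real n * N * t)" by (intro real_sqrt_le_mono) (simp add: mult_ac)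
      then show "sqrt (N * real n) \<le> real n * q" unfolding sq .
    qed (use L_pos in simp)
    ultimately have "sqrt (real n * (real n * B + x3)) \<le> 2 * real n * L * (real n * q)" by linarith
    then have "2 * L * N * sqrt (real n * (real n * B + x3)) \<le> 2 * L * N * (2 * real n * L * (real n * q))"
      using L_pos N0 by (intro mult_left_mono) auto
    then show ?thesis by (simp add: X_def power2_eq_square mult_ac)
  qed
  have x7: "real n * L\<^sup>2 * N\<^sup>2 \<le> X * real n * q"
  proof -
    have "N \<le> real n * q\<^sup>2" using q_ge(2) n1 by (simp add: field_simps)
    also have "\<dots> \<le> real n * q" using q_ge(3) q by (intro mult_left_mono) auto
    finally have "real n * L\<^sup>2 * N * N \<le> real n * L\<^sup>2 * N * (real n * q)" using N0 by (intro mult_left_mono) auto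
    then show ?thesis by (simp add: X_def power2_eq_square mult_ac)
  qed
  have x8: "real n * (L\<^sup>2 * N) \<le> X * real n * q"
  proof -
    have "1 \<le> real n * q\<^sup>2" using q_ge(1) n1 by (simp add: field_simps)
    also have "\<dots> \<le> real n * q" using q_ge(3) q by (intro mult_left_mono) auto
    finally have "X * 1 \<le> X * (real n * q)" using X by (intro mult_left_mono) auto
    then show ?thesis by (simp add: X_def mult_ac)
  qed
  have x9: "real n * L\<^sup>2 * x4 \<le> 4 * X * real n * q"
  proof -
    have "real n * L\<^sup>2 * x4 \<le> real n * L\<^sup>2 * (4 * N * real n * q)" using x4_le by (intro mult_left_mono) auto
    then show ?thesis by (simp add: X_def mult_ac)
  qed
  have x10: "real n * x1 \<le> 7 * X * real n * p"
    using mult_left_mono[OF x1_le, of "real n"] by (simp add: mult_ac)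
  have t0: "t > 0" using t by simp
  have R: "4 * (real n)\<^sup>2 * B > 0" using n B by simp
  \<comment> \<open>There are \<open>n + 1 + 1 + n + 1\<close> events, each failing with probability
    at most \<open>2 exp (-t)\<close>; this is the factor \<open>4 n + 6\<close>.\<close>
  note E = whp_conj[OF whp_ball[OF finite_atLeastAtMost whp_score_martingale[OF B t0 n], of 1 n]
      whp_conj[OF whp_gram_score_martingale[OF R t0 n, of n]
      whp_conj[OF whp_square_martingale[OF B t0 n]
      whp_conj[OF whp_ball[OF finite_atLeastAtMost whp_kernel[OF t0 n], of 1 n]
       whp_diagonal[OF t0 n]]]]]
  show ?thesis
  proof (rule whp_mono[OF E])
    fix z assume z: "z \<in> space (PiM {1..n} (\<lambda>_. P))"
    assume "(\<forall>j\<in>{1..n}. \<bar>\<Sum>k=1..n. if k \<le> j \<and> dot D (score z (k-1)) (score z (k-1)) \<le> B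
          then 2 * \<eta> (z k) * innov z k else 0\<bar> \<le> 2 * sqrt (real n * (4 * L\<^sup>2 * B) * t) + 2 * (2 * L * sqrt (B * N)) * t) \<and>
      \<bar>\<Sum>k=1..n. if k \<le> n \<and> dot D (gram_score z (k-1)) (gram_score z (k-1)) \<le> 4 * (real n)\<^sup>2 * B
          then 2 * \<eta> (z k) * dot D (gram_score z (k-1)) (f (z k)) else 0\<bar>
        \<le> 2 * sqrt (real n * (4 * L\<^sup>2 * (4 * (real n)\<^sup>2 * B)) * t) + 2 * (2 * L * sqrt (4 * (real n)\<^sup>2 * B * N)) * t \<and>
      \<bar>\<Sum>k=1..n. if dot D (score z (k-1)) (score z (k-1)) \<le> B
          then (innov z k)\<^sup>2 - dot D (score z (k-1)) (score z (k-1)) else 0\<bar>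
        \<le> 2 * sqrt (real n * (N * B\<^sup>2) * t) + 2 * (B * N) * t \<and>
      (\<forall>k\<in>{1..n}. \<bar>\<Sum>i=1..k-1. (dot D (f (z k)) (f (z i)))\<^sup>2 - lev z k\<bar>
        \<le> 2 * sqrt (real n * N ^ 3 * t) + 2 * N\<^sup>2 * t) \<and>
      \<bar>\<Sum>k=1..n. (\<eta> (z k))\<^sup>2 * lev z k - noise_energy\<bar>
        \<le> 2 * sqrt (real n * (L\<^sup>2 * N)\<^sup>2 * t) + 2 * (L\<^sup>2 * N) * t"
    note E = this[folded x1_def x2_def x3_def x4_def x5_def, folded score_energy_def]
    have zs: "z i \<in> space P" if "i \<in> {1..n}" for i using z that by (auto simp: space_PiM)
    have sp: "\<bar>\<Sum>k=1..n. 2 * \<eta> (z k) * innov z k\<bar> \<le> x1"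
    proof -
      have h: "(\<eta> (z k))\<^sup>2 * lev z k \<le> L\<^sup>2 * N" if "k \<in> {1..n}" for k
        by (rule diagonal_bound[OF zs[OF that]])
      show ?thesis
        by (rule truncated_sums[THEN conjunct2, OF score_energy_expansion h _ Bx x1_0 _ order_refl])
          (use E N0 in auto)
    qed
    have A1: "\<bar>score_energy z n - real n * noise_energy\<bar> \<le> x1 + x5"
      using sp E score_energy_expansion[of z n] by (simp add: sum_subtractf) linarith
    show "\<bar>score_energy z n - real n * noise_energy\<bar> \<le> 11 * L\<^sup>2 * real n * N * (p + q) \<and>
      ((\<forall>c. (\<Sum>i=1..n. (dot D c (f (z i)))\<^sup>2) \<le> 2 * real n * dot D c c) \<longrightarrow>
        \<bar>gram_energy z n - real n * score_energy z n\<bar> \<le> 50 * L\<^sup>2 * (real n)\<^sup>2 * N * (p + q))"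
    proof (intro conjI impI)
      have "x1 + x5 \<le> 7 * (X * p) + 4 * (X * q)" using x1_le x5_le by simp
      also have "\<dots> \<le> 11 * (X * p) + 11 * (X * q)" using X p q by simp
      also have "\<dots> = 11 * L\<^sup>2 * real n * N * (p + q)" by (simp add: X_def algebra_simps)
      finally show "\<bar>score_energy z n - real n * noise_energy\<bar> \<le> 11 * L\<^sup>2 * real n * N * (p + q)"
        using A1 by linarith
      assume op: "\<forall>c. (\<Sum>i=1..n. (dot D c (f (z i)))\<^sup>2) \<le> 2 * real n * dot D c c"
      have "\<bar>gram_energy z n - real n * score_energy z n\<bar> \<le> x2 + x3 + real n * L\<^sup>2 * x4
        + 2 * L * N * sqrt (real n * (real n * B + x3)) + real n * L\<^sup>2 * N\<^sup>2 + 2 * real n * x1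
        + real n * (L\<^sup>2 * N)"
        by (rule gram_energy_deviation[OF n zs _ _ _ _ _ Bx x1_0 x4_0]) (use op E in auto)
      also have "\<dots> \<le> 28 * (X * real n * p) + 18 * (X * real n * q)"
        using x2_eq x3_le x6 x7 x8 x9 x10 by linarith
      also have "\<dots> \<le> 50 * (X * real n * p) + 50 * (X * real n * q)" using X p q by simp
      also have "\<dots> = 50 * L\<^sup>2 * (real n)\<^sup>2 * N * (p + q)"
        by (simp add: X_def power2_eq_square algebra_simps)
      finally show "\<bar>gram_energy z n - real n * score_energy z n\<bar> \<le> 50 * L\<^sup>2 * (real n)\<^sup>2 * N * (p + q)" .
    qed
  qed (simp_all add: algebra_simps)
qed

end

section \<open>The Gram error of a localized design\<close>

text \<open>A Schur test whose weights balance the blocks: Cauchy--Schwarz is applied with the weight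
  \<open>w j / a j\<close> on block \<open>j\<close>, where \<open>w j = (\<Sum>i. max (a i) (a j))\<close>.\<close>

lemma block_operator_bound:
  fixes \<Delta> :: "nat \<Rightarrow> nat \<Rightarrow> real" and a :: "nat \<Rightarrow> real" and x :: "nat \<Rightarrow> real"
  assumes b: "b \<ge> 1" and blk: "\<And>k. k \<in> {1..D} \<Longrightarrow> blk k \<in> {1..b}"
    and a: "\<And>i. i \<in> {1..b} \<Longrightarrow> a i \<ge> 1"
    and ent: "\<And>k l. k \<in> {1..D} \<Longrightarrow> l \<in> {1..D} \<Longrightarrow> (\<Delta> k l)\<^sup>2 \<le> s * min (a (blk k)) (a (blk l))"
    and zero: "\<And>k l. k \<in> {1..D} \<Longrightarrow> l \<in> {1..D} \<Longrightarrow> \<not> meet k l \<Longrightarrow> \<Delta> k l = 0"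
    and sym: "\<And>k l. meet k l \<Longrightarrow> meet l k"
    and card: "\<And>k j. k \<in> {1..D} \<Longrightarrow> j \<in> {1..b} \<Longrightarrow>
      real (card {l \<in> {1..D}. blk l = j \<and> meet k l}) \<le> Ac * max (a j / a (blk k)) 1"
    and s: "0 \<le> s" and Ac: "0 \<le> Ac"
  shows "(\<Sum>k=1..D. (\<Sum>l=1..D. \<Delta> k l * x l)\<^sup>2)
    \<le> Ac\<^sup>2 * s * (\<Sum>i=1..b. \<Sum>j=1..b. max (a i) (a j)) * (\<Sum>l=1..D. (x l)\<^sup>2)"
proof -
  define w where "w j = (\<Sum>i=1..b. max (a i) (a j))" for j
  define \<Omega> where "\<Omega> = (\<Sum>i=1..b. \<Sum>j=1..b. max (a i) (a j))"
  define M where "M k = {l \<in> {1..D}. meet k l}" for k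
  have a0: "a i > 0" if "i \<in> {1..b}" for i using a[OF that] by simp
  have w_pos: "w j > 0" if "j \<in> {1..b}" for j
    unfolding w_def using b a0[OF that] a0 by (intro sum_pos) (auto simp: less_max_iff_disj)
  have \<Omega>: "\<Omega> = (\<Sum>j=1..b. w j)" unfolding \<Omega>_def w_def by (rule sum.swap)
  have \<Omega>0: "0 \<le> \<Omega>" unfolding \<Omega> using w_pos by (intro sum_nonneg) (auto intro: less_imp_le)
  have group: "(\<Sum>l\<in>M k. g (blk l)) = (\<Sum>j=1..b. real (card {l \<in> {1..D}. blk l = j \<and> meet k l}) * g j)"
    if "k \<in> {1..D}" for k and g :: "nat \<Rightarrow> real"
  proof -
    have "(\<Sum>l\<in>M k. g (blk l)) = (\<Sum>j\<in>{1..b}. \<Sum>l\<in>{l \<in> M k. blk l = j}. g (blk l))"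
      by (rule sum.group[symmetric]) (use blk in \<open>auto simp: M_def\<close>)
    also have "\<dots> = (\<Sum>j=1..b. real (card {l \<in> {1..D}. blk l = j \<and> meet k l}) * g j)"
    proof (intro sum.cong refl)
      fix j
      have "{l \<in> M k. blk l = j} = {l \<in> {1..D}. blk l = j \<and> meet k l}" by (auto simp: M_def)
      then show "(\<Sum>l\<in>{l \<in> M k. blk l = j}. g (blk l)) = real (card {l \<in> {1..D}. blk l = j \<and> meet k l}) * g j"
        by simp
    qed
    finally show ?thesis .
  qed
  have row: "(\<Sum>l=1..D. \<Delta> k l * x l)\<^sup>2 \<le> Ac * s * \<Omega> * (\<Sum>l\<in>M k. (x l)\<^sup>2 * (a (blk l) / w (blk l)))"
    if k: "k \<in> {1..D}" for k
  proof -
    have k': "blk k \<in> {1..b}" using blk k by blast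
    have pos: "a (blk l) > 0" "w (blk l) > 0" if "l \<in> M k" for l
      using that blk[of l] a0[of "blk l"] w_pos[of "blk l"] by (auto simp: M_def)
    have "(\<Sum>l=1..D. \<Delta> k l * x l) = (\<Sum>l\<in>M k. \<Delta> k l * x l)"
      by (rule sum.mono_neutral_right) (use zero k in \<open>auto simp: M_def\<close>)
    also have "\<dots> = (\<Sum>l\<in>M k. (\<Delta> k l * sqrt (w (blk l) / a (blk l))) * (x l * sqrt (a (blk l) / w (blk l))))"
    proof (intro sum.cong refl)
      fix l assume l: "l \<in> M k"
      have "sqrt (w (blk l) / a (blk l)) * sqrt (a (blk l) / w (blk l)) = 1"
        using pos[OF l] by (simp add: real_sqrt_mult[symmetric])
      then show "\<Delta> k l * x l = (\<Delta> k l * sqrt (w (blk l) / a (blk l))) * (x l * sqrt (a (blk l) / w (blk l)))"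
        by (metis (no_types, lifting) mult.assoc mult.commute mult.right_neutral)
    qed
    finally have CS: "(\<Sum>l=1..D. \<Delta> k l * x l)\<^sup>2 \<le> (\<Sum>l\<in>M k. (\<Delta> k l * sqrt (w (blk l) / a (blk l)))\<^sup>2) * (\<Sum>l\<in>M k. (x l * sqrt (a (blk l) / w (blk l)))\<^sup>2)"
      by (simp only: Cauchy_Schwarz_ineq_sum)
    have second: "(\<Sum>l\<in>M k. (x l * sqrt (a (blk l) / w (blk l)))\<^sup>2) = (\<Sum>l\<in>M k. (x l)\<^sup>2 * (a (blk l) / w (blk l)))"
      using pos by (intro sum.cong refl) (simp add: power_mult_distrib less_imp_le)
    have "(\<Sum>l\<in>M k. (\<Delta> k l * sqrt (w (blk l) / a (blk l)))\<^sup>2)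
        \<le> (\<Sum>l\<in>M k. s * min (a (blk k)) (a (blk l)) * (w (blk l) / a (blk l)))"
    proof (intro sum_mono)
      fix l assume l: "l \<in> M k"
      then have "(\<Delta> k l)\<^sup>2 * (w (blk l) / a (blk l)) \<le> s * min (a (blk k)) (a (blk l)) * (w (blk l) / a (blk l))"
        using ent[of k l] k pos[OF l] by (intro mult_right_mono) (auto simp: M_def)
      then show "(\<Delta> k l * sqrt (w (blk l) / a (blk l)))\<^sup>2 \<le> s * min (a (blk k)) (a (blk l)) * (w (blk l) / a (blk l))"
        using pos[OF l] by (simp add: power_mult_distrib less_imp_le)
    qed
    also have "(\<Sum>l\<in>M k. s * min (a (blk k)) (a (blk l)) * (w (blk l) / a (blk l)))
        = (\<Sum>j=1..b. real (card {l \<in> {1..D}. blk l = j \<and> meet k l}) * (s * min (a (blk k)) (a j) * (w j / a j)))"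
      by (rule group[OF k])
    also have "\<dots> \<le> (\<Sum>j=1..b. Ac * s * w j)"
    proof (intro sum_mono)
      fix j assume j: "j \<in> {1..b}"
      have "real (card {l \<in> {1..D}. blk l = j \<and> meet k l}) * (s * min (a (blk k)) (a j) * (w j / a j))
        \<le> Ac * max (a j / a (blk k)) 1 * (s * min (a (blk k)) (a j) * (w j / a j))"
        using card[OF k j] s a0[OF j] a0[OF k'] w_pos[OF j] by (intro mult_right_mono) auto
      also have "\<dots> = Ac * s * w j * (max (a j / a (blk k)) 1 * min (a (blk k)) (a j) / a j)" by simp
      \<comment> \<open>The overlap count grows exactly as fast as the squared entries shrink, so
        every block contributes the same up to its weight.\<close>
      also have "max (a j / a (blk k)) 1 * min (a (blk k)) (a j) / a j = 1"
        using a0[OF j] a0[OF k'] by (auto simp: max_def min_def field_simps)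
      finally show "real (card {l \<in> {1..D}. blk l = j \<and> meet k l}) * (s * min (a (blk k)) (a j) * (w j / a j)) \<le> Ac * s * w j"
        by simp
    qed
    also have "\<dots> = Ac * s * \<Omega>" unfolding \<Omega> by (simp add: sum_distrib_left)
    finally have first: "(\<Sum>l\<in>M k. (\<Delta> k l * sqrt (w (blk l) / a (blk l)))\<^sup>2) \<le> Ac * s * \<Omega>" .
    have "0 \<le> (\<Sum>l\<in>M k. (x l)\<^sup>2 * (a (blk l) / w (blk l)))"
      using pos by (intro sum_nonneg) (simp add: less_imp_le)
    from CS[unfolded second] mult_right_mono[OF first this] show ?thesis by (rule order_trans)
  qed
  have "(\<Sum>k=1..D. (\<Sum>l=1..D. \<Delta> k l * x l)\<^sup>2)
      \<le> (\<Sum>k=1..D. Ac * s * \<Omega> * (\<Sum>l\<in>M k. (x l)\<^sup>2 * (a (blk l) / w (blk l))))"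
    using row by (intro sum_mono) auto
  also have "\<dots> = Ac * s * \<Omega> * (\<Sum>k=1..D. \<Sum>l\<in>M k. (x l)\<^sup>2 * (a (blk l) / w (blk l)))"
    by (simp add: sum_distrib_left)
  \<comment> \<open>Overlap is symmetric, so columns are counted like rows. The number of indices
    meeting \<open>l\<close> is at most \<open>Ac * w j / a j\<close> for \<open>j = blk l\<close>,
    and the weight was chosen to cancel this.\<close>
  also have "(\<Sum>k=1..D. \<Sum>l\<in>M k. (x l)\<^sup>2 * (a (blk l) / w (blk l)))
      = (\<Sum>l=1..D. \<Sum>k\<in>M l. (x l)\<^sup>2 * (a (blk l) / w (blk l)))"
  proof -
    have "(\<Sum>k=1..D. \<Sum>l\<in>M k. g l) = (\<Sum>l=1..D. \<Sum>k\<in>M l. g l)" for g :: "nat \<Rightarrow> real"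
      unfolding M_def by (subst sum.swap_restrict) (auto intro!: sum.cong sym)
    then show ?thesis .
  qed
  also have "\<dots> \<le> (\<Sum>l=1..D. Ac * (x l)\<^sup>2)"
  proof (intro sum_mono)
    fix l assume l: "l \<in> {1..D}"
    have l': "blk l \<in> {1..b}" using blk l by blast
    let ?j = "blk l"
    have "(\<Sum>k\<in>M l. (x l)\<^sup>2 * (a ?j / w ?j)) = (x l)\<^sup>2 * (a ?j / w ?j) * (\<Sum>k\<in>M l. 1)"
      by simp
    also have "(\<Sum>k\<in>M l. 1) = (\<Sum>i=1..b. real (card {k \<in> {1..D}. blk k = i \<and> meet l k}) * 1)"
      by (rule group[OF l])
    also have "(x l)\<^sup>2 * (a ?j / w ?j) * (\<Sum>i=1..b. real (card {k \<in> {1..D}. blk k = i \<and> meet l k}) * 1)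
      \<le> (x l)\<^sup>2 * (a ?j / w ?j) * (\<Sum>i=1..b. Ac * max (a i / a ?j) 1)"
      using card[OF l] a0[OF l'] w_pos[OF l'] by (intro mult_left_mono sum_mono) auto
    also have "\<dots> = (x l)\<^sup>2 * Ac * ((\<Sum>i=1..b. a ?j * max (a i / a ?j) 1) / w ?j)"
      by (simp add: sum_distrib_left[symmetric])
    also have "(\<Sum>i=1..b. a ?j * max (a i / a ?j) 1) = w ?j"
      unfolding w_def using a0[OF l'] by (intro sum.cong refl) (auto simp: max_def field_simps)
    finally show "(\<Sum>k\<in>M l. (x l)\<^sup>2 * (a ?j / w ?j)) \<le> Ac * (x l)\<^sup>2"
      using w_pos[OF l'] by (simp add: mult.commute)
  qed
  also have "\<dots> = Ac * (\<Sum>l=1..D. (x l)\<^sup>2)" by (simp add: sum_distrib_left)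
  finally have "(\<Sum>k=1..D. (\<Sum>l=1..D. \<Delta> k l * x l)\<^sup>2) \<le> Ac * s * \<Omega> * (Ac * (\<Sum>l=1..D. (x l)\<^sup>2))"
    using Ac s \<Omega>0 by (simp add: mult_left_mono)
  then show ?thesis unfolding \<Omega>_def by (simp add: power2_eq_square mult_ac)
qed

section \<open>Entrywise concentration of the Gram matrix\<close>

context bounded_design
begin

definition gram_error :: "(nat \<Rightarrow> 'b) \<Rightarrow> nat \<Rightarrow> (nat \<Rightarrow> real) \<Rightarrow> nat \<Rightarrow> real" where
  "gram_error z n c l = (\<Sum>i=1..n. dot D c (f (z i)) * f (z i) l) / real n - c l"

text \<open>Either factor of the product may be taken out in sup-norm, the other then having second
  moment one. Choosing the better one gives the minimum in the variance, which the Schur test relies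
  on.\<close>

lemma whp_entry:
  assumes k: "k \<in> {1..D}" and l: "l \<in> {1..D}" and "t > 0" "n > 0"
    and x: "\<And>w. w \<in> space P \<Longrightarrow> \<bar>f w k\<bar> \<le> x" and y: "\<And>w. w \<in> space P \<Longrightarrow> \<bar>f w l\<bar> \<le> y"
  shows "whp (PiM {1..n} (\<lambda>_. P)) (2 * exp (- t))
    (\<lambda>z. \<bar>\<Sum>i=1..n. f (z i) k * f (z i) l - (if k = l then 1 else 0)\<bar>
      \<le> 2 * sqrt (real n * (min x y)\<^sup>2 * t) + 2 * (2 * (x * y)) * t)"
proof -
  define \<delta> where "\<delta> = (if k = l then 1 else 0 :: real)"
  \<comment> \<open>A normalized function has sup-norm at least 1. This makes \<open>x * y\<close>
    dominate the centering constant and keeps the Bernstein parameters positive.\<close>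
  have sq: "1 \<le> c\<^sup>2" if "j \<in> {1..D}" and c: "\<And>w. w \<in> space P \<Longrightarrow> \<bar>f w j\<bar> \<le> c" for j c
  proof -
    have "(LINT w|P. f w j * f w j) \<le> (LINT w|P. c\<^sup>2)"
    proof (rule integral_mono)
      fix w assume "w \<in> space P"
      then have "(f w j)\<^sup>2 \<le> c\<^sup>2" using c by (metis abs_ge_zero power2_abs power_mono)
      then show "f w j * f w j \<le> c\<^sup>2" by (simp add: power2_eq_square)
    qed (use integrable_f_f[OF that(1,1)] in auto)
    then show ?thesis using orthonormal[OF that(1,1)] by (simp add: prob_space)
  qed
  have ge0: "0 \<le> x" "0 \<le> y" using x y not_empty by fastforce+
  have ge1: "1 \<le> x" "1 \<le> y"
    using sq[OF k x] sq[OF l y] ge0 by (simp_all add: power2_le_imp_le[of 1 x] power2_le_imp_le[of 1 y])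
  have xy: "1 \<le> x * y" using ge1 mult_mono[of 1 x 1 y] by simp
  have b: "\<bar>f w k * f w l\<bar> \<le> x * y" if "w \<in> space P" for w
    unfolding abs_mult using x[OF that] y[OF that] ge0 by (intro mult_mono) auto
  have int: "integrable P (\<lambda>w. (f w k * f w l)\<^sup>2)"
  proof (rule integrable_const_bound[where B="(x * y)\<^sup>2"])
    have "(f w k * f w l)\<^sup>2 \<le> (x * y)\<^sup>2" if "w \<in> space P" for w
      using b[OF that] by (metis abs_ge_zero power2_abs power_mono)
    then show "AE w in P. norm ((f w k * f w l)\<^sup>2) \<le> (x * y)\<^sup>2" by auto
  qed auto
  have second: "(LINT w|P. (f w k * f w l)\<^sup>2) \<le> (min x y)\<^sup>2"
  proof -
    have A: "(LINT w|P. (f w k * f w l)\<^sup>2) \<le> c\<^sup>2" if j: "j \<in> {1..D}"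
      and c: "\<And>w. w \<in> space P \<Longrightarrow> (f w k * f w l)\<^sup>2 \<le> c\<^sup>2 * (f w j * f w j)" for j c
    proof -
      have "(LINT w|P. (f w k * f w l)\<^sup>2) \<le> (LINT w|P. c\<^sup>2 * (f w j * f w j))"
        using int integrable_f_f[OF j j] c by (intro integral_mono) auto
      then show ?thesis using orthonormal[OF j j] by simp
    qed
    have "(f w k * f w l)\<^sup>2 \<le> x\<^sup>2 * (f w l * f w l)" if "w \<in> space P" for w
    proof -
      have "(f w k)\<^sup>2 \<le> x\<^sup>2" using x[OF that] by (metis abs_ge_zero power2_abs power_mono)
      then show ?thesis by (simp add: power_mult_distrib power2_eq_square[of "f w l"] mult_right_mono)
    qed
    moreover have "(f w k * f w l)\<^sup>2 \<le> y\<^sup>2 * (f w k * f w k)" if "w \<in> space P" for w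
    proof -
      have "(f w l)\<^sup>2 \<le> y\<^sup>2" using y[OF that] by (metis abs_ge_zero power2_abs power_mono)
      then have "(f w k)\<^sup>2 * (f w l)\<^sup>2 \<le> (f w k)\<^sup>2 * y\<^sup>2" by (rule mult_left_mono) simp
      then show ?thesis by (simp add: power_mult_distrib power2_eq_square[of "f w k"] mult.commute)
    qed
    ultimately show ?thesis using A[OF l, of x] A[OF k, of y] by (simp add: min_def)
  qed
  have "whp (PiM {1..n} (\<lambda>_. P)) (2 * exp (- t))
    (\<lambda>z. \<bar>\<Sum>i=1..n. f (z i) k * f (z i) l - \<delta>\<bar>
      \<le> 2 * sqrt (real n * (min x y)\<^sup>2 * t) + 2 * (2 * (x * y)) * t)"
  proof (rule martingale_bernstein_seq[where d = "\<lambda>i z w. f w k * f w l - \<delta>"])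
    show "\<bar>f w k * f w l - \<delta>\<bar> \<le> 2 * (x * y)" if "w \<in> space P" for w
    proof -
      have "\<bar>\<delta>\<bar> \<le> x * y" using xy by (auto simp: \<delta>_def)
      then show ?thesis using b[OF that] by linarith
    qed
    show "(LINT w|P. f w k * f w l - \<delta>) = 0"
      using integrable_f_f[OF k l] orthonormal[OF k l] by (simp add: prob_space \<delta>_def)
    have "(LINT w|P. (f w k * f w l - \<delta>)\<^sup>2) = (LINT w|P. (f w k * f w l)\<^sup>2) - \<delta>\<^sup>2"
      using variance_eq[OF integrable_f_f[OF k l] int] orthonormal[OF k l] by (simp add: \<delta>_def)
    then show "(LINT w|P. (f w k * f w l - \<delta>)\<^sup>2) \<le> (min x y)\<^sup>2"
      using second by (smt (verit) zero_le_power2)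
    show "2 * (x * y) > 0" "(min x y)\<^sup>2 > 0" using ge1 by auto
  qed (use assms in auto)
  then show ?thesis by (simp add: \<delta>_def)
qed

lemma gram_error_entries:
  assumes "n > 0" "k \<in> {1..D}"
  shows "gram_error z n c k
    = (\<Sum>l=1..D. ((\<Sum>i=1..n. f (z i) k * f (z i) l - (if k = l then 1 else 0)) / real n) * c l)"
proof -
  have "(\<Sum>l=1..D. ((\<Sum>i=1..n. f (z i) k * f (z i) l - (if k = l then 1 else 0)) / real n) * c l)
    = (\<Sum>l=1..D. (\<Sum>i=1..n. c l * f (z i) l * f (z i) k) / real n - (if k = l then c l else 0))"
    using assms(1) by (intro sum.cong refl) (auto simp: sum_subtractf field_simps sum_distrib_left)
  also have "\<dots> = (\<Sum>l=1..D. (\<Sum>i=1..n. c l * f (z i) l * f (z i) k)) / real n - c k"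
    using assms(2) by (simp add: sum_subtractf sum_divide_distrib sum.delta)
  also have "(\<Sum>l=1..D. (\<Sum>i=1..n. c l * f (z i) l * f (z i) k)) = (\<Sum>i=1..n. dot D c (f (z i)) * f (z i) k)"
    by (subst sum.swap) (simp add: dot_def sum_distrib_right)
  finally show ?thesis by (simp add: gram_error_def)
qed

text \<open>Since \<open>a i * t <= n\<close>, the bounded-increment term of Bernstein's inequality
  has the order of the variance term, so every squared entry is at most
  \<open>(2 r + 4 r^2)^2 (t / n)\<close> times the smaller block level, the form required by the
  Schur test. A union over \<open>D^2\<close> entries gives the probability.\<close>

theorem whp_gram_error:
  fixes a :: "nat \<Rightarrow> real"
  assumes n: "n > 0" and t: "t > 0" and b: "b \<ge> 1"
    and blk: "\<And>k. k \<in> {1..D} \<Longrightarrow> blk k \<in> {1..b}"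
    and a: "\<And>i. i \<in> {1..b} \<Longrightarrow> a i \<ge> 1" "\<And>i. i \<in> {1..b} \<Longrightarrow> a i * t \<le> real n"
    and bound: "\<And>w k. w \<in> space P \<Longrightarrow> k \<in> {1..D} \<Longrightarrow> \<bar>f w k\<bar> \<le> r * sqrt (a (blk k))"
    and card: "\<And>k j. k \<in> {1..D} \<Longrightarrow> j \<in> {1..b} \<Longrightarrow>
      real (card {l \<in> {1..D}. blk l = j \<and> (\<exists>w\<in>space P. f w k \<noteq> 0 \<and> f w l \<noteq> 0)})
        \<le> Ac * max (a j / a (blk k)) 1"
    and r: "r > 0" and Ac: "Ac \<ge> 0"
  shows "whp (PiM {1..n} (\<lambda>_. P)) (2 * (real D)\<^sup>2 * exp (- t)) (\<lambda>z. \<forall>c.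
    dot D (gram_error z n c) (gram_error z n c)
      \<le> Ac\<^sup>2 * ((2 * r + 4 * r\<^sup>2)\<^sup>2 * (t / real n)) * (\<Sum>i=1..b. \<Sum>j=1..b. max (a i) (a j)) * dot D c c)"
proof -
  let ?e = "\<lambda>z k l. \<Sum>i=1..n. f (z i) k * f (z i) l - (if k = l then 1 else 0)"
  let ?x = "\<lambda>k. r * sqrt (a (blk k))"
  let ?meet = "\<lambda>k l. \<exists>w\<in>space P. f w k \<noteq> 0 \<and> f w l \<noteq> 0"
  have W: "whp (PiM {1..n} (\<lambda>_. P)) (real (Finite_Set.card ({1..D} \<times> {1..D})) * (2 * exp (- t)))
    (\<lambda>z. \<forall>kl\<in>{1..D} \<times> {1..D}. \<bar>?e z (fst kl) (snd kl)\<bar>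
      \<le> 2 * sqrt (real n * (min (?x (fst kl)) (?x (snd kl)))\<^sup>2 * t) + 2 * (2 * (?x (fst kl) * ?x (snd kl))) * t)"
  proof (rule whp_ball)
    fix kl assume "kl \<in> {1..D} \<times> {1..D}"
    then have "fst kl \<in> {1..D}" "snd kl \<in> {1..D}" by auto
    then show "whp (PiM {1..n} (\<lambda>_. P)) (2 * exp (- t)) (\<lambda>z. \<bar>?e z (fst kl) (snd kl)\<bar>
      \<le> 2 * sqrt (real n * (min (?x (fst kl)) (?x (snd kl)))\<^sup>2 * t) + 2 * (2 * (?x (fst kl) * ?x (snd kl))) * t)"
      using whp_entry[OF _ _ t n bound bound] by blast
  qed auto
  have ent: "(2 * sqrt (real n * (min (?x k) (?x l))\<^sup>2 * t) + 2 * (2 * (?x k * ?x l)) * t)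
      \<le> (2 * r + 4 * r\<^sup>2) * sqrt (real n * t) * sqrt (min (a (blk k)) (a (blk l)))"
    if "k \<in> {1..D}" "l \<in> {1..D}" for k l
  proof -
    define \<alpha> where "\<alpha> = a (blk k)"
    define \<beta> where "\<beta> = a (blk l)"
    have ab: "\<alpha> \<ge> 1" "\<beta> \<ge> 1" "\<alpha> * t \<le> real n" "\<beta> * t \<le> real n"
      using a blk that by (auto simp: \<alpha>_def \<beta>_def)
    have mn: "min (?x k) (?x l) = r * sqrt (min \<alpha> \<beta>)"
      using r by (auto simp: \<alpha>_def \<beta>_def min_def)
    have 1: "sqrt (real n * (min (?x k) (?x l))\<^sup>2 * t) = r * sqrt (real n * t) * sqrt (min \<alpha> \<beta>)"
      unfolding mn using r ab by (simp add: real_sqrt_mult)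
    \<comment> \<open>The larger level is absorbed together with \<open>t\<close> into
      \<open>sqrt (n t)\<close>, which leaves only the smaller one.\<close>
    have mm: "sqrt \<alpha> * sqrt \<beta> = sqrt (min \<alpha> \<beta>) * sqrt (max \<alpha> \<beta>)"
      by (auto simp: min_def max_def)
    have mt: "sqrt (max \<alpha> \<beta>) * t \<le> sqrt (real n * t)"
    proof -
      have "(sqrt (max \<alpha> \<beta>) * t)\<^sup>2 = (max \<alpha> \<beta> * t) * t"
        using ab by (simp add: power_mult_distrib power2_eq_square[of t])
      also have "\<dots> \<le> real n * t" using ab t by (intro mult_right_mono) (auto simp: max_def)
      finally show ?thesis by (rule real_le_rsqrt)
    qed
    have "sqrt \<alpha> * sqrt \<beta> * t \<le> sqrt (min \<alpha> \<beta>) * sqrt (real n * t)"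
      unfolding mm mult.assoc by (rule mult_left_mono[OF mt]) (use ab in auto)
    then have "r\<^sup>2 * (sqrt \<alpha> * sqrt \<beta> * t) \<le> r\<^sup>2 * (sqrt (min \<alpha> \<beta>) * sqrt (real n * t))"
      by (intro mult_left_mono) auto
    then have 2: "?x k * ?x l * t \<le> r\<^sup>2 * sqrt (real n * t) * sqrt (min \<alpha> \<beta>)"
      by (simp add: \<alpha>_def \<beta>_def power2_eq_square mult_ac)
    have "(2 * r + 4 * r\<^sup>2) * sqrt (real n * t) * sqrt (min \<alpha> \<beta>)
      = 2 * (r * sqrt (real n * t) * sqrt (min \<alpha> \<beta>)) + 4 * (r\<^sup>2 * sqrt (real n * t) * sqrt (min \<alpha> \<beta>))"
      by (simp add: distrib_right)
    moreover have "2 * (2 * (?x k * ?x l)) * t = 4 * (?x k * ?x l * t)" by (simp only: mult_ac)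
    ultimately show ?thesis unfolding \<alpha>_def[symmetric] \<beta>_def[symmetric]
      using 1[folded \<alpha>_def \<beta>_def] 2[folded \<alpha>_def \<beta>_def] by linarith
  qed
  show ?thesis
  proof (rule whp_mono[OF W])
    fix z assume z: "z \<in> space (PiM {1..n} (\<lambda>_. P))"
    assume E: "\<forall>kl\<in>{1..D} \<times> {1..D}. \<bar>?e z (fst kl) (snd kl)\<bar>
      \<le> 2 * sqrt (real n * (min (?x (fst kl)) (?x (snd kl)))\<^sup>2 * t) + 2 * (2 * (?x (fst kl) * ?x (snd kl))) * t"
    have zs: "z i \<in> space P" if "i \<in> {1..n}" for i using z that by (auto simp: space_PiM)
    show "\<forall>c. dot D (gram_error z n c) (gram_error z n c)
      \<le> Ac\<^sup>2 * ((2 * r + 4 * r\<^sup>2)\<^sup>2 * (t / real n)) * (\<Sum>i=1..b. \<Sum>j=1..b. max (a i) (a j)) * dot D c c"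
    proof
      fix c
      have "dot D (gram_error z n c) (gram_error z n c) = (\<Sum>k=1..D. (\<Sum>l=1..D. (?e z k l / real n) * c l)\<^sup>2)"
        unfolding dot_def power2_eq_square[symmetric] by (intro sum.cong refl) (simp only: gram_error_entries[OF n])
      also have "\<dots> \<le> Ac\<^sup>2 * ((2 * r + 4 * r\<^sup>2)\<^sup>2 * (t / real n)) * (\<Sum>i=1..b. \<Sum>j=1..b. max (a i) (a j)) * (\<Sum>l=1..D. (c l)\<^sup>2)"
      proof (rule block_operator_bound[where meet = ?meet, OF b blk a(1) _ _ _ card])
        fix k l assume kl: "k \<in> {1..D}" "l \<in> {1..D}"
        have kl': "(k, l) \<in> {1..D} \<times> {1..D}" using kl by simp
        have e: "\<bar>?e z k l\<bar> \<le> (2 * r + 4 * r\<^sup>2) * sqrt (real n * t) * sqrt (min (a (blk k)) (a (blk l)))"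
          using bspec[OF E kl', unfolded fst_conv snd_conv] ent[OF kl] by (rule order_trans)
        have "(?e z k l)\<^sup>2 \<le> ((2 * r + 4 * r\<^sup>2) * sqrt (real n * t) * sqrt (min (a (blk k)) (a (blk l))))\<^sup>2"
          using power_mono[OF e abs_ge_zero, of 2] unfolding power2_abs .
        also have "\<dots> = (2 * r + 4 * r\<^sup>2)\<^sup>2 * (real n * t) * min (a (blk k)) (a (blk l))"
        proof -
          have "0 \<le> min (a (blk k)) (a (blk l))" using a(1)[OF blk[OF kl(1)]] a(1)[OF blk[OF kl(2)]] by simp
          moreover have "0 \<le> real n * t" using t by simp
          ultimately show ?thesis unfolding power_mult_distrib by (simp only: real_sqrt_pow2)
        qed
        finally show "(?e z k l / real n)\<^sup>2 \<le> (2 * r + 4 * r\<^sup>2)\<^sup>2 * (t / real n) * min (a (blk k)) (a (blk l))"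
          unfolding power_divide using n by (simp add: power2_eq_square[of "real n"] divide_simps mult_ac)
        assume m: "\<not> ?meet k l"
        \<comment> \<open>A basis function overlaps itself because its norm is one. For a pair
          without overlap the centering constant is therefore 0, and the products vanish at every
          sample point.\<close>
        have "k \<noteq> l"
        proof
          assume "k = l"
          then have "(LINT w|P. f w k * f w k) = (LINT w|P. 0)"
            using m by (intro Bochner_Integration.integral_cong) auto
          then show False using orthonormal[OF kl(1,1)] by simp
        qed
        then show "?e z k l / real n = 0" using m zs by (auto intro!: sum.neutral)
      qed (use Ac t in auto)
      finally show "dot D (gram_error z n c) (gram_error z n c)
        \<le> Ac\<^sup>2 * ((2 * r + 4 * r\<^sup>2)\<^sup>2 * (t / real n)) * (\<Sum>i=1..b. \<Sum>j=1..b. max (a i) (a j)) * dot D c c"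
        by (simp add: dot_def power2_eq_square)
    qed
  qed (simp add: power2_eq_square)
qed

end

section \<open>Least squares\<close>

lemma quadratic_minimum_stationary:
  fixes x y :: real
  assumes "\<And>l. 0 \<le> l\<^sup>2 * y - 2 * l * x" and "0 \<le> y"
  shows "x = 0"
proof -
  \<comment> \<open>The exact minimizer would be \<open>x / y\<close>; the shifted denominator also
    covers \<open>y = 0\<close>.\<close>
  define u where "u = x / (y + 1)"
  have x: "x = u * (y + 1)" using assms(2) by (simp add: u_def)
  have "u\<^sup>2 * y - 2 * u * x = - (u\<^sup>2 * (y + 2))"
    by (simp add: x power2_eq_square algebra_simps)
  then have "u\<^sup>2 * (y + 2) \<le> 0" using assms(1)[of u] by linarith
  then show ?thesis using assms(2) by (simp add: x mult_le_0_iff)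
qed

text \<open>Brings the weight total of the Schur test into the form that localization controls: one
  factor \<open>sqrt (a i)\<close> is traded for \<open>sqrt m\<close>, and the remaining sum of
  square roots is at most \<open>r sqrt D\<close>.\<close>

lemma sum_max_le:
  fixes a :: "nat \<Rightarrow> real"
  assumes a: "\<And>i. i \<in> {1..b} \<Longrightarrow> 0 \<le> a i \<and> a i \<le> m"
  shows "(\<Sum>i=1..b. \<Sum>j=1..b. max (a i) (a j)) \<le> 2 * real b * sqrt m * (\<Sum>i=1..b. sqrt (a i))"
proof -
  have "(\<Sum>i=1..b. \<Sum>j=1..b. max (a i) (a j)) \<le> (\<Sum>i=1..b. \<Sum>j=1..b. a i + a j)"
    using a by (intro sum_mono) (auto simp: max_def)
  also have "\<dots> = 2 * real b * (\<Sum>i=1..b. a i)"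
    by (simp add: sum.distrib sum_distrib_left[symmetric])
  also have "(\<Sum>i=1..b. a i) \<le> (\<Sum>i=1..b. sqrt m * sqrt (a i))"
  proof (intro sum_mono)
    fix i assume "i \<in> {1..b}"
    then have "0 \<le> a i" "sqrt (a i) \<le> sqrt m" using a by auto
    then have "sqrt (a i) * sqrt (a i) \<le> sqrt m * sqrt (a i)" by (intro mult_right_mono) auto
    then show "a i \<le> sqrt m * sqrt (a i)" using \<open>0 \<le> a i\<close> by simp
  qed
  finally show ?thesis by (simp add: sum_distrib_left[symmetric] mult_left_mono mult.assoc)
qed

context bounded_design
begin

lemma dot_gram_error:
  "dot D a (gram_error z n c) = (\<Sum>i=1..n. dot D a (f (z i)) * dot D c (f (z i))) / real n - dot D a c"
proof -
  have "dot D (gram_error z n c) a = dot D (\<lambda>l. (1 / real n) * (\<Sum>i=1..n. dot D c (f (z i)) * f (z i) l)) a - dot D c a"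
    by (simp add: gram_error_def[abs_def] dot_diff)
  also have "dot D (\<lambda>l. (1 / real n) * (\<Sum>i=1..n. dot D c (f (z i)) * f (z i) l)) a
      = (1 / real n) * (\<Sum>i=1..n. dot D c (f (z i)) * dot D (f (z i)) a)"
    unfolding dot_scale dot_sum by simp
  also have "(\<Sum>i=1..n. dot D c (f (z i)) * dot D (f (z i)) a) = (\<Sum>i=1..n. dot D a (f (z i)) * dot D c (f (z i)))"
    by (intro sum.cong refl) (simp only: dot_commute[of D "f _" a] mult.commute)
  finally show ?thesis unfolding dot_commute[of D a "gram_error z n c"] dot_commute[of D a c] by simp
qed

lemma dot_gram_error_sym: "dot D a (gram_error z n c) = dot D c (gram_error z n a)"
  by (simp add: dot_gram_error dot_commute[of D a c] mult.commute)

text \<open>Minimality enters through the normal equation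
  \<open>v = \<beta> + \<Delta> \<beta>\<close>, tested against arbitrary vectors. Squaring it
  relates \<open>|\<beta>|^2\<close> to \<open>|v|^2\<close>; using it a second time isolates the
  first-order term of the empirical risk.\<close>

lemma least_squares_expansion:
  fixes z :: "nat \<Rightarrow> 'b" and n :: nat and \<beta> :: "nat \<Rightarrow> real"
  defines "v \<equiv> \<lambda>l. score z n l / real n"
  assumes n: "n > 0"
    and min: "\<And>c. (\<Sum>i=1..n. (\<eta> (z i) - dot D \<beta> (f (z i)))\<^sup>2) \<le> (\<Sum>i=1..n. (\<eta> (z i) - dot D c (f (z i)))\<^sup>2)"
    and e: "\<And>c. dot D (gram_error z n c) (gram_error z n c) \<le> e\<^sup>2 * dot D c c" "0 \<le> e" "e \<le> 1 / 8"
  shows "\<bar>dot D \<beta> \<beta> - dot D v v\<bar> \<le> 4 * e * dot D v v" (is ?A)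
    and "\<bar>(\<Sum>i=1..n. (\<eta> (z i))\<^sup>2 - (\<eta> (z i) - dot D \<beta> (f (z i)))\<^sup>2) / real n - dot D v v\<bar>
      \<le> \<bar>dot D v (gram_error z n v)\<bar> + 2 * e\<^sup>2 * dot D v v" (is ?B)
proof -
  let ?\<Delta> = "gram_error z n"
  have n0: "real n > 0" using n by simp
  have dv: "dot D c v = (\<Sum>i=1..n. \<eta> (z i) * dot D c (f (z i))) / real n" for c
  proof -
    have "dot D v c = dot D (\<lambda>l. (1 / real n) * score z n l) c" by (simp add: v_def)
    also have "\<dots> = (1 / real n) * (\<Sum>i=1..n. \<eta> (z i) * dot D (f (z i)) c)"
      unfolding score_def dot_scale dot_sum by (simp add: dot_scale)
    also have "(\<Sum>i=1..n. \<eta> (z i) * dot D (f (z i)) c) = (\<Sum>i=1..n. \<eta> (z i) * dot D c (f (z i)))"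
      by (intro sum.cong refl) (simp only: dot_commute[of D "f _" c])
    finally show ?thesis unfolding dot_commute[of D c v] by simp
  qed
  have normal: "dot D c v = dot D c \<beta> + dot D c (?\<Delta> \<beta>)" for c
  proof -
    define X where "X = (\<Sum>i=1..n. (\<eta> (z i) - dot D \<beta> (f (z i))) * dot D c (f (z i)))"
    define Y where "Y = (\<Sum>i=1..n. (dot D c (f (z i)))\<^sup>2)"
    have "X = 0"
    proof (rule quadratic_minimum_stationary)
      fix l
      have "(\<Sum>i=1..n. (\<eta> (z i) - dot D (\<lambda>j. l * c j + \<beta> j) (f (z i)))\<^sup>2)
        = (\<Sum>i=1..n. (\<eta> (z i) - dot D \<beta> (f (z i)))\<^sup>2 - 2 * l * ((\<eta> (z i) - dot D \<beta> (f (z i))) * dot D c (f (z i)))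
            + l\<^sup>2 * (dot D c (f (z i)))\<^sup>2)"
        by (intro sum.cong refl) (simp add: dot_add dot_scale power2_eq_square algebra_simps)
      also have "\<dots> = (\<Sum>i=1..n. (\<eta> (z i) - dot D \<beta> (f (z i)))\<^sup>2) - 2 * l * X + l\<^sup>2 * Y"
        by (simp add: X_def Y_def sum.distrib sum_subtractf sum_distrib_left)
      finally show "0 \<le> l\<^sup>2 * Y - 2 * l * X"
        using min[of "\<lambda>j. l * c j + \<beta> j"] by linarith
    qed (simp add: Y_def sum_nonneg)
    then have "(\<Sum>i=1..n. \<eta> (z i) * dot D c (f (z i))) = (\<Sum>i=1..n. dot D c (f (z i)) * dot D \<beta> (f (z i)))"
      unfolding X_def left_diff_distrib sum_subtractf by (simp add: mult.commute)
    then show ?thesis unfolding dv dot_gram_error by simp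
  qed
  define bb where "bb = dot D \<beta> \<beta>"
  define vv where "vv = dot D v v"
  define d where "d = dot D \<beta> (?\<Delta> \<beta>)"
  define dd where "dd = dot D (?\<Delta> \<beta>) (?\<Delta> \<beta>)"
  have nn: "0 \<le> bb" "0 \<le> vv" "0 \<le> dd" by (simp_all add: bb_def vv_def dd_def)
  have dd: "dd \<le> e\<^sup>2 * bb" unfolding dd_def bb_def by (rule e(1))
  have d: "\<bar>d\<bar> \<le> e * bb"
  proof -
    have "\<bar>d\<bar> \<le> sqrt (bb * (e\<^sup>2 * bb))"
      unfolding d_def by (rule abs_dot_le) (use dd in \<open>auto simp: bb_def dd_def\<close>)
    also have "bb * (e\<^sup>2 * bb) = (e * bb)\<^sup>2" by (simp add: power2_eq_square)
    finally show ?thesis using e(2) nn by simp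
  qed
  have vv: "vv = bb + 2 * d + dd"
    using normal[of v] normal[of \<beta>] normal[of "?\<Delta> \<beta>"]
    unfolding vv_def bb_def d_def dd_def by (simp add: dot_commute)
  have e2: "e\<^sup>2 \<le> e / 8" using e(2,3) mult_left_mono[of e "1/8" e] by (simp add: power2_eq_square)
  have e2b: "e\<^sup>2 * bb \<le> e / 8 * bb" using e2 nn by (intro mult_right_mono) auto
  have eb: "e * bb \<le> bb / 8" using e(3) nn mult_right_mono[of e "1/8" bb] by simp
  have low: "bb * (3 / 4) \<le> vv" using vv d eb nn by linarith
  have up: "vv \<le> bb * (4 / 3)" using vv d eb dd e2b nn by linarith
  \<comment> \<open>The linear term gives 2 and the quadratic one at most \<open>1 / 8\<close>.
    Replacing \<open>|\<beta>|^2\<close> by \<open>|v|^2\<close> costs \<open>4 / 3\<close>, and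
    \<open>17 / 6\<close> is below 4.\<close>
  have "\<bar>bb - vv\<bar> \<le> (17 / 8) * (e * bb)" using vv d dd e2b nn by linarith
  also have "e * bb \<le> e * (vv * (4 / 3))" using low e(2) by (intro mult_left_mono) auto
  finally have "\<bar>bb - vv\<bar> \<le> (17 / 6) * (e * vv)" by simp
  moreover have "0 \<le> e * vv" using e(2) nn by simp
  ultimately show ?A unfolding bb_def vv_def by (simp add: mult.assoc)
  \<comment> \<open>The normal equation tested against \<open>\<beta>\<close> identifies the
    quadratic term with half of the cross term.\<close>
  have emp: "(\<Sum>i=1..n. (\<eta> (z i))\<^sup>2 - (\<eta> (z i) - dot D \<beta> (f (z i)))\<^sup>2) / real n = dot D \<beta> v"
  proof -
    have "(\<Sum>i=1..n. (\<eta> (z i))\<^sup>2 - (\<eta> (z i) - dot D \<beta> (f (z i)))\<^sup>2)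
      = 2 * (\<Sum>i=1..n. \<eta> (z i) * dot D \<beta> (f (z i))) - (\<Sum>i=1..n. dot D \<beta> (f (z i)) * dot D \<beta> (f (z i)))"
      by (simp add: sum_distrib_left sum_subtractf[symmetric] power2_eq_square algebra_simps)
    moreover have "(\<Sum>i=1..n. dot D \<beta> (f (z i)) * dot D \<beta> (f (z i))) = (\<Sum>i=1..n. \<eta> (z i) * dot D \<beta> (f (z i)))"
      using normal[of \<beta>] dv[of \<beta>] n unfolding dot_gram_error by simp
    ultimately show ?thesis using dv[of \<beta>] by simp
  qed
  \<comment> \<open>Testing against \<open>v\<close> and then against \<open>\<Delta> v\<close>,
    with the symmetry of \<open>\<Delta>\<close>, keeps \<open>v . \<Delta> v\<close> apart from a
    remainder of second order. Only the remainder is bounded by the operator norm.\<close>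
  have "dot D \<beta> v - vv = - dot D v (?\<Delta> v) + dot D (?\<Delta> v) (?\<Delta> \<beta>)"
    using normal[of v] normal[of "?\<Delta> v"] dot_gram_error_sym[of v z n \<beta>] unfolding vv_def
    by (simp add: dot_commute)
  moreover have "\<bar>dot D (?\<Delta> v) (?\<Delta> \<beta>)\<bar> \<le> 2 * e\<^sup>2 * vv"
  proof -
    have "\<bar>dot D (?\<Delta> v) (?\<Delta> \<beta>)\<bar> \<le> sqrt ((e\<^sup>2 * vv) * (e\<^sup>2 * bb))"
      by (rule abs_dot_le) (use e(1) in \<open>auto simp: vv_def bb_def\<close>)
    also have "\<dots> \<le> sqrt ((2 * e\<^sup>2 * vv)\<^sup>2)"
    proof (rule real_sqrt_le_mono)
      have "(e\<^sup>2 * vv) * (e\<^sup>2 * bb) \<le> (e\<^sup>2 * vv) * (e\<^sup>2 * (4 * vv))"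
        using low nn by (intro mult_left_mono) auto
      then show "(e\<^sup>2 * vv) * (e\<^sup>2 * bb) \<le> (2 * e\<^sup>2 * vv)\<^sup>2" by (simp add: power2_eq_square mult_ac)
    qed
    finally show ?thesis using nn by simp
  qed
  ultimately show ?B unfolding emp vv_def[symmetric] by linarith
qed

lemma dot_score_normalized:
  assumes "n > 0"
  shows "dot D (\<lambda>l. score z n l / real n) (\<lambda>l. score z n l / real n) = score_energy z n / (real n)\<^sup>2"
    "dot D (\<lambda>l. score z n l / real n) (gram_error z n (\<lambda>l. score z n l / real n))
      = (gram_energy z n - real n * score_energy z n) / (real n)^3"
proof -
  have s: "dot D (\<lambda>l. score z n l / real n) c = dot D (score z n) c / real n" for c
    using dot_scale[of D "1 / real n" "score z n" c] by simp
  show 1: "dot D (\<lambda>l. score z n l / real n) (\<lambda>l. score z n l / real n) = score_energy z n / (real n)\<^sup>2"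
    unfolding s dot_commute[of D "score z n" "\<lambda>l. score z n l / real n"] score_energy_def
    by (simp add: power2_eq_square)
  show "dot D (\<lambda>l. score z n l / real n) (gram_error z n (\<lambda>l. score z n l / real n))
      = (gram_energy z n - real n * score_energy z n) / (real n)^3"
    unfolding dot_gram_error 1 unfolding s gram_energy_def using assms
    by (simp add: sum_divide_distrib[symmetric] power2_eq_square power3_eq_cube field_simps)
qed

text \<open>Joins the deterministic expansion to the two concentration results. Quantifying over all
  minimizing \<open>\<beta>\<close> inside the event avoids any choice or measurability of the
  minimizer at this stage.\<close>

theorem least_squares_concentration:
  fixes a :: "nat \<Rightarrow> real" and n :: nat and t e :: real
  defines "\<rho> \<equiv> sqrt (t / N) + sqrt (N * t / real n)"
  assumes n: "n > 0" and t: "t \<ge> 1" and small: "\<rho> \<le> 1 / 16"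
    and b: "b \<ge> 1" and blk: "\<And>k. k \<in> {1..D} \<Longrightarrow> blk k \<in> {1..b}"
    and a: "\<And>i. i \<in> {1..b} \<Longrightarrow> a i \<ge> 1" "\<And>i. i \<in> {1..b} \<Longrightarrow> a i * t \<le> real n"
    and bound: "\<And>w k. w \<in> space P \<Longrightarrow> k \<in> {1..D} \<Longrightarrow> \<bar>f w k\<bar> \<le> r * sqrt (a (blk k))"
    and card: "\<And>k j. k \<in> {1..D} \<Longrightarrow> j \<in> {1..b} \<Longrightarrow>
      real (card {l \<in> {1..D}. blk l = j \<and> (\<exists>w\<in>space P. f w k \<noteq> 0 \<and> f w l \<noteq> 0)})
        \<le> Ac * max (a j / a (blk k)) 1"
    and r: "r > 0" and Ac: "Ac \<ge> 0"
    and e: "Ac\<^sup>2 * ((2 * r + 4 * r\<^sup>2)\<^sup>2 * (t / real n)) * (\<Sum>i=1..b. \<Sum>j=1..b. max (a i) (a j)) \<le> e\<^sup>2"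
      "0 \<le> e" "e \<le> 1 / 8"
  shows "whp (PiM {1..n} (\<lambda>_. P)) ((2 * (real D)\<^sup>2 + 4 * real n + 6) * exp (- t)) (\<lambda>z. \<forall>\<beta>.
    (\<forall>c. (\<Sum>i=1..n. (\<eta> (z i) - dot D \<beta> (f (z i)))\<^sup>2) \<le> (\<Sum>i=1..n. (\<eta> (z i) - dot D c (f (z i)))\<^sup>2)) \<longrightarrow>
    \<bar>dot D \<beta> \<beta> - noise_energy / real n\<bar> \<le> L\<^sup>2 * N / real n * (8 * e + 11 * \<rho>) \<and>
    \<bar>(\<Sum>i=1..n. (\<eta> (z i))\<^sup>2 - (\<eta> (z i) - dot D \<beta> (f (z i)))\<^sup>2) / real n - noise_energy / real n\<bar>
      \<le> L\<^sup>2 * N / real n * (4 * e\<^sup>2 + 61 * \<rho>))"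
proof (rule whp_mono[OF whp_conj[OF whp_gram_error[OF n _ b blk a bound card r Ac] score_concentration[OF n t]]])
  fix z assume "(\<forall>c. dot D (gram_error z n c) (gram_error z n c)
      \<le> Ac\<^sup>2 * ((2 * r + 4 * r\<^sup>2)\<^sup>2 * (t / real n)) * (\<Sum>i=1..b. \<Sum>j=1..b. max (a i) (a j)) * dot D c c) \<and>
    \<bar>score_energy z n - real n * noise_energy\<bar> \<le> 11 * L\<^sup>2 * real n * N * (sqrt (t / N) + sqrt (N * t / real n)) \<and>
    ((\<forall>c. (\<Sum>i=1..n. (dot D c (f (z i)))\<^sup>2) \<le> 2 * real n * dot D c c) \<longrightarrow>
      \<bar>gram_energy z n - real n * score_energy z n\<bar> \<le> 50 * L\<^sup>2 * (real n)\<^sup>2 * N * (sqrt (t / N) + sqrt (N * t / real n)))"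
  note E = this[folded \<rho>_def]
  let ?v = "\<lambda>l. score z n l / real n"
  have n0: "real n > 0" using n by simp
  have N0: "N > 0" using N_ge_1 by simp
  have \<rho>0: "0 \<le> \<rho>" using N0 t by (simp add: \<rho>_def)
  have err: "dot D (gram_error z n c) (gram_error z n c) \<le> e\<^sup>2 * dot D c c" for c
    using E mult_right_mono[OF e(1) dot_self_nonneg[of D c]] by (meson order_trans)
  \<comment> \<open>\<open>\<Delta>\<close> of norm at most \<open>1 / 8\<close> bounds the Gram
    matrix by 2, which releases the conditional half of the score estimate.\<close>
  have op: "(\<Sum>i=1..n. (dot D c (f (z i)))\<^sup>2) \<le> 2 * real n * dot D c c" for c
  proof -
    have "\<bar>dot D c (gram_error z n c)\<bar> \<le> sqrt (dot D c c * (e\<^sup>2 * dot D c c))"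
      by (rule abs_dot_le[OF order_refl err])
    also have "dot D c c * (e\<^sup>2 * dot D c c) = (e * dot D c c)\<^sup>2" by (simp add: power2_eq_square)
    also have "sqrt ((e * dot D c c)\<^sup>2) = e * dot D c c" using e(2) by simp
    also have "\<dots> \<le> 1 * dot D c c" using e(3) by (intro mult_right_mono) auto
    finally have "(\<Sum>i=1..n. (dot D c (f (z i)))\<^sup>2) / real n \<le> 2 * dot D c c"
      by (simp add: dot_gram_error power2_eq_square)
    then show ?thesis using n0 by (simp add: field_simps)
  qed
  have Q: "\<bar>score_energy z n - real n * noise_energy\<bar> \<le> 11 * L\<^sup>2 * real n * N * \<rho>"
    and F: "\<bar>gram_energy z n - real n * score_energy z n\<bar> \<le> 50 * L\<^sup>2 * (real n)\<^sup>2 * N * \<rho>"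
    using E op by auto
  define U where "U = L\<^sup>2 * N / real n"
  have U0: "U \<ge> 0" using N0 by (simp add: U_def)
  have vv: "\<bar>dot D ?v ?v - noise_energy / real n\<bar> \<le> U * (11 * \<rho>)"
  proof -
    have "dot D ?v ?v - noise_energy / real n = (score_energy z n - real n * noise_energy) / (real n)\<^sup>2"
      using n0 unfolding dot_score_normalized[OF n] by (simp add: field_simps power2_eq_square)
    then have "\<bar>dot D ?v ?v - noise_energy / real n\<bar> = \<bar>score_energy z n - real n * noise_energy\<bar> / (real n)\<^sup>2" by simp
    also have "\<dots> \<le> 11 * L\<^sup>2 * real n * N * \<rho> / (real n)\<^sup>2" using Q by (intro divide_right_mono) auto
    also have "\<dots> = U * (11 * \<rho>)" using n0 by (simp add: U_def field_simps power2_eq_square)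
    finally show ?thesis .
  qed
  have vdv: "\<bar>dot D ?v (gram_error z n ?v)\<bar> \<le> U * (50 * \<rho>)"
  proof -
    have "\<bar>dot D ?v (gram_error z n ?v)\<bar> = \<bar>gram_energy z n - real n * score_energy z n\<bar> / (real n)^3"
      unfolding dot_score_normalized[OF n] by simp
    also have "\<dots> \<le> 50 * L\<^sup>2 * (real n)\<^sup>2 * N * \<rho> / (real n)^3" using F by (intro divide_right_mono) auto
    also have "\<dots> = U * (50 * \<rho>)" using n0 by (simp add: U_def field_simps power2_eq_square power3_eq_cube)
    finally show ?thesis .
  qed
  \<comment> \<open>Since \<open>11 * \<rho> <= 1\<close>, the squared norm of \<open>v\<close> is
    at most \<open>2 U\<close>; this turns the factors \<open>4 e\<close> and \<open>2 e^2\<close>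
    of the expansion into \<open>8 e\<close> and \<open>4 e^2\<close>.\<close>
  have vv2: "dot D ?v ?v \<le> 2 * U"
  proof -
    have "noise_energy / real n \<le> U" using noise_energy_le n0 unfolding U_def by (intro divide_right_mono) auto
    moreover have "U * (11 * \<rho>) \<le> U * 1" using small U0 by (intro mult_left_mono) auto
    ultimately show ?thesis using vv by linarith
  qed
  show "\<forall>\<beta>. (\<forall>c. (\<Sum>i=1..n. (\<eta> (z i) - dot D \<beta> (f (z i)))\<^sup>2) \<le> (\<Sum>i=1..n. (\<eta> (z i) - dot D c (f (z i)))\<^sup>2)) \<longrightarrow>
    \<bar>dot D \<beta> \<beta> - noise_energy / real n\<bar> \<le> L\<^sup>2 * N / real n * (8 * e + 11 * \<rho>) \<and>
    \<bar>(\<Sum>i=1..n. (\<eta> (z i))\<^sup>2 - (\<eta> (z i) - dot D \<beta> (f (z i)))\<^sup>2) / real n - noise_energy / real n\<bar>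
      \<le> L\<^sup>2 * N / real n * (4 * e\<^sup>2 + 61 * \<rho>)"
  proof (intro allI impI)
    fix \<beta> assume min: "\<forall>c. (\<Sum>i=1..n. (\<eta> (z i) - dot D \<beta> (f (z i)))\<^sup>2) \<le> (\<Sum>i=1..n. (\<eta> (z i) - dot D c (f (z i)))\<^sup>2)"
    note ls = least_squares_expansion[OF n min[rule_format] err e(2,3)]
    have "4 * e * dot D ?v ?v \<le> 4 * e * (2 * U)" "2 * e\<^sup>2 * dot D ?v ?v \<le> 2 * e\<^sup>2 * (2 * U)"
      using vv2 e(2) by (intro mult_left_mono; simp)+
    moreover have "U * (8 * e + 11 * \<rho>) = 4 * e * (2 * U) + U * (11 * \<rho>)"
      "U * (4 * e\<^sup>2 + 61 * \<rho>) = U * (50 * \<rho>) + 2 * e\<^sup>2 * (2 * U) + U * (11 * \<rho>)"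
      by (simp_all add: algebra_simps)
    ultimately show "\<bar>dot D \<beta> \<beta> - noise_energy / real n\<bar> \<le> L\<^sup>2 * N / real n * (8 * e + 11 * \<rho>) \<and>
      \<bar>(\<Sum>i=1..n. (\<eta> (z i))\<^sup>2 - (\<eta> (z i) - dot D \<beta> (f (z i)))\<^sup>2) / real n - noise_energy / real n\<bar>
        \<le> L\<^sup>2 * N / real n * (4 * e\<^sup>2 + 61 * \<rho>)"
      using ls vv vdv unfolding U_def[symmetric] by linarith
  qed
qed (use small t in \<open>auto simp: \<rho>_def algebra_simps\<close>)

end

section \<open>The regression model\<close>

lemma clamp_eq: "\<bar>x\<bar> \<le> L \<Longrightarrow> max (- L) (min L x) = (x::real)"
  by auto

lemma clamp_abs_le: "0 \<le> L \<Longrightarrow> \<bar>max (- L) (min L x)\<bar> \<le> (L::real)"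
  by auto

lemma sup_norm_leD:
  assumes "sup_norm X f \<le> ereal c" "x \<in> X"
  shows "\<bar>f x\<bar> \<le> c"
proof -
  have "ereal \<bar>f x\<bar> \<le> sup_norm X f"
    unfolding sup_norm_def by (rule SUP_upper[OF assms(2)])
  with assms(1) show ?thesis by (metis ereal_less_eq(3) order_trans)
qed

lemma linear_L2_subspace_sum:
  assumes "linear_L2_subspace M m" "g \<in> m" "finite K" "\<And>k. k \<in> K \<Longrightarrow> \<phi> k \<in> m"
  shows "(\<lambda>x. g x + (\<Sum>k\<in>K. c k * \<phi> k x)) \<in> m"
  using assms(3,4)
proof (induction K rule: finite_induct)
  case empty
  then show ?case using assms(2) by simp
next
  case (insert k K)
  then have "(\<lambda>x. g x + (\<Sum>k\<in>K. c k * \<phi> k x)) \<in> m" "(\<lambda>x. c k * \<phi> k x) \<in> m"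
    using assms(1) by (auto simp: linear_L2_subspace_def)
  then have "(\<lambda>x. (g x + (\<Sum>k\<in>K. c k * \<phi> k x)) + c k * \<phi> k x) \<in> m"
    using assms(1) by (auto simp: linear_L2_subspace_def)
  moreover have "(\<lambda>x. (g x + (\<Sum>k\<in>K. c k * \<phi> k x)) + c k * \<phi> k x)
      = (\<lambda>x. g x + (\<Sum>k\<in>insert k K. c k * \<phi> k x))"
    using insert.hyps by (simp add: add_ac)
  ultimately show ?case by simp
qed

locale regression_model =
  fixes d :: nat and X :: "point set" and Q :: "(point \<times> real) measure"
    and s_star \<sigma> :: "point \<Rightarrow> real" and m :: "(point \<Rightarrow> real) set" and D :: nat
    and \<phi> :: "nat \<Rightarrow> point \<Rightarrow> real" and b :: nat and parts :: "nat \<Rightarrow> nat set" and a :: "nat \<Rightarrow> real"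
    and s_m :: "point \<Rightarrow> real" and A \<sigma>_min r Ac :: real
    and S :: "point measure" and P :: "(point \<times> real) measure" and PX :: "point measure"
  defines "S \<equiv> design_space d X"
  defines "P \<equiv> regression_law S Q s_star \<sigma>"
  defines "PX \<equiv> design_law S P"
  assumes X: "X \<subseteq> space (PiM {..<d} (\<lambda>_. borel :: real measure))"
    and noise: "noise_law S Q"
    and s_star: "s_star \<in> L2_fun PX"
    and \<sigma>: "\<sigma> \<in> borel_measurable S"
    and lin: "linear_L2_subspace PX m"
    and basis: "strongly_localized_basis PX m D \<phi> r b parts a Ac"
    and proj: "orthogonal_projection_on PX m s_star s_m"
    and Y_bound: "AE (x, y) in P. \<bar>y\<bar> \<le> A"
    and s_m_bound: "sup_norm X s_m \<le> ereal A"
    and \<sigma>_lower: "AE x in PX. \<sigma> x \<ge> \<sigma>_min"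
    and A_pos: "A > 0" and \<sigma>_min_pos: "\<sigma>_min > 0" and D_pos: "D \<ge> 1"
begin

text \<open>Uniform bound on the sum of the squared basis functions: at most \<open>Ac\<close>
  functions per block are nonzero at a point, each with square at most \<open>r^2 a i\<close>, and
  the sum of the \<open>a i\<close> is at most the square of the sum of their roots, hence at most
  \<open>r^2 D\<close>.\<close>

definition N where "N = Ac * r^4 * real D"
definition L where "L = 2 * A"
text \<open>Zero outside \<open>{1..D}\<close>, because a bounded design asks for measurability at
  every index.\<close>

definition f where "f w l = (if l \<in> {1..D} then \<phi> l (fst w) else 0)" for w :: "point \<times> real" and l
definition \<xi> where "\<xi> w = snd w - s_m (fst w)" for w :: "point \<times> real"

text \<open>The residual is bounded only almost surely; clamping it makes it bounded everywhere.\<close>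

definition \<eta> where "\<eta> w = max (- L) (min L (\<xi> w))" for w

text \<open>Carries \<open>(X, \<epsilon>)\<close> to \<open>(X, Y)\<close>. Integrals under
  \<open>P\<close> are pulled back to \<open>Q\<close>, where the conditional moments of the noise
  are given.\<close>

definition T where "T = (\<lambda>(x, e). (x, s_star x + \<sigma> x * e))"

lemma space_S: "space S = X"
  using X by (simp add: S_def design_space_def space_restrict_space Int_absorb2)

sublocale Q: prob_space Q
  using noise by (simp add: noise_law_def)

lemma sets_Q: "sets Q = sets (S \<Otimes>\<^sub>M borel)"
  using noise by (simp add: noise_law_def)

lemma space_Q: "space Q = X \<times> UNIV"
  using sets_eq_imp_space_eq[OF sets_Q] by (simp add: space_pair_measure space_S)

lemma sets_PX: "sets PX = sets S" and sets_P: "sets P = sets (S \<Otimes>\<^sub>M borel)"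
  by (simp_all add: PX_def design_law_def P_def regression_law_def)

lemma space_PX: "space PX = X" and space_P: "space P = X \<times> UNIV"
  using sets_eq_imp_space_eq[OF sets_PX] sets_eq_imp_space_eq[OF sets_P]
  by (simp_all add: space_pair_measure space_S)

lemma s_star_meas [measurable]: "s_star \<in> borel_measurable S"
  using s_star measurable_cong_sets[OF sets_PX refl] by (auto simp: L2_fun_def)

lemma \<sigma>_meas [measurable]: "\<sigma> \<in> borel_measurable S"
  by (rule \<sigma>)

lemma fst_Q [measurable]: "fst \<in> measurable Q S" and fst_P [measurable]: "fst \<in> measurable P S"
  and snd_Q [measurable]: "snd \<in> borel_measurable Q" and snd_P [measurable]: "snd \<in> borel_measurable P"
  by (simp_all add: measurable_cong_sets[OF sets_Q refl] measurable_cong_sets[OF sets_P refl])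

lemma T_eq: "T w = (fst w, s_star (fst w) + \<sigma> (fst w) * snd w)"
  by (simp add: T_def split_beta')

lemma T_meas [measurable]: "T \<in> measurable Q P"
proof -
  have "(\<lambda>w. (fst w, s_star (fst w) + \<sigma> (fst w) * snd w)) \<in> measurable Q (S \<Otimes>\<^sub>M borel)" by measurable
  then show ?thesis
    unfolding T_eq[abs_def] measurable_cong_sets[OF refl sets_P] .
qed

lemma P_eq: "P = distr Q P T"
proof -
  have "P = distr Q (S \<Otimes>\<^sub>M borel) T" by (simp add: P_def regression_law_def T_def)
  also have "\<dots> = distr Q P T" by (rule distr_cong) (simp_all add: sets_P)
  finally show ?thesis .
qed

sublocale P: prob_space P
proof -
  have "prob_space (distr Q P T)" by (rule Q.prob_space_distr) measurable
  then show "prob_space P" by (simp add: P_eq[symmetric])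
qed

lemma integral_P:
  fixes h :: "point \<times> real \<Rightarrow> real"
  assumes "h \<in> borel_measurable P"
  shows "(LINT w|P. h w) = (LINT w|Q. h (T w))" "integrable P h \<longleftrightarrow> integrable Q (\<lambda>w. h (T w))"
  using assms integral_distr[OF T_meas, of h] integrable_distr_eq[OF T_meas, of h] by (simp_all add: P_eq[symmetric])

lemma AE_P: "(AE w in P. R w) \<Longrightarrow> (AE w in Q. R (T w))"
  by (rule AE_distrD[OF T_meas]) (subst (asm) P_eq)

lemma PX_eq: "PX = distr P S fst"
  by (simp add: PX_def design_law_def)

lemma integral_PX:
  fixes h :: "point \<Rightarrow> real"
  assumes [measurable]: "h \<in> borel_measurable S"
  shows "(LINT x|PX. h x) = (LINT w|Q. h (fst w))" "integrable PX h \<longleftrightarrow> integrable Q (\<lambda>w. h (fst w))"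
    "(LINT x|PX. h x) = (LINT w|P. h (fst w))"
proof -
  have m: "(\<lambda>w. h (fst w)) \<in> borel_measurable P" by measurable
  show "(LINT x|PX. h x) = (LINT w|P. h (fst w))"
    unfolding PX_eq by (rule integral_distr) measurable
  then show "(LINT x|PX. h x) = (LINT w|Q. h (fst w))"
    using integral_P(1)[OF m] by (simp add: T_eq)
  show "integrable PX h \<longleftrightarrow> integrable Q (\<lambda>w. h (fst w))"
    unfolding PX_eq using integrable_distr_eq[OF fst_P assms] integral_P(2)[OF m] by (simp add: T_eq)
qed

lemma AE_PX: "(AE x in PX. R x) \<Longrightarrow> (AE w in Q. R (fst w))"
  using AE_P[of "\<lambda>w. R (fst w)", OF AE_distrD[OF fst_P]] unfolding PX_eq by (simp add: T_eq)

lemma m_meas: "g \<in> m \<Longrightarrow> g \<in> borel_measurable S"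
  using lin measurable_cong_sets[OF sets_PX refl, of borel] by (auto simp: linear_L2_subspace_def L2_fun_def)

lemma s_m_in: "s_m \<in> m" and proj_orth: "g \<in> m \<Longrightarrow> L2_inner PX (\<lambda>x. s_star x - s_m x) g = 0"
  using proj by (auto simp: orthogonal_projection_on_def)

lemma s_m_meas [measurable]: "s_m \<in> borel_measurable S"
  by (rule m_meas[OF s_m_in])

lemma basis_facts:
  shows r_pos: "r > 0" and b_ge_1: "b \<ge> 1" and Ac_pos: "Ac > 0" and a_1: "1 \<le> a 1"
    and a_mono: "mono_on {1..b} a" and sum_sqrt: "(\<Sum>i=1..b. sqrt (a i)) \<le> r * sqrt (real D)"
    and partition: "partition_on {1..D} (parts ` {1..b})" and parts_inj: "inj_on parts {1..b}"
    and ortho_basis: "orthonormal_basis PX m D \<phi>"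
  using basis by (simp_all add: strongly_localized_basis_def)

lemma a_ge_1: "i \<in> {1..b} \<Longrightarrow> 1 \<le> a i" and a_le: "i \<in> {1..b} \<Longrightarrow> a i \<le> a b"
  using a_1 b_ge_1 mono_onD[OF a_mono, of 1 i] mono_onD[OF a_mono, of i b] by auto

lemma \<phi>_in: "k \<in> {1..D} \<Longrightarrow> \<phi> k \<in> m"
  and \<phi>_orth: "k \<in> {1..D} \<Longrightarrow> l \<in> {1..D} \<Longrightarrow> L2_inner PX (\<phi> k) (\<phi> l) = (if k = l then 1 else 0)"
  and \<phi>_span: "g \<in> m \<Longrightarrow> \<exists>c. \<forall>x\<in>X. g x = (\<Sum>k=1..D. c k * \<phi> k x)"
  using ortho_basis by (auto simp: orthonormal_basis_def space_PX)

lemma \<phi>_meas: "k \<in> {1..D} \<Longrightarrow> \<phi> k \<in> borel_measurable S"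
  by (rule m_meas[OF \<phi>_in])

lemma f_meas' [measurable]: "(\<lambda>w. f w l) \<in> borel_measurable P"
proof (cases "l \<in> {1..D}")
  case True
  then show ?thesis using measurable_compose[OF fst_P \<phi>_meas] unfolding f_def if_P[OF True] by blast
next
  case False
  show ?thesis unfolding f_def if_not_P[OF False] by simp
qed

lemma \<xi>_meas [measurable]: "\<xi> \<in> borel_measurable P"
  unfolding \<xi>_def by measurable

lemma \<eta>_meas' [measurable]: "\<eta> \<in> borel_measurable P"
  unfolding \<eta>_def by measurable

definition blk where "blk k = (SOME i. i \<in> {1..b} \<and> k \<in> parts i)" for k

lemma blk: "k \<in> {1..D} \<Longrightarrow> blk k \<in> {1..b} \<and> k \<in> parts (blk k)"
proof -
  assume "k \<in> {1..D}"
  then have "k \<in> \<Union> (parts ` {1..b})" using partition by (simp add: partition_on_def)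
  then have "\<exists>i. i \<in> {1..b} \<and> k \<in> parts i" by blast
  then show ?thesis unfolding blk_def by (rule someI_ex)
qed

lemma parts_subset: "i \<in> {1..b} \<Longrightarrow> parts i \<subseteq> {1..D}"
  using partition by (auto simp: partition_on_def)

lemma \<phi>_bound: "x \<in> X \<Longrightarrow> k \<in> {1..D} \<Longrightarrow> \<bar>\<phi> k x\<bar> \<le> r * sqrt (a (blk k))"
  using basis blk[of k] sup_norm_leD[of X "\<phi> k"]
  by (auto simp: strongly_localized_basis_def space_PX)

lemma overlap:
  assumes k: "k \<in> {1..D}" and j: "j \<in> {1..b}"
  shows "real (card {l \<in> {1..D}. blk l = j \<and> (\<exists>x\<in>X. \<phi> k x \<noteq> 0 \<and> \<phi> l x \<noteq> 0)})
        \<le> Ac * max (a j / a (blk k)) 1"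
proof -
  let ?B = "{l \<in> parts j. support_on X (\<phi> k) \<inter> support_on X (\<phi> l) \<noteq> {}}"
  have "{l \<in> {1..D}. blk l = j \<and> (\<exists>x\<in>X. \<phi> k x \<noteq> 0 \<and> \<phi> l x \<noteq> 0)} \<subseteq> ?B"
    using blk by (auto simp: support_on_def)
  moreover have "finite ?B" using parts_subset[OF j] finite_subset by fastforce
  ultimately have "card {l \<in> {1..D}. blk l = j \<and> (\<exists>x\<in>X. \<phi> k x \<noteq> 0 \<and> \<phi> l x \<noteq> 0)} \<le> card ?B"
    by (rule card_mono[rotated])
  also have "real (card ?B) \<le> Ac * max (a j / a (blk k)) 1"
    using basis blk[OF k] j unfolding strongly_localized_basis_def space_PX by blast
  finally show ?thesis by simp
qed

text \<open>At a given point, each block contributes at most \<open>Ac\<close> nonzero basis functions.\<close>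

lemma sum_\<phi>_sq: assumes x: "x \<in> X" shows "(\<Sum>k=1..D. (\<phi> k x)\<^sup>2) \<le> N"
proof -
  have Ac: "0 \<le> Ac" using Ac_pos by simp
  define K where "K i = {l \<in> {1..D}. blk l = i \<and> \<phi> l x \<noteq> 0}" for i
  have cardK: "real (card (K i)) \<le> Ac" if i: "i \<in> {1..b}" for i
  proof (cases "K i = {}")
    case True
    then show ?thesis using Ac by simp
  next
    case False
    \<comment> \<open>All functions of the block that are nonzero at \<open>x\<close> overlap each
      other there, so one of them suffices as reference; within its own block the ratio of levels is
      1.\<close>
    then obtain k where k: "k \<in> {1..D}" "blk k = i" "\<phi> k x \<noteq> 0" by (auto simp: K_def)
    have "card (K i) \<le> card {l \<in> {1..D}. blk l = i \<and> (\<exists>x\<in>X. \<phi> k x \<noteq> 0 \<and> \<phi> l x \<noteq> 0)}"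
      unfolding K_def using x k by (intro card_mono) auto
    also have "real \<dots> \<le> Ac * max (a i / a (blk k)) 1" by (rule overlap[OF k(1) i])
    also have "\<dots> = Ac" using k a_ge_1[OF i] by simp
    finally show ?thesis by simp
  qed
  have "(\<Sum>k=1..D. (\<phi> k x)\<^sup>2) = (\<Sum>i\<in>{1..b}. \<Sum>k\<in>{k \<in> {1..D}. blk k = i}. (\<phi> k x)\<^sup>2)"
    by (rule sum.group[symmetric]) (use blk in auto)
  also have "\<dots> \<le> (\<Sum>i\<in>{1..b}. Ac * (r\<^sup>2 * a i))"
  proof (rule sum_mono)
    fix i assume i: "i \<in> {1..b}"
    have "(\<Sum>k\<in>{k \<in> {1..D}. blk k = i}. (\<phi> k x)\<^sup>2) = (\<Sum>k\<in>K i. (\<phi> k x)\<^sup>2)"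
      by (rule sum.mono_neutral_right) (auto simp: K_def)
    also have "\<dots> \<le> (\<Sum>k\<in>K i. r\<^sup>2 * a i)"
    proof (rule sum_mono)
      fix k assume k: "k \<in> K i"
      have "(\<phi> k x)\<^sup>2 \<le> (r * sqrt (a i))\<^sup>2"
        using \<phi>_bound[OF x, of k] k by (intro power_mono[of "\<bar>\<phi> k x\<bar>" _ 2, simplified]) (auto simp: K_def)
      then show "(\<phi> k x)\<^sup>2 \<le> r\<^sup>2 * a i" using a_ge_1[OF i] by (simp add: power_mult_distrib)
    qed
    also have "\<dots> = real (card (K i)) * (r\<^sup>2 * a i)" by simp
    also have "\<dots> \<le> Ac * (r\<^sup>2 * a i)" using cardK[OF i] a_ge_1[OF i] by (intro mult_right_mono) auto
    finally show "(\<Sum>k\<in>{k \<in> {1..D}. blk k = i}. (\<phi> k x)\<^sup>2) \<le> Ac * (r\<^sup>2 * a i)" .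
  qed
  also have "\<dots> = Ac * r\<^sup>2 * (\<Sum>i=1..b. a i)" by (simp add: sum_distrib_left mult.assoc)
  also have "(\<Sum>i=1..b. a i) \<le> (\<Sum>i=1..b. sqrt (a i))\<^sup>2"
  proof -
    have "(\<Sum>i=1..b. a i) = (\<Sum>i=1..b. (sqrt (a i))\<^sup>2)"
      by (intro sum.cong refl) (use a_ge_1 in \<open>force\<close>)
    also have "\<dots> \<le> (\<Sum>i=1..b. sqrt (a i) * (\<Sum>j=1..b. sqrt (a j)))"
      using a_ge_1 unfolding power2_eq_square
      by (intro sum_mono mult_left_mono member_le_sum) (auto intro: order_trans[OF zero_le_one])
    finally show ?thesis by (simp add: power2_eq_square sum_distrib_right)
  qed
  also have "(\<Sum>i=1..b. sqrt (a i))\<^sup>2 \<le> (r * sqrt (real D))\<^sup>2"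
    using sum_sqrt a_ge_1 by (intro power_mono sum_nonneg) (auto intro: order_trans[OF zero_le_one])
  finally have "(\<Sum>k=1..D. (\<phi> k x)\<^sup>2) \<le> Ac * r\<^sup>2 * (r * sqrt (real D))\<^sup>2"
    using Ac by (simp add: mult_left_mono)
  then show ?thesis by (simp add: N_def power_mult_distrib power4_eq_xxxx power2_eq_square mult_ac)
qed

end

section \<open>Moments of the residual and reduction to a bounded design\<close>

lemma integrable_bounded_times:
  fixes g h :: "'a \<Rightarrow> real"
  assumes g: "integrable M g" and [measurable]: "h \<in> borel_measurable M"
    and h: "\<And>x. x \<in> space M \<Longrightarrow> \<bar>h x\<bar> \<le> c"
  shows "integrable M (\<lambda>x. h x * g x)"
proof (rule Bochner_Integration.integrable_bound)
  show "integrable M (\<lambda>x. c * \<bar>g x\<bar>)" using g by auto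
  show "(\<lambda>x. h x * g x) \<in> borel_measurable M" using g by measurable
  show "AE x in M. norm (h x * g x) \<le> norm (c * \<bar>g x\<bar>)"
  proof (rule AE_I2)
    fix x assume "x \<in> space M"
    then have "\<bar>h x\<bar> \<le> \<bar>c\<bar>" using h by fastforce
    then show "norm (h x * g x) \<le> norm (c * \<bar>g x\<bar>)" by (simp add: abs_mult mult_right_mono)
  qed
qed

lemma integrable_product_of_squares:
  fixes g h :: "'a \<Rightarrow> real"
  assumes [measurable]: "g \<in> borel_measurable M" "h \<in> borel_measurable M"
    and "integrable M (\<lambda>x. (g x)\<^sup>2)" "integrable M (\<lambda>x. (h x)\<^sup>2)"
  shows "integrable M (\<lambda>x. g x * h x)"
proof (rule Bochner_Integration.integrable_bound)
  show "integrable M (\<lambda>x. (g x)\<^sup>2 + (h x)\<^sup>2)" using assms by auto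
  have "\<bar>g x * h x\<bar> \<le> (g x)\<^sup>2 + (h x)\<^sup>2" for x
  proof -
    have "2 * (\<bar>g x\<bar> * \<bar>h x\<bar>) \<le> (g x)\<^sup>2 + (h x)\<^sup>2"
      using sum_squares_bound[of "\<bar>g x\<bar>" "\<bar>h x\<bar>"] by (simp add: mult.assoc)
    then show ?thesis unfolding abs_mult by (smt (verit) mult_nonneg_nonneg abs_ge_zero)
  qed
  then show "AE x in M. norm (g x * h x) \<le> norm ((g x)\<^sup>2 + (h x)\<^sup>2)" by auto
qed measurable

context regression_model
begin

lemma L_pos: "L > 0" using A_pos by (simp add: L_def)

lemma \<xi>_bound: "AE w in P. \<bar>\<xi> w\<bar> \<le> L"
proof -
  have "AE w in P. w \<in> space P" by simp
  then show ?thesis using Y_bound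
  proof eventually_elim
    fix w :: "point \<times> real" assume "w \<in> space P" "case w of (x, y) \<Rightarrow> \<bar>y\<bar> \<le> A"
    then have "\<bar>snd w\<bar> \<le> A" "\<bar>s_m (fst w)\<bar> \<le> A"
      using sup_norm_leD[OF s_m_bound, of "fst w"] by (auto simp: space_P)
    then show "\<bar>\<xi> w\<bar> \<le> L" by (simp add: \<xi>_def L_def)
  qed
qed

lemma \<eta>_eq_\<xi>: "AE w in P. \<eta> w = \<xi> w"
  using \<xi>_bound by eventually_elim (simp add: \<eta>_def clamp_eq)

lemma f_eq: "k \<in> {1..D} \<Longrightarrow> f w k = \<phi> k (fst w)"
  by (simp add: f_def)

text \<open>Bias and noise parts of the residual: \<open>u\<close> depends on \<open>X\<close> alone
  and is orthogonal to the model, \<open>g\<close> is conditionally centered.\<close>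

definition u where "u w = s_star (fst w) - s_m (fst w)" for w :: "point \<times> real"
definition g where "g w = \<sigma> (fst w) * snd w" for w :: "point \<times> real"

lemma u_meas [measurable]: "u \<in> borel_measurable Q" and g_meas [measurable]: "g \<in> borel_measurable Q"
  unfolding u_def g_def by measurable

lemma \<xi>_T: "\<xi> (T w) = u w + g w"
  by (simp add: \<xi>_def T_eq u_def g_def)

lemma fst_T: "fst (T w) = fst w"
  by (simp add: T_eq)

lemma integrable_u_sq: "integrable Q (\<lambda>w. (u w)\<^sup>2)"
proof -
  have s: "integrable Q (\<lambda>w. (s_star (fst w))\<^sup>2)"
    using s_star integral_PX(2)[of "\<lambda>x. (s_star x)\<^sup>2"] by (simp add: L2_fun_def)
  have b: "\<bar>s_m (fst w)\<bar> \<le> A" if "w \<in> space Q" for w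
    using sup_norm_leD[OF s_m_bound, of "fst w"] that by (auto simp: space_Q)
  have m2: "integrable Q (\<lambda>w. (s_m (fst w))\<^sup>2)"
  proof (rule Q.integrable_const_bound[where B="A\<^sup>2"])
    show "AE w in Q. norm ((s_m (fst w))\<^sup>2) \<le> A\<^sup>2"
    proof (rule AE_I2)
      fix w assume "w \<in> space Q"
      from power_mono[OF b[OF this] abs_ge_zero, of 2] show "norm ((s_m (fst w))\<^sup>2) \<le> A\<^sup>2" by simp
    qed
  qed measurable
  have "integrable Q (\<lambda>w. (s_star (fst w))\<^sup>2 - 2 * (s_star (fst w) * s_m (fst w)) + (s_m (fst w))\<^sup>2)"
    using s m2 integrable_product_of_squares[OF _ _ s m2] by simp
  then show ?thesis by (simp add: u_def power2_diff algebra_simps)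
qed

text \<open>\<open>\<sigma>\<close> carries no upper bound, so integrability comes from writing
  \<open>g\<close> as the almost surely bounded residual minus \<open>u\<close>.\<close>

lemma integrable_g_sq: "integrable Q (\<lambda>w. (g w)\<^sup>2)"
proof -
  have m: "(\<lambda>w. \<xi> (T w)) \<in> borel_measurable Q" by measurable
  have x: "integrable Q (\<lambda>w. (\<xi> (T w))\<^sup>2)"
  proof (rule Q.integrable_const_bound[where B="L\<^sup>2"])
    show "AE w in Q. norm ((\<xi> (T w))\<^sup>2) \<le> L\<^sup>2"
      using AE_P[OF \<xi>_bound]
    proof eventually_elim
      fix w assume "\<bar>\<xi> (T w)\<bar> \<le> L"
      from power_mono[OF this abs_ge_zero, of 2] show "norm ((\<xi> (T w))\<^sup>2) \<le> L\<^sup>2" by simp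
    qed
  qed (use m in measurable)
  have "integrable Q (\<lambda>w. (\<xi> (T w))\<^sup>2 - 2 * (\<xi> (T w) * u w) + (u w)\<^sup>2)"
    using x integrable_u_sq integrable_product_of_squares[OF m u_meas x integrable_u_sq] by simp
  then show ?thesis by (simp add: \<xi>_T power2_eq_square algebra_simps)
qed

definition F where "F = vimage_algebra (space Q) fst S"

lemma F_subalgebra: "subalgebra Q F"
proof -
  have "fst \<in> space Q \<rightarrow> space S" by (auto simp: space_Q space_S)
  then have "sets F \<subseteq> sets Q"
    unfolding F_def using measurable_sets[OF fst_Q] by (auto simp: sets_vimage_algebra2)
  then show ?thesis by (simp add: subalgebra_def F_def)
qed

lemma comp_fst_F: "p \<in> borel_measurable S \<Longrightarrow> (\<lambda>w. p (fst w)) \<in> borel_measurable F"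
  unfolding F_def
  by (rule measurable_compose[OF measurable_vimage_algebra1]) (auto simp: space_Q space_S)

lemma cond_mean:
  assumes "p \<in> borel_measurable S" "integrable Q (\<lambda>w. p (fst w) * snd w)"
  shows "(LINT w|Q. p (fst w) * snd w) = 0"
proof -
  interpret C: finite_measure_subalgebra Q F
    by standard (rule F_subalgebra)
  have "AE w in Q. real_cond_exp Q F snd w = 0" using noise by (simp add: noise_law_def F_def)
  then have "(LINT w|Q. p (fst w) * real_cond_exp Q F snd w) = (LINT w|Q. 0)"
    by (intro integral_cong_AE) (auto intro!: borel_measurable_times measurable_compose[OF fst_Q assms(1)] borel_measurable_cond_exp2)
  then show ?thesis using C.real_cond_exp_intg(2)[OF assms(2) comp_fst_F[OF assms(1)] snd_Q] by simp
qed

lemma cond_variance: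
  assumes "p \<in> borel_measurable S" "integrable Q (\<lambda>w. p (fst w) * (snd w)\<^sup>2)"
  shows "integrable Q (\<lambda>w. p (fst w))" "(LINT w|Q. p (fst w) * (snd w)\<^sup>2) = (LINT w|Q. p (fst w))"
proof -
  interpret C: finite_measure_subalgebra Q F
    by standard (rule F_subalgebra)
  have m: "(\<lambda>w. (snd w)\<^sup>2) \<in> borel_measurable Q" by measurable
  have pm: "(\<lambda>w. p (fst w)) \<in> borel_measurable Q" by (rule measurable_compose[OF fst_Q assms(1)])
  note I = C.real_cond_exp_intg[OF assms(2) comp_fst_F[OF assms(1)] m]
  have "AE w in Q. real_cond_exp Q F (\<lambda>w. (snd w)\<^sup>2) w = 1" using noise by (simp add: noise_law_def F_def)
  then have ae: "AE w in Q. p (fst w) * real_cond_exp Q F (\<lambda>w. (snd w)\<^sup>2) w = p (fst w)"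
    by eventually_elim simp
  have pm': "(\<lambda>w. p (fst w) * real_cond_exp Q F (\<lambda>w. (snd w)\<^sup>2) w) \<in> borel_measurable Q"
    using I(1) by (rule borel_measurable_integrable)
  show "integrable Q (\<lambda>w. p (fst w))"
    using I(1) integrable_cong_AE[OF pm' pm ae] by simp
  show "(LINT w|Q. p (fst w) * (snd w)\<^sup>2) = (LINT w|Q. p (fst w))"
    using I(2) integral_cong_AE[OF pm' pm ae] by simp
qed

lemma \<phi>_fst_bound: "w \<in> space Q \<Longrightarrow> k \<in> {1..D} \<Longrightarrow> \<bar>\<phi> k (fst w)\<bar> \<le> r * sqrt (a (blk k))"
  using \<phi>_bound[of "fst w" k] by (auto simp: space_Q)

lemma \<phi>_sq_fst_bound: "w \<in> space Q \<Longrightarrow> k \<in> {1..D} \<Longrightarrow> \<bar>(\<phi> k (fst w))\<^sup>2\<bar> \<le> (r * sqrt (a (blk k)))\<^sup>2"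
  using power_mono[OF \<phi>_fst_bound abs_ge_zero, of w k 2] by simp

lemma \<phi>_fst_meas: "k \<in> {1..D} \<Longrightarrow> (\<lambda>w. \<phi> k (fst w)) \<in> borel_measurable Q"
  by (rule measurable_compose[OF fst_Q \<phi>_meas])

text \<open>The bias part vanishes by the defining property of the projection, the noise part by
  conditioning on \<open>X\<close>.\<close>

lemma \<xi>_centered:
  assumes k: "k \<in> {1..D}"
  shows "(LINT w|P. \<xi> w * \<phi> k (fst w)) = 0"
proof -
  note [measurable] = \<phi>_meas[OF k] \<phi>_fst_meas[OF k]
  have iu: "integrable Q (\<lambda>w. \<phi> k (fst w) * u w)"
    by (rule integrable_bounded_times[OF Q.square_integrable_imp_integrable[OF u_meas integrable_u_sq] _ \<phi>_fst_bound[OF _ k]]) measurable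
  have ig: "integrable Q (\<lambda>w. \<phi> k (fst w) * g w)"
    by (rule integrable_bounded_times[OF Q.square_integrable_imp_integrable[OF g_meas integrable_g_sq] _ \<phi>_fst_bound[OF _ k]]) measurable
  have "(LINT w|P. \<xi> w * \<phi> k (fst w)) = (LINT w|Q. \<xi> (T w) * \<phi> k (fst (T w)))"
    by (rule integral_P(1)) measurable
  also have "\<dots> = (LINT w|Q. \<phi> k (fst w) * u w + \<phi> k (fst w) * g w)"
    by (simp add: \<xi>_T fst_T algebra_simps)
  also have "\<dots> = (LINT w|Q. \<phi> k (fst w) * u w) + (LINT w|Q. \<phi> k (fst w) * g w)"
    using iu ig by simp
  also have "(LINT w|Q. \<phi> k (fst w) * u w) = L2_inner PX (\<lambda>x. s_star x - s_m x) (\<phi> k)"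
    unfolding L2_inner_def by (subst integral_PX(1)) (measurable, simp add: u_def mult.commute)
  also have "\<dots> = 0" by (rule proj_orth[OF \<phi>_in[OF k]])
  also have "(LINT w|Q. \<phi> k (fst w) * g w) = 0"
    using cond_mean[of "\<lambda>x. \<phi> k x * \<sigma> x"] ig by (simp add: g_def mult.assoc)
  finally show ?thesis by simp
qed

lemma integrable_\<xi>\<phi>_sq:
  assumes k: "k \<in> {1..D}"
  shows "integrable P (\<lambda>w. (\<xi> w * \<phi> k (fst w))\<^sup>2)"
proof (rule P.integrable_const_bound[where B="L\<^sup>2 * (r * sqrt (a (blk k)))\<^sup>2"])
  note [measurable] = \<phi>_meas[OF k]
  have "AE w in P. w \<in> space P" by simp
  then show "AE w in P. norm ((\<xi> w * \<phi> k (fst w))\<^sup>2) \<le> L\<^sup>2 * (r * sqrt (a (blk k)))\<^sup>2"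
    using \<xi>_bound
  proof eventually_elim
    fix w assume w: "w \<in> space P" "\<bar>\<xi> w\<bar> \<le> L"
    have "\<bar>\<phi> k (fst w)\<bar> \<le> r * sqrt (a (blk k))" using \<phi>_bound[of "fst w" k] w k by (auto simp: space_P)
    from power_mono[OF this abs_ge_zero, of 2] power_mono[OF w(2) abs_ge_zero, of 2]
    have "(\<xi> w)\<^sup>2 * (\<phi> k (fst w))\<^sup>2 \<le> L\<^sup>2 * (r * sqrt (a (blk k)))\<^sup>2"
      by (intro mult_mono) auto
    then show "norm ((\<xi> w * \<phi> k (fst w))\<^sup>2) \<le> L\<^sup>2 * (r * sqrt (a (blk k)))\<^sup>2"
      by (simp add: power_mult_distrib)
  qed
  show "(\<lambda>w. (\<xi> w * \<phi> k (fst w))\<^sup>2) \<in> borel_measurable P" by measurable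
qed

lemma \<phi>_norm:
  assumes k: "k \<in> {1..D}"
  shows "(LINT w|Q. (\<phi> k (fst w))\<^sup>2) = 1"
proof -
  note [measurable] = \<phi>_meas[OF k]
  have "(LINT x|PX. \<phi> k x * \<phi> k x) = 1" using \<phi>_orth[OF k k] by (simp add: L2_inner_def)
  then show ?thesis by (subst (asm) integral_PX(1)) (measurable, simp add: power2_eq_square)
qed

text \<open>Given \<open>X\<close> the cross term has mean zero and the bias only adds. The noise
  contributes the mean of \<open>\<sigma>^2 \<phi>_k^2\<close>, which is at least
  \<open>\<sigma>_min^2\<close> since \<open>\<phi>_k\<close> is normalized. Summing over
  \<open>k\<close> makes the complexity of order at least \<open>D\<close>.\<close>

lemma \<xi>\<phi>_second_moment:
  assumes k: "k \<in> {1..D}"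
  shows "\<sigma>_min\<^sup>2 \<le> (LINT w|P. (\<xi> w * \<phi> k (fst w))\<^sup>2)"
proof -
  note [measurable] = \<phi>_meas[OF k] \<phi>_fst_meas[OF k]
  let ?p = "\<lambda>w. (\<phi> k (fst w))\<^sup>2"
  have b: "integrable Q (\<lambda>w. ?p w * h w)" if "integrable Q h" for h
    by (rule integrable_bounded_times[OF that _ \<phi>_sq_fst_bound[OF _ k]]) measurable
  have iu: "integrable Q (\<lambda>w. ?p w * (u w)\<^sup>2)" by (rule b[OF integrable_u_sq])
  have ig: "integrable Q (\<lambda>w. ?p w * (g w)\<^sup>2)" by (rule b[OF integrable_g_sq])
  have iug: "integrable Q (\<lambda>w. ?p w * (u w * g w))"
    by (rule b[OF integrable_product_of_squares[OF _ _ integrable_u_sq integrable_g_sq]]) measurable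
  have "(LINT w|P. (\<xi> w * \<phi> k (fst w))\<^sup>2) = (LINT w|Q. (\<xi> (T w) * \<phi> k (fst (T w)))\<^sup>2)"
    by (rule integral_P(1)) measurable
  also have "\<dots> = (LINT w|Q. ?p w * (u w)\<^sup>2 + 2 * (?p w * (u w * g w)) + ?p w * (g w)\<^sup>2)"
    by (simp add: \<xi>_T fst_T power2_eq_square algebra_simps)
  also have "\<dots> = (LINT w|Q. ?p w * (u w)\<^sup>2) + 2 * (LINT w|Q. ?p w * (u w * g w)) + (LINT w|Q. ?p w * (g w)\<^sup>2)"
    using iu ig iug by simp
  also have "(LINT w|Q. ?p w * (u w * g w)) = 0"
    using cond_mean[of "\<lambda>x. (\<phi> k x)\<^sup>2 * ((s_star x - s_m x) * \<sigma> x)"] iug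
    by (simp add: g_def u_def mult.assoc)
  finally have 1: "(LINT w|P. (\<xi> w * \<phi> k (fst w))\<^sup>2) = (LINT w|Q. ?p w * (u w)\<^sup>2) + (LINT w|Q. ?p w * (g w)\<^sup>2)"
    by simp
  have 2: "0 \<le> (LINT w|Q. ?p w * (u w)\<^sup>2)" by (rule integral_nonneg_AE) simp
  have gs: "(\<lambda>w. ?p w * (g w)\<^sup>2) = (\<lambda>w. ((\<phi> k (fst w))\<^sup>2 * (\<sigma> (fst w))\<^sup>2) * (snd w)\<^sup>2)"
    by (simp add: g_def power_mult_distrib mult.assoc fun_eq_iff)
  have sm: "(\<lambda>x. (\<phi> k x)\<^sup>2 * (\<sigma> x)\<^sup>2) \<in> borel_measurable S" by measurable
  note cv = cond_variance[OF sm ig[unfolded gs]]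
  have "\<sigma>_min\<^sup>2 = (LINT w|Q. ?p w * \<sigma>_min\<^sup>2)" using \<phi>_norm[OF k] by simp
  also have "\<dots> \<le> (LINT w|Q. ?p w * (\<sigma> (fst w))\<^sup>2)"
  proof (rule integral_mono_AE[OF _ cv(1)])
    show "integrable Q (\<lambda>w. ?p w * \<sigma>_min\<^sup>2)" by (rule b) simp
    show "AE w in Q. ?p w * \<sigma>_min\<^sup>2 \<le> ?p w * (\<sigma> (fst w))\<^sup>2"
      using AE_PX[OF \<sigma>_lower]
      by eventually_elim (use \<sigma>_min_pos in \<open>auto intro!: mult_left_mono power_mono\<close>)
  qed
  finally show ?thesis using 1 2 cv(2) unfolding gs by linarith
qed

lemma P_orthonormal:
  assumes k: "k \<in> {1..D}" and l: "l \<in> {1..D}"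
  shows "(LINT w|P. f w k * f w l) = (if k = l then 1 else 0)"
proof -
  note [measurable] = \<phi>_meas[OF k] \<phi>_meas[OF l]
  have "(LINT x|PX. \<phi> k x * \<phi> l x) = (LINT w|P. \<phi> k (fst w) * \<phi> l (fst w))"
    by (rule integral_PX(3)) measurable
  then show ?thesis using \<phi>_orth[OF k l] by (simp add: L2_inner_def f_eq[OF k] f_eq[OF l])
qed

lemma dot_f_f: "dot D (f w) (f w) = (\<Sum>k=1..D. (\<phi> k (fst w))\<^sup>2)"
  unfolding dot_def by (intro sum.cong refl) (simp add: f_def power2_eq_square)

text \<open>The sum of the squared basis functions has mean \<open>D\<close> and is bounded by
  \<open>N\<close>.\<close>

lemma N_ge: "real D \<le> N"
proof -
  have i: "integrable Q (\<lambda>w. (\<phi> k (fst w))\<^sup>2)" if "k \<in> {1..D}" for k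
  \<comment> \<open>A nonintegrable function has integral 0 by convention, which contradicts norm
    one.\<close>
  proof (rule ccontr)
    assume "\<not> integrable Q (\<lambda>w. (\<phi> k (fst w))\<^sup>2)"
    then show False using \<phi>_norm[OF that] by (simp add: not_integrable_integral_eq)
  qed
  have "real D = (LINT w|Q. (\<Sum>k=1..D. (\<phi> k (fst w))\<^sup>2))"
    using i \<phi>_norm by (simp add: Bochner_Integration.integral_sum)
  also have "\<dots> \<le> (LINT w|Q. N)"
    using i sum_\<phi>_sq by (intro integral_mono Bochner_Integration.integrable_sum) (auto simp: space_Q)
  finally show ?thesis by (simp add: Q.prob_space)
qed

sublocale bd: bounded_design P f \<eta> D N L
proof
  show "dot D (f w) (f w) \<le> N" if "w \<in> space P" for w
    using that sum_\<phi>_sq[of "fst w"] by (auto simp: dot_f_f space_P)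
  show "\<bar>\<eta> w\<bar> \<le> L" for w unfolding \<eta>_def using L_pos by (intro clamp_abs_le) simp
  show "(LINT w|P. f w k * f w l) = (if k = l then 1 else 0)" if "k \<in> {1..D}" "l \<in> {1..D}" for k l
    using that by (rule P_orthonormal)
  show "(LINT w|P. \<eta> w * f w k) = 0" if k: "k \<in> {1..D}" for k
  proof -
    note [measurable] = \<phi>_meas[OF k]
    have "(LINT w|P. \<eta> w * f w k) = (LINT w|P. \<xi> w * \<phi> k (fst w))"
      unfolding f_eq[OF k]
    proof (rule integral_cong_AE)
      show "AE w in P. \<eta> w * \<phi> k (fst w) = \<xi> w * \<phi> k (fst w)"
        using \<eta>_eq_\<xi> by eventually_elim simp
    qed measurable
    then show ?thesis using \<xi>_centered[OF k] by simp
  qed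
  show "N \<ge> 1" using N_ge D_pos by linarith
qed (use L_pos in auto)

lemma complexity_sum: "model_complexity P D \<phi> s_m = (\<Sum>k=1..D. LINT w|P. (\<xi> w * \<phi> k (fst w))\<^sup>2)"
  unfolding model_complexity_def
proof (intro sum.cong refl)
  fix k assume k: "k \<in> {1..D}"
  have eq: "(\<lambda>(x, y). (y - s_m x) * \<phi> k x) = (\<lambda>w. \<xi> w * \<phi> k (fst w))"
    by (auto simp: \<xi>_def fun_eq_iff)
  show "P.variance (\<lambda>(x, y). (y - s_m x) * \<phi> k x) = (LINT w|P. (\<xi> w * \<phi> k (fst w))\<^sup>2)"
    unfolding eq \<xi>_centered[OF k] by simp
qed

lemma complexity_eq: "bd.noise_energy = model_complexity P D \<phi> s_m"
proof -
  have "bd.noise_energy = (LINT w|P. (\<Sum>k=1..D. (\<xi> w * \<phi> k (fst w))\<^sup>2))"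
    unfolding bd.noise_energy_def
  proof (rule integral_cong_AE)
    show "(\<lambda>w. \<Sum>k=1..D. (\<xi> w * \<phi> k (fst w))\<^sup>2) \<in> borel_measurable P"
    proof (intro borel_measurable_sum)
      fix k assume "k \<in> {1..D}"
      note [measurable] = \<phi>_meas[OF this]
      show "(\<lambda>w. (\<xi> w * \<phi> k (fst w))\<^sup>2) \<in> borel_measurable P" by measurable
    qed
    show "AE w in P. (\<eta> w)\<^sup>2 * dot D (f w) (f w) = (\<Sum>k=1..D. (\<xi> w * \<phi> k (fst w))\<^sup>2)"
      using \<eta>_eq_\<xi> by eventually_elim (simp add: dot_f_f sum_distrib_left power_mult_distrib)
  qed measurable
  also have "\<dots> = (\<Sum>k=1..D. LINT w|P. (\<xi> w * \<phi> k (fst w))\<^sup>2)"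
    by (rule Bochner_Integration.integral_sum) (rule integrable_\<xi>\<phi>_sq)
  finally show ?thesis by (simp add: complexity_sum)
qed

lemma complexity_ge: "\<sigma>_min\<^sup>2 * real D \<le> model_complexity P D \<phi> s_m"
proof -
  have "(\<Sum>k=1..D. \<sigma>_min\<^sup>2) \<le> (\<Sum>k=1..D. LINT w|P. (\<xi> w * \<phi> k (fst w))\<^sup>2)"
    by (intro sum_mono \<xi>\<phi>_second_moment)
  then show ?thesis by (simp add: complexity_sum mult.commute)
qed

text \<open>Pythagoras: the residual is orthogonal to the span and the features are
  orthonormal.\<close>

lemma excess_risk_coeff:
  assumes "\<And>x. x \<in> X \<Longrightarrow> s x = s_m x + (\<Sum>k=1..D. \<beta> k * \<phi> k x)"
  shows "excess_risk P s_m s = dot D \<beta> \<beta>"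
proof -
  have res: "snd w - s (fst w) = \<xi> w - dot D \<beta> (f w)" if "w \<in> space P" for w
    using that assms[of "fst w"] by (auto simp: space_P \<xi>_def dot_def f_def)
  have "excess_risk P s_m s = (LINT w|P. (\<xi> w - dot D \<beta> (f w))\<^sup>2 - (\<xi> w)\<^sup>2)"
    unfolding excess_risk_def
    by (intro Bochner_Integration.integral_cong refl) (simp add: contrast_def split_beta' res, simp add: \<xi>_def)
  also have "\<dots> = (LINT w|P. (dot D \<beta> (f w))\<^sup>2 - 2 * (\<eta> w * dot D \<beta> (f w)))"
  proof (rule integral_cong_AE)
    show "AE w in P. (\<xi> w - dot D \<beta> (f w))\<^sup>2 - (\<xi> w)\<^sup>2 = (dot D \<beta> (f w))\<^sup>2 - 2 * (\<eta> w * dot D \<beta> (f w))"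
      using \<eta>_eq_\<xi> by eventually_elim (simp add: power2_eq_square algebra_simps)
  qed measurable
  also have "\<dots> = (LINT w|P. (dot D \<beta> (f w))\<^sup>2) - 2 * (LINT w|P. \<eta> w * dot D \<beta> (f w))"
  proof -
    have "integrable P (\<lambda>w. \<eta> w * dot D \<beta> (f w))"
      unfolding dot_def sum_distrib_left using bd.integrable_\<eta>_f
      by (intro Bochner_Integration.integrable_sum) (auto simp: mult.left_commute)
    then show ?thesis using bd.integrable_dot_sq[of \<beta>] by simp
  qed
  finally show ?thesis by (simp add: bd.second_moment bd.linear_mean)
qed

lemma empirical_risk_coeff:
  assumes "\<And>x. x \<in> X \<Longrightarrow> s x = s_m x + (\<Sum>k=1..D. \<beta> k * \<phi> k x)"
    and "\<And>i. i \<in> {1..n} \<Longrightarrow> z i \<in> space P" "\<And>i. i \<in> {1..n} \<Longrightarrow> \<eta> (z i) = \<xi> (z i)"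
  shows "empirical_mean n z (contrast s) = (\<Sum>i=1..n. (\<eta> (z i) - dot D \<beta> (f (z i)))\<^sup>2) / real n"
    "empirical_excess_risk n z s s_m = (\<Sum>i=1..n. (\<eta> (z i))\<^sup>2 - (\<eta> (z i) - dot D \<beta> (f (z i)))\<^sup>2) / real n"
proof -
  have c: "contrast s (z i) = (\<eta> (z i) - dot D \<beta> (f (z i)))\<^sup>2" "contrast s_m (z i) = (\<eta> (z i))\<^sup>2"
    if i: "i \<in> {1..n}" for i
  proof -
    have "fst (z i) \<in> X" using assms(2)[OF i] by (auto simp: space_P)
    then have "snd (z i) - s (fst (z i)) = \<xi> (z i) - dot D \<beta> (f (z i))"
      using assms(1) by (simp add: \<xi>_def dot_def f_def)
    then show "contrast s (z i) = (\<eta> (z i) - dot D \<beta> (f (z i)))\<^sup>2" "contrast s_m (z i) = (\<eta> (z i))\<^sup>2"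
      using assms(3)[OF i] by (simp_all add: contrast_def split_beta') (simp add: \<xi>_def)
  qed
  show "empirical_mean n z (contrast s) = (\<Sum>i=1..n. (\<eta> (z i) - dot D \<beta> (f (z i)))\<^sup>2) / real n"
    unfolding empirical_mean_def using c(1) by (intro arg_cong[of _ _ "\<lambda>x. x / real n"] sum.cong refl)
  show "empirical_excess_risk n z s s_m = (\<Sum>i=1..n. (\<eta> (z i))\<^sup>2 - (\<eta> (z i) - dot D \<beta> (f (z i)))\<^sup>2) / real n"
    unfolding empirical_excess_risk_def empirical_mean_def using c
    by (intro arg_cong[of _ _ "\<lambda>x. x / real n"] sum.cong refl) simp
qed

end

section \<open>From coefficient vectors back to the estimator\<close>

lemma whp_AE:
  assumes "AE z in M. E z"
  shows "whp M 0 E"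
proof -
  from assms obtain B where "{z \<in> space M. \<not> E z} \<subseteq> B" "emeasure M B = 0" "B \<in> sets M"
    by (rule AE_E)
  then show ?thesis unfolding whp_def by (intro bexI[of _ B]) (auto simp: measure_def)
qed

lemma whp_prob:
  assumes "prob_space M" "whp M \<delta> E" "{z \<in> space M. E z} \<in> sets M"
  shows "measure M {z \<in> space M. E z} \<ge> 1 - \<delta>"
proof -
  interpret prob_space M by fact
  obtain B where B: "B \<in> sets M" "prob B \<le> \<delta>" "\<And>z. z \<in> space M - B \<Longrightarrow> E z"
    using assms(2) unfolding whp_def by blast
  have "1 - prob B = prob (space M - B)" using B(1) by (simp add: prob_compl)
  also have "\<dots> \<le> prob {z \<in> space M. E z}"
    using B(3) assms(3) by (intro finite_measure_mono) auto
  finally show ?thesis using B(2) by linarith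
qed

context regression_model
begin

text \<open>The expansion must hold at every point of \<open>X\<close>, since it is evaluated at the
  sample points.\<close>

lemma coefficients:
  assumes "s \<in> m"
  obtains \<beta> where "\<And>x. x \<in> X \<Longrightarrow> s x = s_m x + (\<Sum>k=1..D. \<beta> k * \<phi> k x)"
proof -
  obtain c c' where "\<forall>x\<in>X. s x = (\<Sum>k=1..D. c k * \<phi> k x)" "\<forall>x\<in>X. s_m x = (\<Sum>k=1..D. c' k * \<phi> k x)"
    using \<phi>_span[OF assms] \<phi>_span[OF s_m_in] by blast
  then show ?thesis
    by (intro that[of "\<lambda>k. c k - c' k"]) (simp add: left_diff_distrib sum_subtractf)
qed

text \<open>Almost surely no sample residual is changed by clamping. Then least squares over the
  model is the coefficient problem of the bounded design: every vector \<open>c\<close> is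
  admissible, because adding its combination of basis functions to \<open>s_m\<close> stays in the
  model.\<close>

theorem estimator_concentration:
  fixes n :: nat and t e :: real and s_hat :: "(nat \<Rightarrow> point \<times> real) \<Rightarrow> point \<Rightarrow> real"
  defines "\<rho> \<equiv> sqrt (t / N) + sqrt (N * t / real n)" and "C \<equiv> model_complexity P D \<phi> s_m"
  assumes n: "n > 0" and t: "t \<ge> 1" and small: "\<rho> \<le> 1 / 16"
    and at: "a b * t \<le> real n"
    and e: "Ac\<^sup>2 * ((2 * r + 4 * r\<^sup>2)\<^sup>2 * (t / real n)) * (2 * real b * sqrt (a b) * (r * sqrt (real D))) \<le> e\<^sup>2"
      "0 \<le> e" "e \<le> 1 / 8"
    and est: "least_squares_estimator S P m n s_hat"
  shows "whp (sample_law n P) ((2 * (real D)\<^sup>2 + 4 * real n + 6) * exp (- t)) (\<lambda>z.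
      \<bar>excess_risk P s_m (s_hat z) - C / real n\<bar> \<le> L\<^sup>2 * N / real n * (8 * e + 11 * \<rho>) \<and>
      \<bar>empirical_excess_risk n z (s_hat z) s_m - C / real n\<bar> \<le> L\<^sup>2 * N / real n * (4 * e\<^sup>2 + 61 * \<rho>))"
proof -
  have \<Omega>: "Ac\<^sup>2 * ((2 * r + 4 * r\<^sup>2)\<^sup>2 * (t / real n)) * (\<Sum>i=1..b. \<Sum>j=1..b. max (a i) (a j)) \<le> e\<^sup>2"
  proof -
    have "(\<Sum>i=1..b. \<Sum>j=1..b. max (a i) (a j)) \<le> 2 * real b * sqrt (a b) * (\<Sum>i=1..b. sqrt (a i))"
      using a_ge_1 a_le by (intro sum_max_le) (auto intro: order_trans[OF zero_le_one])
    also have "\<dots> \<le> 2 * real b * sqrt (a b) * (r * sqrt (real D))"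
      using sum_sqrt a_ge_1[of b] b_ge_1 by (intro mult_left_mono) auto
    finally have "Ac\<^sup>2 * ((2 * r + 4 * r\<^sup>2)\<^sup>2 * (t / real n)) * (\<Sum>i=1..b. \<Sum>j=1..b. max (a i) (a j))
      \<le> Ac\<^sup>2 * ((2 * r + 4 * r\<^sup>2)\<^sup>2 * (t / real n)) * (2 * real b * sqrt (a b) * (r * sqrt (real D)))"
      using t by (intro mult_left_mono) auto
    with e(1) show ?thesis by linarith
  qed
  have at': "a i * t \<le> real n" if "i \<in> {1..b}" for i
    using mult_right_mono[OF a_le[OF that], of t] t at by linarith
  have bound: "\<bar>f w k\<bar> \<le> r * sqrt (a (blk k))" if "w \<in> space P" "k \<in> {1..D}" for w k
    using that \<phi>_bound[of "fst w" k] by (auto simp: f_eq space_P)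
  have card: "real (card {l \<in> {1..D}. blk l = j \<and> (\<exists>w\<in>space P. f w k \<noteq> 0 \<and> f w l \<noteq> 0)})
        \<le> Ac * max (a j / a (blk k)) 1" if k: "k \<in> {1..D}" and j: "j \<in> {1..b}" for k j
  proof -
    have "{l \<in> {1..D}. blk l = j \<and> (\<exists>w\<in>space P. f w k \<noteq> 0 \<and> f w l \<noteq> 0)}
        = {l \<in> {1..D}. blk l = j \<and> (\<exists>x\<in>X. \<phi> k x \<noteq> 0 \<and> \<phi> l x \<noteq> 0)}"
      using k by (auto simp: f_eq space_P)
    then show ?thesis using overlap[OF k j] by simp
  qed
  have blk': "blk k \<in> {1..b}" if "k \<in> {1..D}" for k using blk[OF that] by simp
  have ae: "AE z in sample_law n P. \<forall>i\<in>{1..n}. \<eta> (z i) = \<xi> (z i)"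
    unfolding sample_law_def
    by (intro eventually_ball_finite ballI AE_PiM_component) (use \<eta>_eq_\<xi> P.prob_space_axioms in auto)
  have Ac0: "0 \<le> Ac" using Ac_pos by simp
  note W = whp_conj[OF bd.least_squares_concentration[OF n t small[unfolded \<rho>_def] b_ge_1 blk' a_ge_1 at' bound card r_pos Ac0 \<Omega> e(2,3)]
      whp_AE[OF ae, unfolded sample_law_def], folded sample_law_def \<rho>_def]
  show ?thesis
  proof (rule whp_mono[OF W])
    fix z assume z: "z \<in> space (sample_law n P)"
    assume E: "(\<forall>\<beta>. (\<forall>c. (\<Sum>i=1..n. (\<eta> (z i) - dot D \<beta> (f (z i)))\<^sup>2) \<le> (\<Sum>i=1..n. (\<eta> (z i) - dot D c (f (z i)))\<^sup>2)) \<longrightarrow>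
      \<bar>dot D \<beta> \<beta> - bd.noise_energy / real n\<bar> \<le> L\<^sup>2 * N / real n * (8 * e + 11 * \<rho>) \<and>
      \<bar>(\<Sum>i=1..n. (\<eta> (z i))\<^sup>2 - (\<eta> (z i) - dot D \<beta> (f (z i)))\<^sup>2) / real n - bd.noise_energy / real n\<bar>
        \<le> L\<^sup>2 * N / real n * (4 * e\<^sup>2 + 61 * \<rho>)) \<and> (\<forall>i\<in>{1..n}. \<eta> (z i) = \<xi> (z i))"
    have zs: "z i \<in> space P" if "i \<in> {1..n}" for i
      using z that by (auto simp: sample_law_def space_PiM)
    have eq: "\<eta> (z i) = \<xi> (z i)" if "i \<in> {1..n}" for i using E that by blast
    have am: "s_hat z \<in> m" "\<And>s. s \<in> m \<Longrightarrow> empirical_mean n z (contrast (s_hat z)) \<le> empirical_mean n z (contrast s)"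
      using est z by (auto simp: least_squares_estimator_def is_arg_min_def not_less)
    obtain \<beta> where \<beta>: "\<And>x. x \<in> X \<Longrightarrow> s_hat z x = s_m x + (\<Sum>k=1..D. \<beta> k * \<phi> k x)"
      using coefficients[OF am(1)] by blast
    have min: "(\<Sum>i=1..n. (\<eta> (z i) - dot D \<beta> (f (z i)))\<^sup>2) \<le> (\<Sum>i=1..n. (\<eta> (z i) - dot D c (f (z i)))\<^sup>2)" for c
    proof -
      have "(\<lambda>x. s_m x + (\<Sum>k=1..D. c k * \<phi> k x)) \<in> m"
        by (rule linear_L2_subspace_sum[OF lin s_m_in]) (use \<phi>_in in auto)
      from am(2)[OF this] empirical_risk_coeff(1)[where s="s_hat z" and \<beta>=\<beta> and n=n and z=z, OF \<beta> zs eq]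
        empirical_risk_coeff(1)[where s="\<lambda>x. s_m x + (\<Sum>k=1..D. c k * \<phi> k x)" and \<beta>=c and n=n and z=z, OF refl zs eq]
      have "(\<Sum>i=1..n. (\<eta> (z i) - dot D \<beta> (f (z i)))\<^sup>2) / real n \<le> (\<Sum>i=1..n. (\<eta> (z i) - dot D c (f (z i)))\<^sup>2) / real n"
        by simp
      then show ?thesis using n by (simp add: divide_le_cancel)
    qed
    show "\<bar>excess_risk P s_m (s_hat z) - C / real n\<bar> \<le> L\<^sup>2 * N / real n * (8 * e + 11 * \<rho>) \<and>
      \<bar>empirical_excess_risk n z (s_hat z) s_m - C / real n\<bar> \<le> L\<^sup>2 * N / real n * (4 * e\<^sup>2 + 61 * \<rho>)"
      using E[THEN conjunct1, THEN spec[of _ \<beta>], THEN mp, OF allI[OF min]]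
        excess_risk_coeff[where s="s_hat z" and \<beta>=\<beta>, OF \<beta>]
        empirical_risk_coeff(2)[where s="s_hat z" and \<beta>=\<beta> and n=n and z=z, OF \<beta> zs eq]
      unfolding C_def complexity_eq[symmetric] by simp
  qed simp_all
qed

lemma risks_measurable:
  assumes est: "least_squares_estimator S P m n s_hat"
  shows "(\<lambda>z. excess_risk P s_m (s_hat z)) \<in> borel_measurable (sample_law n P)"
    "(\<lambda>z. empirical_excess_risk n z (s_hat z) s_m) \<in> borel_measurable (sample_law n P)"
proof -
  have sh: "(\<lambda>(z, x). s_hat z x) \<in> borel_measurable (sample_law n P \<Otimes>\<^sub>M S)"
    using est by (simp add: least_squares_estimator_def)
  have [measurable]: "(\<lambda>p. s_hat (fst p) (fst (snd p))) \<in> borel_measurable (sample_law n P \<Otimes>\<^sub>M P)"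
    using measurable_compose[OF measurable_Pair[OF measurable_fst measurable_compose[OF measurable_snd fst_P]] sh]
    by simp
  have "(\<lambda>p. contrast (s_hat (fst p)) (snd p) - contrast s_m (snd p)) \<in> borel_measurable (sample_law n P \<Otimes>\<^sub>M P)"
    unfolding contrast_def split_beta' by measurable
  then have "(\<lambda>(z, w). contrast (s_hat z) w - contrast s_m w) \<in> borel_measurable (sample_law n P \<Otimes>\<^sub>M P)"
    by (simp add: split_beta')
  then show "(\<lambda>z. excess_risk P s_m (s_hat z)) \<in> borel_measurable (sample_law n P)"
    unfolding excess_risk_def by (rule P.borel_measurable_lebesgue_integral)
  have "(\<lambda>z. contrast s_m (z i) - contrast (s_hat z) (z i)) \<in> borel_measurable (sample_law n P)" if i: "i \<in> {1..n}" for i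
  proof -
    have c [measurable]: "(\<lambda>z. z i) \<in> measurable (sample_law n P) P"
      unfolding sample_law_def by (rule measurable_component_singleton[OF i])
    have [measurable]: "(\<lambda>z. s_hat z (fst (z i))) \<in> borel_measurable (sample_law n P)"
      using measurable_compose[OF measurable_Pair[OF measurable_ident measurable_compose[OF c fst_P]] sh]
      by simp
    show ?thesis unfolding contrast_def split_beta' by measurable
  qed
  then show "(\<lambda>z. empirical_excess_risk n z (s_hat z) s_m) \<in> borel_measurable (sample_law n P)"
    unfolding empirical_excess_risk_def empirical_mean_def
    by (intro borel_measurable_divide borel_measurable_sum borel_measurable_const)
qed

end

section \<open>Constants\<close>

text \<open>Both \<open>ln n / D\<close> and \<open>D ln n / n\<close> are at most
  \<open>M / ln n\<close> with \<open>M = 1 / A_minus + A_plus\<close>, so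
  \<open>e^2 <= sqrt (M / ln n)\<close>. A fixed factor \<open>q\<close> in front of
  \<open>e^2\<close> is thus absorbed once \<open>ln n >= M q^2\<close>;
  \<open>q = 16 \<kappa>\<close> and \<open>q = 64\<close> yield the smallness conditions of the
  earlier theorems.\<close>

lemma large_sample_bounds:
  fixes n D :: nat and lam A_minus A_plus K \<tau> c1 ab bb :: real
  defines "lam \<equiv> ln (real n)"
  defines "\<kappa> \<equiv> sqrt (\<tau> / K) + sqrt (K * \<tau>)"
    and "e \<equiv> max ((lam / real D) powr (1/4)) ((real D * lam / real n) powr (1/4))"
  assumes pos: "A_minus > 0" "A_plus > 0" "K > 0" "\<tau> \<ge> 1" "c1 \<ge> 0" "bb \<ge> 1" "ab \<ge> 1" "n > 0"
    and D: "A_minus * lam\<^sup>2 \<le> real D" "real D \<le> A_plus * (real n / lam\<^sup>2)"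
      "bb\<^sup>2 * ab \<le> A_plus * (real n / lam\<^sup>2)"
    and lam: "lam \<ge> 1" "lam \<ge> (1 / A_minus + A_plus) * (16 * \<kappa>)\<^sup>2" "lam \<ge> (1 / A_minus + A_plus) * 64\<^sup>2"
      "lam \<ge> A_plus * \<tau>" "lam \<ge> c1\<^sup>2 * A_plus"
  shows "real D > 0" "0 < e" "e \<le> 1 / 8"
    and "sqrt (\<tau> * lam / (K * real D)) + sqrt (K * real D * (\<tau> * lam) / real n) \<le> \<kappa> * e\<^sup>2"
    and "\<kappa> * e\<^sup>2 \<le> 1 / 16"
    and "ab * (\<tau> * lam) \<le> real n"
    and "c1 * (lam / real n) * (bb * sqrt ab * sqrt (real D)) \<le> e\<^sup>2"
    and "real D \<le> real n"
proof -
  have n0: "real n > 0" using pos by simp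
  have lam0: "lam > 0" using lam(1) by simp
  show D0: "real D > 0" using D(1) pos lam0 by (smt (verit) mult_pos_pos zero_less_power)
  define x where "x = lam / real D"
  define y where "y = real D * lam / real n"
  have xy: "x > 0" "y > 0" using D0 n0 lam0 by (auto simp: x_def y_def)
  have e_eq: "e = max (x powr (1/4)) (y powr (1/4))" by (simp add: e_def x_def y_def)
  show e0: "0 < e" using xy by (simp add: e_eq less_max_iff_disj)
  have pw: "(w powr (1/4))\<^sup>2 = sqrt w" if "w > 0" for w :: real
    using that by (simp add: powr_half_sqrt[symmetric] powr_power)
  have ex: "sqrt x \<le> e\<^sup>2" "sqrt y \<le> e\<^sup>2"
    unfolding pw[OF xy(1), symmetric] pw[OF xy(2), symmetric] by (auto simp: e_eq intro!: power_mono)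
  have ee: "e\<^sup>2 = sqrt x \<or> e\<^sup>2 = sqrt y"
    unfolding e_eq max_def using pw xy by auto
  define M where "M = 1 / A_minus + A_plus"
  have M0: "M > 0" using pos by (simp add: M_def add_pos_pos)
  have xM: "x \<le> M / lam"
  proof -
    have "x \<le> lam / (A_minus * lam\<^sup>2)" unfolding x_def using D(1) pos lam0 D0 by (intro divide_left_mono) auto
    also have "\<dots> = 1 / A_minus / lam" using lam0 by (simp add: power2_eq_square)
    also have "\<dots> \<le> M / lam" using pos lam0 by (intro divide_right_mono) (auto simp: M_def)
    finally show ?thesis .
  qed
  have yM: "y \<le> M / lam"
  proof -
    have "y \<le> A_plus * (real n / lam\<^sup>2) * lam / real n"
      unfolding y_def using D(2) n0 lam0 by (intro divide_right_mono mult_right_mono) auto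
    also have "\<dots> = A_plus / lam" using lam0 n0 by (simp add: power2_eq_square)
    also have "\<dots> \<le> M / lam" using pos lam0 by (intro divide_right_mono) (auto simp: M_def)
    finally show ?thesis .
  qed
  have e2: "e\<^sup>2 \<le> sqrt (M / lam)" using ee xM yM by auto
  have small: "q * e\<^sup>2 \<le> 1" if q: "q \<ge> 0" "M * q\<^sup>2 \<le> lam" for q
  proof -
    have "q * e\<^sup>2 \<le> q * sqrt (M / lam)" using e2 q by (intro mult_left_mono) auto
    also have "\<dots> = sqrt (M * q\<^sup>2 / lam)" using q by (simp add: real_sqrt_mult real_sqrt_divide)
    also have "\<dots> \<le> sqrt 1" using q lam0 by (intro real_sqrt_le_mono) auto
    finally show ?thesis by simp
  qed
  have k0: "\<kappa> \<ge> 0" using pos by (simp add: \<kappa>_def)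
  show "\<kappa> * e\<^sup>2 \<le> 1 / 16"
    using small[of "16 * \<kappa>"] k0 lam(2) by (simp add: M_def)
  have "64 * e\<^sup>2 \<le> 1" using small[of 64] lam(3) by (simp add: M_def)
  then have "e\<^sup>2 \<le> (1 / 8)\<^sup>2" by (simp add: power2_eq_square)
  then show "e \<le> 1 / 8" by (rule power2_le_imp_le) simp
  have "sqrt (\<tau> * lam / (K * real D)) = sqrt (\<tau> / K) * sqrt x"
    unfolding x_def real_sqrt_mult[symmetric] by simp
  also have "\<dots> \<le> sqrt (\<tau> / K) * e\<^sup>2" using ex pos by (intro mult_left_mono) auto
  finally have 1: "sqrt (\<tau> * lam / (K * real D)) \<le> sqrt (\<tau> / K) * e\<^sup>2" .
  have "sqrt (K * real D * (\<tau> * lam) / real n) = sqrt (K * \<tau>) * sqrt y"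
    unfolding y_def real_sqrt_mult[symmetric] by (simp add: mult_ac)
  also have "\<dots> \<le> sqrt (K * \<tau>) * e\<^sup>2" using ex pos by (intro mult_left_mono) auto
  finally show "sqrt (\<tau> * lam / (K * real D)) + sqrt (K * real D * (\<tau> * lam) / real n) \<le> \<kappa> * e\<^sup>2"
    using 1 by (simp add: \<kappa>_def distrib_right)
  have abn: "ab \<le> A_plus * (real n / lam\<^sup>2)"
  proof -
    have "1 * ab \<le> bb\<^sup>2 * ab" using pos by (intro mult_right_mono) auto
    then show ?thesis using D(3) by simp
  qed
  show "ab * (\<tau> * lam) \<le> real n"
  proof -
    have "ab * (\<tau> * lam) \<le> A_plus * (real n / lam\<^sup>2) * (\<tau> * lam)"
      using abn pos lam0 by (intro mult_right_mono) auto
    also have "\<dots> = (A_plus * \<tau>) * real n / lam" using lam0 by (simp add: power2_eq_square)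
    also have "\<dots> \<le> lam * real n / lam" using lam(4) n0 lam0 by (intro divide_right_mono mult_right_mono) auto
    finally show ?thesis using lam0 by simp
  qed
  have lam2: "A_plus \<le> lam\<^sup>2"
  proof -
    have "A_plus * 1 \<le> A_plus * \<tau>" using pos by (intro mult_left_mono) auto
    also have "\<dots> \<le> lam" by (rule lam(4))
    also have "\<dots> \<le> lam\<^sup>2" using lam(1) by (simp add: power2_eq_square)
    finally show ?thesis by simp
  qed
  show "real D \<le> real n"
  proof -
    have "A_plus * (real n / lam\<^sup>2) \<le> lam\<^sup>2 * (real n / lam\<^sup>2)" using lam2 by (intro mult_right_mono) auto
    then show ?thesis using D(2) lam0 by simp
  qed
  \<comment> \<open>The hypothesis on \<open>bb^2 * ab\<close> reduces the left side to a multiple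
    of \<open>sqrt (D / n)\<close>. Compared with \<open>sqrt (D ln n / n)\<close> a factor
    \<open>sqrt (ln n)\<close> is gained, and it swallows \<open>c1 * sqrt A_plus\<close>.\<close>
  show "c1 * (lam / real n) * (bb * sqrt ab * sqrt (real D)) \<le> e\<^sup>2"
  proof -
    have sn: "sqrt (real n) / real n = 1 / sqrt (real n)" using n0 by (simp add: field_simps)
    have "bb * sqrt ab = sqrt (bb\<^sup>2 * ab)" using pos by (simp add: real_sqrt_mult)
    also have "\<dots> \<le> sqrt (A_plus * (real n / lam\<^sup>2))" using D(3) by (rule real_sqrt_le_mono)
    also have "\<dots> = sqrt A_plus * sqrt (real n) / lam" using lam0 by (simp add: real_sqrt_mult real_sqrt_divide)
    finally have "c1 * (lam / real n) * (bb * sqrt ab * sqrt (real D))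
      \<le> c1 * (lam / real n) * (sqrt A_plus * sqrt (real n) / lam * sqrt (real D))"
      using pos lam0 by (intro mult_left_mono mult_right_mono) auto
    also have "\<dots> = (c1 * sqrt A_plus) * (sqrt (real D) * (sqrt (real n) / real n))"
      using lam0 by simp
    also have "\<dots> = (c1 * sqrt A_plus) * (sqrt (real D) / sqrt (real n))"
      by (simp add: sn)
    also have "\<dots> \<le> sqrt lam * (sqrt (real D) / sqrt (real n))"
    proof (intro mult_right_mono)
      have "sqrt (c1\<^sup>2 * A_plus) \<le> sqrt lam" using lam(5) by (rule real_sqrt_le_mono)
      then show "c1 * sqrt A_plus \<le> sqrt lam" using pos by (simp add: real_sqrt_mult)
    qed simp
    also have "\<dots> = sqrt y" by (simp add: y_def real_sqrt_mult real_sqrt_divide)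
    also have "\<dots> \<le> e\<^sup>2" by (rule ex(2))
    finally show ?thesis .
  qed
qed

text \<open>With \<open>t = (\<alpha> + 4) ln n\<close>, the surplus \<open>n^(-4)\<close> pays for
  the events, whose number is at most quadratic in \<open>n\<close> because \<open>D <= n\<close>.
  For \<open>n >= 2\<close> even \<open>12 n^2 <= 5 n^4\<close>.\<close>

lemma failure_probability:
  fixes n D :: nat
  assumes "n \<ge> 2" "D \<le> n" "\<alpha> > 0"
  shows "(2 * (real D)\<^sup>2 + 4 * real n + 6) * exp (- ((\<alpha> + 4) * ln (real n))) \<le> 5 * real n powr (- \<alpha>)"
proof -
  have n: "real n \<ge> 2" using assms by simp
  have e: "exp (- ((\<alpha> + 4) * ln (real n))) = real n powr (- \<alpha>) * real n powr (- 4)"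
    using n by (simp add: powr_def exp_add[symmetric] algebra_simps)
  have p: "real n powr (- 4) = 1 / (real n)^4"
    using n powr_realpow[of "real n" 4] by (simp add: powr_minus_divide)
  have "2 * (real D)\<^sup>2 + 4 * real n + 6 \<le> 2 * (real n)\<^sup>2 + 4 * (real n)\<^sup>2 + 6 * (real n)\<^sup>2"
  proof -
    have "(real D)\<^sup>2 \<le> (real n)\<^sup>2" using assms(2) by (intro power_mono) auto
    moreover have "real n * 1 \<le> real n * real n" "1 * 1 \<le> real n * real n"
      using n by (intro mult_mono; simp)+
    ultimately show ?thesis unfolding power2_eq_square by linarith
  qed
  also have "\<dots> \<le> 5 * (real n)^4"
  proof -
    have "2 * 2 * (real n)\<^sup>2 \<le> real n * real n * (real n)\<^sup>2" using n by (intro mult_right_mono mult_mono) auto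
    moreover have "0 \<le> (real n)\<^sup>2" by simp
    ultimately show ?thesis unfolding power4_eq_xxxx power2_eq_square by linarith
  qed
  finally have "(2 * (real D)\<^sup>2 + 4 * real n + 6) * (1 / (real n)^4) \<le> 5 * (real n)^4 * (1 / (real n)^4)"
    by (rule mult_right_mono) simp
  also have "\<dots> = 5" using n by simp
  finally have "(2 * (real D)\<^sup>2 + 4 * real n + 6) * (1 / (real n)^4) * real n powr (- \<alpha>) \<le> 5 * real n powr (- \<alpha>)"
    by (rule mult_right_mono) simp
  then show ?thesis unfolding e p by (simp add: mult_ac)
qed

text \<open>\<open>\<Lambda>\<close> converts the unit \<open>L^2 N / n\<close> into
  \<open>C / n\<close>, by \<open>L = 2 A\<close>, \<open>N = K D\<close> and
  \<open>C >= \<sigma>_min^2 D\<close>. With \<open>\<rho> <= \<kappa> e^2\<close>, the two errors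
  are at most \<open>8 + 61 \<kappa>\<close> times \<open>e\<close> and \<open>e^2\<close>. The
  summand 1 in \<open>L\<^sub>0\<close> ensures \<open>L\<^sub>0 <= L\<^sub>0^2\<close>, so one
  constant serves both risks.\<close>

lemma regression_concentration:
  fixes n :: nat and s_hat :: "(nat \<Rightarrow> point \<times> real) \<Rightarrow> point \<Rightarrow> real"
  fixes A_minus A_plus \<alpha> A \<sigma>_min r Ac K \<tau> \<kappa> c1 \<Lambda> L\<^sub>0 :: real
  assumes model: "regression_model d X Q s_star \<sigma> m D \<phi> b parts a s_m A \<sigma>_min r Ac"
    and S: "S = design_space d X" and P: "P = regression_law S Q s_star \<sigma>"
    and est: "least_squares_estimator S P m n s_hat"
    and const: "K = Ac * r^4" "\<tau> = \<alpha> + 4" "\<kappa> = sqrt (\<tau> / K) + sqrt (K * \<tau>)"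
      "c1 = Ac\<^sup>2 * (2 * r + 4 * r\<^sup>2)\<^sup>2 * \<tau> * (2 * r)" "\<Lambda> = 4 * A\<^sup>2 * K / \<sigma>_min\<^sup>2"
      "L\<^sub>0 = 1 + \<Lambda> * (8 + 61 * \<kappa>)"
    and pos: "A_minus > 0" "A_plus > 0" "\<alpha> > 0" and n: "n \<ge> 2"
    and D: "A_minus * (ln (real n))\<^sup>2 \<le> real D" "real D \<le> A_plus * (real n / (ln (real n))\<^sup>2)"
      "(real b)\<^sup>2 * a b \<le> A_plus * (real n / (ln (real n))\<^sup>2)"
    and large: "ln (real n) \<ge> 1" "ln (real n) \<ge> (1 / A_minus + A_plus) * (16 * \<kappa>)\<^sup>2"
      "ln (real n) \<ge> (1 / A_minus + A_plus) * 64\<^sup>2"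
      "ln (real n) \<ge> A_plus * \<tau>" "ln (real n) \<ge> c1\<^sup>2 * A_plus"
  defines "C \<equiv> model_complexity P D \<phi> s_m"
    and "\<epsilon> \<equiv> L\<^sub>0 * max ((ln (real n) / real D) powr (1/4)) ((real D * ln (real n) / real n) powr (1/4))"
  shows "\<P>(z in sample_law n P. (1 - \<epsilon>) * (C / real n) \<le> excess_risk P s_m (s_hat z) \<and>
        excess_risk P s_m (s_hat z) \<le> (1 + \<epsilon>) * (C / real n)) \<ge> 1 - 5 * real n powr (- \<alpha>)" (is ?A)
    and "\<P>(z in sample_law n P. (1 - \<epsilon>\<^sup>2) * (C / real n) \<le> empirical_excess_risk n z (s_hat z) s_m \<and>
        empirical_excess_risk n z (s_hat z) s_m \<le> (1 + \<epsilon>\<^sup>2) * (C / real n)) \<ge> 1 - 5 * real n powr (- \<alpha>)" (is ?B)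
proof -
  interpret R: regression_model d X Q s_star \<sigma> m D \<phi> b parts a s_m A \<sigma>_min r Ac S P "design_law S P"
    using model unfolding S P .
  define lam where "lam = ln (real n)"
  define t where "t = \<tau> * lam"
  define e where "e = max ((lam / real D) powr (1/4)) ((real D * lam / real n) powr (1/4))"
  have n0: "real n > 0" "n > 0" using n by auto
  have \<tau>: "\<tau> \<ge> 4" using const pos by simp
  have K: "K > 0" using const(1) R.Ac_pos R.r_pos by simp
  have c1: "c1 \<ge> 0" using const(4) \<tau> R.r_pos by simp
  have ab: "a b \<ge> 1" using R.a_ge_1[of b] R.b_ge_1 by simp
  have b1: "real b \<ge> 1" using R.b_ge_1 by simp
  have \<tau>1: "\<tau> \<ge> 1" using \<tau> by simp
  note B = large_sample_bounds[OF pos(1,2) K \<tau>1 c1 b1 ab n0(2) D large(1) large(2)[unfolded const(3)] large(3-5),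
      folded lam_def, folded e_def const(3)]
  have N: "R.N = K * real D" by (simp add: R.N_def const(1))
  define \<rho> where "\<rho> = sqrt (t / R.N) + sqrt (R.N * t / real n)"
  have \<rho>: "\<rho> \<le> \<kappa> * e\<^sup>2" unfolding \<rho>_def N t_def by (rule B(4))
  have \<rho>16: "sqrt (t / R.N) + sqrt (R.N * t / real n) \<le> 1 / 16"
    using \<rho> B(5) unfolding \<rho>_def by linarith
  have e0: "0 \<le> e" using B(2) by simp
  have t1: "t \<ge> 1"
    using mult_mono[of 1 \<tau> 1 lam] \<tau> large(1) by (simp add: t_def lam_def)
  have op: "Ac\<^sup>2 * ((2 * r + 4 * r\<^sup>2)\<^sup>2 * (t / real n)) * (2 * real b * sqrt (a b) * (r * sqrt (real D))) \<le> e\<^sup>2"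
  proof -
    have eq: "Ac\<^sup>2 * ((2 * r + 4 * r\<^sup>2)\<^sup>2 * (t / real n)) * (2 * real b * sqrt (a b) * (r * sqrt (real D)))
      = c1 * (lam / real n) * (real b * sqrt (a b) * sqrt (real D))"
      by (simp add: const(4) t_def mult_ac)
    show ?thesis unfolding eq by (rule B(7))
  qed
  have at: "a b * t \<le> real n" using B(6) by (simp add: t_def)
  have W: "whp (sample_law n P) (5 * real n powr (- \<alpha>)) (\<lambda>z.
      \<bar>excess_risk P s_m (s_hat z) - C / real n\<bar> \<le> R.L\<^sup>2 * R.N / real n * (8 * e + 11 * \<rho>) \<and>
      \<bar>empirical_excess_risk n z (s_hat z) s_m - C / real n\<bar> \<le> R.L\<^sup>2 * R.N / real n * (4 * e\<^sup>2 + 61 * \<rho>))"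
  proof (rule whp_mono)
    show "whp (sample_law n P) ((2 * (real D)\<^sup>2 + 4 * real n + 6) * exp (- t)) (\<lambda>z.
      \<bar>excess_risk P s_m (s_hat z) - C / real n\<bar> \<le> R.L\<^sup>2 * R.N / real n * (8 * e + 11 * \<rho>) \<and>
      \<bar>empirical_excess_risk n z (s_hat z) s_m - C / real n\<bar> \<le> R.L\<^sup>2 * R.N / real n * (4 * e\<^sup>2 + 61 * \<rho>))"
      unfolding C_def \<rho>_def
      by (rule R.estimator_concentration[OF n0(2) t1 \<rho>16 at op e0 B(3) est])
    show "(2 * (real D)\<^sup>2 + 4 * real n + 6) * exp (- t) \<le> 5 * real n powr (- \<alpha>)"
      using failure_probability[OF n _ pos(3), of D] B(8) by (simp add: t_def lam_def const(2))
  qed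
  have LN: "R.L\<^sup>2 * R.N / real n \<le> \<Lambda> * (C / real n)"
  proof -
    have "R.L\<^sup>2 * R.N = \<Lambda> * (\<sigma>_min\<^sup>2 * real D)"
      using R.\<sigma>_min_pos by (simp add: R.L_def N const(5) power_mult_distrib)
    also have "\<dots> \<le> \<Lambda> * C"
      unfolding C_def using R.complexity_ge K by (intro mult_left_mono) (auto simp: const(5))
    finally show ?thesis using n0 by (simp add: divide_right_mono)
  qed
  have C0: "0 \<le> C / real n"
    using R.complexity_ge n0 unfolding C_def by (metis divide_nonneg_nonneg less_imp_le mult_nonneg_nonneg of_nat_0_le_iff order_trans zero_le_power2)
  have \<kappa>0: "\<kappa> \<ge> 0" unfolding const(3) using K \<tau> by simp
  have \<Lambda>0: "\<Lambda> \<ge> 0" using K by (simp add: const(5))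
  have L0: "L\<^sub>0 \<ge> 1" "\<Lambda> * (8 + 61 * \<kappa>) \<le> L\<^sub>0" using \<Lambda>0 \<kappa>0 by (auto simp: const(6))
  have \<epsilon>: "\<epsilon> = L\<^sub>0 * e" by (simp add: \<epsilon>_def e_def lam_def)
  have rel: "R.L\<^sup>2 * R.N / real n * w \<le> v * (C / real n)" if "0 \<le> w" "\<Lambda> * w \<le> v" for w v
  proof -
    have "R.L\<^sup>2 * R.N / real n * w \<le> \<Lambda> * (C / real n) * w" using LN that(1) by (rule mult_right_mono)
    also have "\<dots> = \<Lambda> * w * (C / real n)" by simp
    also have "\<dots> \<le> v * (C / real n)" using that(2) C0 by (rule mult_right_mono)
    finally show ?thesis .
  qed
  have e2: "e\<^sup>2 \<le> e"
    using B(3) e0 mult_left_mono[of e 1 e] by (simp add: power2_eq_square)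
  have \<rho>0: "0 \<le> \<rho>" unfolding \<rho>_def N using K t1 by simp
  have r1: "R.L\<^sup>2 * R.N / real n * (8 * e + 11 * \<rho>) \<le> \<epsilon> * (C / real n)"
  proof (rule rel)
    show "0 \<le> 8 * e + 11 * \<rho>" using e0 \<rho>0 by simp
    have "\<kappa> * e\<^sup>2 \<le> \<kappa> * e" using e2 \<kappa>0 by (rule mult_left_mono)
    then have "8 * e + 11 * \<rho> \<le> (8 + 61 * \<kappa>) * e"
      using \<rho> \<rho>0 by (simp add: distrib_right)
    then have "\<Lambda> * (8 * e + 11 * \<rho>) \<le> \<Lambda> * ((8 + 61 * \<kappa>) * e)" using \<Lambda>0 by (rule mult_left_mono)
    also have "\<dots> = \<Lambda> * (8 + 61 * \<kappa>) * e" by simp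
    also have "\<dots> \<le> \<epsilon>" unfolding \<epsilon> using L0(2) e0 by (rule mult_right_mono)
    finally show "\<Lambda> * (8 * e + 11 * \<rho>) \<le> \<epsilon>" .
  qed
  have r2: "R.L\<^sup>2 * R.N / real n * (4 * e\<^sup>2 + 61 * \<rho>) \<le> \<epsilon>\<^sup>2 * (C / real n)"
  proof (rule rel)
    show "0 \<le> 4 * e\<^sup>2 + 61 * \<rho>" using \<rho>0 by simp
    have "4 * e\<^sup>2 + 61 * \<rho> \<le> (8 + 61 * \<kappa>) * e\<^sup>2"
      unfolding distrib_right using \<rho> zero_le_power2[of e] by linarith
    then have "\<Lambda> * (4 * e\<^sup>2 + 61 * \<rho>) \<le> \<Lambda> * ((8 + 61 * \<kappa>) * e\<^sup>2)" using \<Lambda>0 by (rule mult_left_mono)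
    also have "\<dots> = \<Lambda> * (8 + 61 * \<kappa>) * e\<^sup>2" by simp
    also have "\<dots> \<le> L\<^sub>0 * e\<^sup>2" using L0(2) by (rule mult_right_mono) simp
    also have "\<dots> \<le> L\<^sub>0\<^sup>2 * e\<^sup>2"
      using L0(1) by (intro mult_right_mono) (simp_all add: power2_eq_square)
    also have "\<dots> = \<epsilon>\<^sup>2" by (simp add: \<epsilon> power_mult_distrib)
    finally show "\<Lambda> * (4 * e\<^sup>2 + 61 * \<rho>) \<le> \<epsilon>\<^sup>2" .
  qed
  have int: "(1 - w) * c \<le> y \<and> y \<le> (1 + w) * c" if "\<bar>y - c\<bar> \<le> U" "U \<le> w * c" for y c w U :: real
    using that unfolding left_diff_distrib distrib_right by linarith
  have Pn: "prob_space (sample_law n P)"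
    unfolding sample_law_def by (intro prob_space_PiM R.P.prob_space_axioms)
  note [measurable] = R.risks_measurable[OF est]
  show ?A
    by (rule whp_prob[OF Pn whp_mono[OF W]]) (use int[OF _ r1] in \<open>blast\<close>, simp, measurable)
  show ?B
    by (rule whp_prob[OF Pn whp_mono[OF W]]) (use int[OF _ r2] in \<open>blast\<close>, simp, measurable)
qed

text \<open>The order of quantifiers carries the dependence of the constants:
  \<open>L\<^sub>0\<close> is chosen before \<open>A_plus\<close>, \<open>n\<^sub>0\<close> after
  it, and both before the dimension, the law, the model and the estimator. The overlap constant
  \<open>A\<^sub>c\<close> is fixed in advance together with \<open>r\<close>.\<close>

theorem theorem5p2:
  fixes A_minus \<alpha> A \<sigma>_min r A\<^sub>c :: real
  assumes "A_minus > 0" "\<alpha> > 0" "A > 0" "\<sigma>_min > 0" "r > 0" "A\<^sub>c > 0"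
  shows "\<exists>L\<^sub>0>0. \<forall>A_plus>0. \<exists>n\<^sub>0. \<forall>n\<ge>n\<^sub>0.
    \<forall>(d::nat) (\<X> :: point set) (Q :: (point \<times> real) measure)
      (s_star :: point \<Rightarrow> real) (\<sigma> :: point \<Rightarrow> real)
      (m :: (point \<Rightarrow> real) set) (D::nat) (\<phi> :: nat \<Rightarrow> point \<Rightarrow> real)
      (b::nat) (parts :: nat \<Rightarrow> nat set) (a :: nat \<Rightarrow> real)
      (s\<^sub>m :: point \<Rightarrow> real) (s_hat :: (nat \<Rightarrow> point \<times> real) \<Rightarrow> point \<Rightarrow> real).
    let S = design_space d \<X>;
        P = regression_law S Q s_star \<sigma>;
        PX = design_law S P;
        \<epsilon>\<^sub>n = L\<^sub>0 * max ((ln (real n) / real D) powr (1/4)) ((real D * ln (real n) / real n) powr (1/4));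
        C = model_complexity P D \<phi> s\<^sub>m
    in
      \<X> \<subseteq> space (PiM {..<d} (\<lambda>_. borel :: real measure)) \<longrightarrow>
      noise_law S Q \<longrightarrow>
      s_star \<in> L2_fun PX \<longrightarrow>
      \<sigma> \<in> borel_measurable S \<longrightarrow> (\<forall>x\<in>\<X>. \<sigma> x \<ge> 0) \<longrightarrow>
      linear_L2_subspace PX m \<longrightarrow>
      strongly_localized_basis PX m D \<phi> r b parts a A\<^sub>c \<longrightarrow>
      orthogonal_projection_on PX m s_star s\<^sub>m \<longrightarrow>
      least_squares_estimator S P m n s_hat \<longrightarrow>
      (AE (x, y) in P. \<bar>y\<bar> \<le> A) \<longrightarrow>
      sup_norm \<X> s\<^sub>m \<le> ereal A \<longrightarrow>
      (AE x in PX. \<sigma> x \<ge> \<sigma>_min) \<longrightarrow>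
      A_minus * (ln (real n))\<^sup>2 \<le> real D \<longrightarrow>
      max (real D) ((real b)\<^sup>2 * a b) \<le> A_plus * (real n / (ln (real n))\<^sup>2) \<longrightarrow>
        \<P>(z in sample_law n P. (1 - \<epsilon>\<^sub>n) * (C / real n) \<le> excess_risk P s\<^sub>m (s_hat z) \<and>
              excess_risk P s\<^sub>m (s_hat z) \<le> (1 + \<epsilon>\<^sub>n) * (C / real n))
          \<ge> 1 - 10 * real n powr (- \<alpha>) \<and>
        \<P>(z in sample_law n P. (1 - \<epsilon>\<^sub>n\<^sup>2) * (C / real n) \<le> empirical_excess_risk n z (s_hat z) s\<^sub>m \<and>
              empirical_excess_risk n z (s_hat z) s\<^sub>m \<le> (1 + \<epsilon>\<^sub>n\<^sup>2) * (C / real n))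
          \<ge> 1 - 5 * real n powr (- \<alpha>)"
proof -
  define K where "K = A\<^sub>c * r^4"
  define \<tau> where "\<tau> = \<alpha> + 4"
  define \<kappa> where "\<kappa> = sqrt (\<tau> / K) + sqrt (K * \<tau>)"
  define c1 where "c1 = A\<^sub>c\<^sup>2 * (2 * r + 4 * r\<^sup>2)\<^sup>2 * \<tau> * (2 * r)"
  define \<Lambda> where "\<Lambda> = 4 * A\<^sup>2 * K / \<sigma>_min\<^sup>2"
  define L\<^sub>0 where "L\<^sub>0 = 1 + \<Lambda> * (8 + 61 * \<kappa>)"
  have K: "K > 0" and \<tau>: "\<tau> \<ge> 4" using assms by (auto simp: K_def \<tau>_def)
  have "\<kappa> \<ge> 0" "\<Lambda> \<ge> 0" using K \<tau> by (auto simp: \<kappa>_def \<Lambda>_def)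
  then have L0: "L\<^sub>0 > 0" by (simp add: L\<^sub>0_def add_pos_nonneg)
  have main: "\<exists>n\<^sub>0. \<forall>n\<ge>n\<^sub>0. n \<ge> 2 \<and> ln (real n) \<ge> 1 \<and> ln (real n) \<ge> (1 / A_minus + A_plus) * (16 * \<kappa>)\<^sup>2
      \<and> ln (real n) \<ge> (1 / A_minus + A_plus) * 64\<^sup>2 \<and> ln (real n) \<ge> A_plus * \<tau> \<and> ln (real n) \<ge> c1\<^sup>2 * A_plus"
    for A_plus :: real
  proof -
    have "filterlim (\<lambda>n. ln (real n)) at_top sequentially"
      by (rule filterlim_compose[OF ln_at_top filterlim_real_sequentially])
    then have "eventually (\<lambda>n. ln (real n) \<ge> c) sequentially" for c
      by (simp add: filterlim_at_top)
    then show ?thesis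
      unfolding eventually_sequentially[symmetric] by (intro eventually_conj eventually_ge_at_top)
  qed
  show ?thesis
    unfolding Let_def
  proof (intro exI[of _ L\<^sub>0] conjI[OF L0] allI impI, goal_cases)
    case (1 A_plus)
    from main[of A_plus] obtain n\<^sub>0 where n\<^sub>0: "\<And>n. n \<ge> n\<^sub>0 \<Longrightarrow> n \<ge> 2" "\<And>n. n \<ge> n\<^sub>0 \<Longrightarrow> ln (real n) \<ge> 1"
      "\<And>n. n \<ge> n\<^sub>0 \<Longrightarrow> ln (real n) \<ge> (1 / A_minus + A_plus) * (16 * \<kappa>)\<^sup>2"
      "\<And>n. n \<ge> n\<^sub>0 \<Longrightarrow> ln (real n) \<ge> (1 / A_minus + A_plus) * 64\<^sup>2"
      "\<And>n. n \<ge> n\<^sub>0 \<Longrightarrow> ln (real n) \<ge> A_plus * \<tau>" "\<And>n. n \<ge> n\<^sub>0 \<Longrightarrow> ln (real n) \<ge> c1\<^sup>2 * A_plus"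
      by blast
    show ?case
    proof (intro exI[of _ n\<^sub>0] allI impI, goal_cases)
      case (1 n d \<X> Q s_star \<sigma> m D \<phi> b parts a s\<^sub>m s_hat)
      note h = this and n = n\<^sub>0[OF this(1)]
      \<comment> \<open>\<open>ln n >= 1\<close> makes the lower bound on \<open>D\<close> positive
        and so excludes the zero-dimensional model.\<close>
      have "A_minus * (ln (real n))\<^sup>2 > 0" using n(2) assms(1) by simp
      then have D: "D \<ge> 1" using h(14) by simp
      have model: "regression_model d \<X> Q s_star \<sigma> m D \<phi> b parts a s\<^sub>m A \<sigma>_min r A\<^sub>c"
        by (rule regression_model.intro) (use h(2-5) h(7-9) h(11-13) assms(3,4) D in \<open>simp_all\<close>)
      have D2: "real D \<le> A_plus * (real n / (ln (real n))\<^sup>2)" "(real b)\<^sup>2 * a b \<le> A_plus * (real n / (ln (real n))\<^sup>2)"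
        using h(15) by simp_all
      note * = regression_concentration[OF model refl refl h(10) K_def \<tau>_def \<kappa>_def c1_def \<Lambda>_def L\<^sub>0_def
          assms(1) \<open>A_plus > 0\<close> assms(2) n(1) h(14) D2 n(2-6)]
      show ?case
        \<comment> \<open>Both probabilities are obtained with the factor 5; the first one is
          relaxed to 10.\<close>
        using * by (intro conjI order_trans[OF _ *(1)]) auto
    qed
  qed
qed

end
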